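(* Let $\lambda\in\mathbb{C}$, let $(m_k)_{k\in\mathbb{N}}$ be a sequence of positive integers, let $J=\bigoplus_{k=1}^\infty J_{m_k}(\lambda)\in\mathcal{B}(\ell^2(\mathbb{N}))$, and let $m=\sup\{m_k:\ k\in\mathbb{N}\}$. Then, up to $*$-isomorphism, \[ C^*_{\rm e}(\mathcal{OS}(J))=\begin{cases}C(\mathbb{T}),&\text{if }m=\infty,\\ M_m(\mathbb{C}),&\text{if } m<\infty.\end{cases} \]
   Context: $J_m(\lambda)\in M_m(\mathbb{C})$ is the basic Jordan block of size $m\ge1$ with $\lambda$ on the diagonal, $1$ on the first superdiagonal and $0$ elsewhere. $\ell^2(\mathbb{N})$ is identified with $\bigoplus_{k}\mathbb{C}^{m_k}$, and $\mathbb{T}$ is the unit circle. For a bounded operator $T$ on a complex Hilbert space $\mathcal{H}$, $\mathcal{OS}(T)=\mathrm{span}\{1,T,T^*\}\subset\mathcal{B}(\mathcal{H})$, and $C^*(T)$ is the unital C$^*$-algebra generated by $\mathcal{OS}(T)$. The C$^*$-envelope is $C^*_{\rm e}(\mathcal{OS}(T))=C^*(T)/\mathfrak{S}$, where $\mathfrak{S}$ is the Šilov ideal, i.e. the largest closed two-sided ideal $\mathcal{K}$ of $C^*(T)$ such that the quotient map $C^*(T)\to C^*(T)/\mathcal{K}$ is completely isometric on $\mathcal{OS}(T)$. Equivalently, $\mathfrak{S}$ is the intersection of the kernels of all boundary representations for $\mathcal{OS}(T)$, where a boundary representation is an irreducible unital $*$-representation $\rho:C^*(T)\to\mathcal{B}(\mathcal{H}_\rho)$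 such that $\rho$ is the unique unital completely positive extension of $\rho|_{\mathcal{OS}(T)}$ to $C^*(T)$. *)

theory Defs
  imports
    "HOL-Analysis.Analysis"
    "HOL-Library.Extended_Nat"
    "HOL-Algebra.QuotRing"
    "Jordan_Normal_Form.Jordan_Normal_Form"
    "Jordan_Normal_Form.Schur_Decomposition"
begin

typedef ell2 = "{x :: nat \<Rightarrow> complex. summable (\<lambda>n. (norm (x n))\<^sup>2)}"
  morphisms coord Abs_ell2
  by (rule exI[of _ "\<lambda>_. 0"]) simp

setup_lifting type_definition_ell2

lemma coord_square_summable: "summable (\<lambda>n. (norm (coord x n))\<^sup>2)"
  using coord[of x] by simp

lemma summable_square_add:
  fixes x y :: "nat \<Rightarrow> complex"
  assumes "summable (\<lambda>n. (norm (x n))\<^sup>2)" "summable (\<lambda>n. (norm (y n))\<^sup>2)"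
  shows "summable (\<lambda>n. (norm (x n + y n))\<^sup>2)"
proof (rule summable_comparison_test')
  show "summable (\<lambda>n. 2 * (norm (x n))\<^sup>2 + 2 * (norm (y n))\<^sup>2)"
    using assms by (intro summable_add summable_mult)
  fix n
  have "(norm (x n + y n))\<^sup>2 \<le> (norm (x n) + norm (y n))\<^sup>2"
    by (intro power_mono norm_triangle_ineq) simp
  also have "\<dots> \<le> 2 * (norm (x n))\<^sup>2 + 2 * (norm (y n))\<^sup>2"
    using sum_squares_bound[of "norm (x n)" "norm (y n)"] by (simp add: power2_sum)
  finally show "norm ((norm (x n + y n))\<^sup>2) \<le> 2 * (norm (x n))\<^sup>2 + 2 * (norm (y n))\<^sup>2"
    by simp
qed

lemma summable_square_scale:
  fixes x :: "nat \<Rightarrow> complex"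
  assumes "summable (\<lambda>n. (norm (x n))\<^sup>2)"
  shows "summable (\<lambda>n. (norm (c * x n))\<^sup>2)"
  using summable_mult[OF assms, of "(norm c)\<^sup>2"] by (simp add: norm_mult power_mult_distrib)

lemma summable_inner_ell2:
  fixes x y :: "nat \<Rightarrow> complex"
  assumes "summable (\<lambda>n. (norm (x n))\<^sup>2)" "summable (\<lambda>n. (norm (y n))\<^sup>2)"
  shows "summable (\<lambda>n. inner (x n) (y n))"
proof (rule summable_comparison_test')
  show "summable (\<lambda>n. (norm (x n))\<^sup>2 + (norm (y n))\<^sup>2)"
    using assms by (rule summable_add)
  fix n
  have "norm (inner (x n) (y n)) \<le> norm (x n) * norm (y n)"
    using Cauchy_Schwarz_ineq2 by simp
  also have "\<dots> \<le> (norm (x n))\<^sup>2 + (norm (y n))\<^sup>2"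
    using sum_squares_bound[of "norm (x n)" "norm (y n)"]
      mult_nonneg_nonneg[OF norm_ge_zero[of "x n"] norm_ge_zero[of "y n"]] by linarith
  finally show "norm (inner (x n) (y n)) \<le> (norm (x n))\<^sup>2 + (norm (y n))\<^sup>2" .
qed

instantiation ell2 :: real_inner
begin

lift_definition zero_ell2 :: ell2 is "\<lambda>_. 0" by simp

lift_definition plus_ell2 :: "ell2 \<Rightarrow> ell2 \<Rightarrow> ell2" is "\<lambda>x y n. x n + y n"
  by (rule summable_square_add)

lift_definition uminus_ell2 :: "ell2 \<Rightarrow> ell2" is "\<lambda>x n. - x n" by simp

lift_definition minus_ell2 :: "ell2 \<Rightarrow> ell2 \<Rightarrow> ell2" is "\<lambda>x y n. x n - y n"
  using summable_square_add[where y = "\<lambda>n. - y n" for y] by fastforce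

lift_definition scaleR_ell2 :: "real \<Rightarrow> ell2 \<Rightarrow> ell2" is "\<lambda>r x n. r *\<^sub>R x n"
  unfolding scaleR_conv_of_real by (rule summable_square_scale)

text \<open>The underlying real inner product, i.e. the real part of the complex one.\<close>

definition inner_ell2 :: "ell2 \<Rightarrow> ell2 \<Rightarrow> real"
  where "inner_ell2 x y = (\<Sum>n. inner (coord x n) (coord y n))"

definition norm_ell2 :: "ell2 \<Rightarrow> real" where "norm_ell2 x = sqrt (inner x x)"
definition sgn_ell2 :: "ell2 \<Rightarrow> ell2" where "sgn_ell2 x = inverse (norm x) *\<^sub>R x"
definition dist_ell2 :: "ell2 \<Rightarrow> ell2 \<Rightarrow> real" where "dist_ell2 x y = norm (x - y)"
definition uniformity_ell2 :: "(ell2 \<times> ell2) filter"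
  where "uniformity_ell2 = (INF e\<in>{0<..}. principal {(x, y). dist x y < e})"
definition open_ell2 :: "ell2 set \<Rightarrow> bool"
  where "open_ell2 U = (\<forall>x\<in>U. eventually (\<lambda>(x', y). x' = x \<longrightarrow> y \<in> U) uniformity)"

instance
proof
  fix x y z :: ell2 and a b r :: real and U :: "ell2 set"
  note summ = summable_inner_ell2[OF coord_square_summable coord_square_summable]
  show "x + y + z = x + (y + z)" "x + y = y + x" "0 + x = x" "- x + x = 0" "x - y = x + - y"
    by (simp_all add: coord_inject[symmetric] plus_ell2.rep_eq zero_ell2.rep_eq
        uminus_ell2.rep_eq minus_ell2.rep_eq fun_eq_iff)
  show "a *\<^sub>R (x + y) = a *\<^sub>R x + a *\<^sub>R y" "(a + b) *\<^sub>R x = a *\<^sub>R x + b *\<^sub>R x"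
    "a *\<^sub>R b *\<^sub>R x = (a * b) *\<^sub>R x" "1 *\<^sub>R x = x"
    by (simp_all add: coord_inject[symmetric] plus_ell2.rep_eq scaleR_ell2.rep_eq fun_eq_iff
        scaleR_add_right scaleR_add_left)
  show "dist x y = norm (x - y)" by (rule dist_ell2_def)
  show "sgn x = inverse (norm x) *\<^sub>R x" by (rule sgn_ell2_def)
  show "uniformity = (INF e\<in>{0<..}. principal {(x :: ell2, y). dist x y < e})"
    by (rule uniformity_ell2_def)
  show "open U = (\<forall>x\<in>U. \<forall>\<^sub>F (x', y) in uniformity. x' = x \<longrightarrow> y \<in> U)"
    by (rule open_ell2_def)
  show "norm x = sqrt (inner x x)" by (rule norm_ell2_def)
  show "inner x y = inner y x" by (simp add: inner_ell2_def inner_commute)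
  show "inner (x + y) z = inner x z + inner y z"
    unfolding inner_ell2_def plus_ell2.rep_eq inner_add_left
    by (rule suminf_add[OF summ summ, symmetric])
  show "inner (r *\<^sub>R x) y = r * inner x y"
    unfolding inner_ell2_def scaleR_ell2.rep_eq inner_scaleR_left
    by (rule suminf_mult[OF summ])
  show "0 \<le> inner x x"
    unfolding inner_ell2_def by (rule suminf_nonneg[OF summ]) simp
  show "(inner x x = 0) = (x = 0)"
  proof -
    have "(inner x x = 0) = (\<forall>n. inner (coord x n) (coord x n) = 0)"
      unfolding inner_ell2_def by (rule suminf_eq_zero_iff[OF summ]) simp
    then show ?thesis by (auto simp: coord_inject[symmetric] zero_ell2.rep_eq)
  qed
qed

end

lemma norm_ell2_eq: "norm x = sqrt (\<Sum>n. (norm (coord x n))\<^sup>2)"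
  by (simp add: norm_ell2_def inner_ell2_def power2_norm_eq_inner)

lift_definition cscale :: "complex \<Rightarrow> ell2 \<Rightarrow> ell2" is "\<lambda>c x n. c * x n"
  by (rule summable_square_scale)

lemma norm_cscale: "norm (cscale c x) = norm c * norm x"
proof -
  have "(\<Sum>n. (norm (c * coord x n))\<^sup>2) = (norm c)\<^sup>2 * (\<Sum>n. (norm (coord x n))\<^sup>2)"
    using suminf_mult[OF coord_square_summable[of x], of "(norm c)\<^sup>2"]
    by (simp add: norm_mult power_mult_distrib)
  then show ?thesis by (simp add: norm_ell2_eq cscale.rep_eq real_sqrt_mult)
qed

lemma bounded_linear_cscale: "bounded_linear (cscale c)"
proof (rule bounded_linear_intro)
  show "cscale c (x + y) = cscale c x + cscale c y" for x y
    by transfer (simp add: algebra_simps)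
  show "cscale c (r *\<^sub>R x) = r *\<^sub>R cscale c x" for r x
    by transfer simp
  show "norm (cscale c x) \<le> norm x * norm c" for x
    by (simp add: norm_cscale)
qed

definition cinner :: "ell2 \<Rightarrow> ell2 \<Rightarrow> complex"
  where "cinner x y = (\<Sum>n. coord x n * cnj (coord y n))"

text \<open>
  Elements of \<^typ>\<open>ell2 \<Rightarrow>\<^sub>L ell2\<close> are the bounded real-linear maps, with the operator norm and
  composition \<^term>\<open>(o\<^sub>L)\<close>. The algebra of bounded operators on the complex Hilbert space is the
  subset of complex-linear ones.
\<close>

type_synonym oper = "ell2 \<Rightarrow>\<^sub>L ell2"

definition bounded_operators :: "oper set"
  where "bounded_operators = {T. \<forall>c x. blinfun_apply T (cscale c x) = cscale c (blinfun_apply T x)}"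

definition oscale :: "complex \<Rightarrow> oper \<Rightarrow> oper"
  where "oscale c T = Blinfun (\<lambda>x. cscale c (blinfun_apply T x))"

lemma oscale_apply: "blinfun_apply (oscale c T) x = cscale c (blinfun_apply T x)"
  unfolding oscale_def
  by (subst bounded_linear_Blinfun_apply)
    (rule bounded_linear_compose[OF bounded_linear_cscale blinfun.bounded_linear_right], rule refl)

definition adj :: "oper \<Rightarrow> oper"
  where "adj T = (THE S. \<forall>x y. cinner (blinfun_apply T x) y = cinner x (blinfun_apply S y))"

record 'a star_algebra = "'a ring" +
  scal :: "complex \<Rightarrow> 'a \<Rightarrow> 'a"
  star :: "'a \<Rightarrow> 'a"

definition star_isomorphic ::
    "('a, 'c) star_algebra_scheme \<Rightarrow> ('b, 'd) star_algebra_scheme \<Rightarrow> bool"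
  where "star_isomorphic A B \<longleftrightarrow>
    (\<exists>h \<in> ring_iso A B. \<forall>a \<in> carrier A.
       (\<forall>c. h (scal A c a) = scal B c (h a)) \<and> h (star A a) = star B (h a))"

text \<open>
  The quotient by a self-adjoint two-sided ideal. As in the multiplication of cosets, the
  coset of the result is formed explicitly; a plain image would be wrong for the scalar 0.
\<close>

definition quotient_algebra :: "'a star_algebra \<Rightarrow> 'a set \<Rightarrow> 'a set star_algebra"
  where "quotient_algebra A K =
    \<lparr> carrier = carrier (A Quot K), mult = mult (A Quot K), one = one (A Quot K),
      zero = zero (A Quot K), add = add (A Quot K),
      scal = (\<lambda>c X. \<Union>a\<in>X. K +>\<^bsub>A\<^esub> scal A c a),
      star = (\<lambda>X. \<Union>a\<in>X. K +>\<^bsub>A\<^esub> star A a) \<rparr>"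

definition matrix_algebra :: "nat \<Rightarrow> complex mat star_algebra"
  where "matrix_algebra n =
    \<lparr> carrier = carrier_mat n n, mult = (*), one = 1\<^sub>m n, zero = 0\<^sub>m n n, add = (+),
      scal = (\<lambda>c M. c \<cdot>\<^sub>m M), star = mat_adjoint \<rparr>"

text \<open>
  The continuous functions on a set of complex numbers, represented by
  functions that are \<^const>\<open>undefined\<close> outside that set.
\<close>

definition continuous_function_algebra :: "complex set \<Rightarrow> (complex \<Rightarrow> complex) star_algebra"
  where "continuous_function_algebra X =
    \<lparr> carrier = {f \<in> extensional X. continuous_on X f},
      mult = (\<lambda>f g. \<lambda>z\<in>X. f z * g z), one = (\<lambda>z\<in>X. 1),
      zero = (\<lambda>z\<in>X. 0), add = (\<lambda>f g. \<lambda>z\<in>X. f z + g z),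
      scal = (\<lambda>c f. \<lambda>z\<in>X. c * f z), star = (\<lambda>f. \<lambda>z\<in>X. cnj (f z)) \<rparr>"

definition operator_system :: "oper \<Rightarrow> oper set"
  where "operator_system T =
    {oscale a id_blinfun + oscale b T + oscale c (adj T) | a b c. True}"

definition cstar_subalgebra :: "oper set \<Rightarrow> bool"
  where "cstar_subalgebra A \<longleftrightarrow>
    A \<subseteq> bounded_operators \<and> id_blinfun \<in> A \<and> closed A \<and>
    (\<forall>S\<in>A. \<forall>T\<in>A. S + T \<in> A \<and> S o\<^sub>L T \<in> A) \<and>
    (\<forall>S\<in>A. adj S \<in> A \<and> (\<forall>c. oscale c S \<in> A))"

definition cstar :: "oper \<Rightarrow> oper star_algebra"
  where "cstar T =
    \<lparr> carrier = cstar_subalgebra hull operator_system T, mult = (o\<^sub>L), one = id_blinfun,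
      zero = 0, add = (+), scal = oscale, star = adj \<rparr>"

text \<open>
  An \<open>n \<times> n\<close> matrix over operators is a function on index pairs; only the entries with both
  indices below \<open>n\<close> matter. Its norm is the operator norm on the \<open>n\<close>-fold Hilbert sum.
\<close>

definition matrix_norm :: "nat \<Rightarrow> (nat \<Rightarrow> nat \<Rightarrow> oper) \<Rightarrow> real"
  where "matrix_norm n A =
    (SUP x \<in> {x. L2_set (\<lambda>j. norm (x j)) {..<n} \<le> 1}.
       L2_set (\<lambda>i. norm (\<Sum>j<n. blinfun_apply (A i j) (x j))) {..<n})"

text \<open>
  The C*-norm of \<open>n \<times> n\<close> matrices over a quotient \<open>A / K\<close>: it is the quotient norm of
  \<open>M\<^sub>n(A / K) = M\<^sub>n(A) / M\<^sub>n(K)\<close>, that is, the infimum of the norms of all representatives.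
\<close>

definition quotient_matrix_norm :: "nat \<Rightarrow> (nat \<Rightarrow> nat \<Rightarrow> oper set) \<Rightarrow> real"
  where "quotient_matrix_norm n X =
    (INF B \<in> {B. \<forall>i<n. \<forall>j<n. B i j \<in> X i j}. matrix_norm n B)"

definition completely_isometric_quotient :: "oper \<Rightarrow> oper set \<Rightarrow> bool"
  where "completely_isometric_quotient T K \<longleftrightarrow>
    (\<forall>n A. (\<forall>i<n. \<forall>j<n. A i j \<in> operator_system T) \<longrightarrow>
       quotient_matrix_norm n (\<lambda>i j. K +>\<^bsub>cstar T\<^esub> A i j) = matrix_norm n A)"

definition boundary_ideal :: "oper \<Rightarrow> oper set \<Rightarrow> bool"
  where "boundary_ideal T K \<longleftrightarrow>
    ideal K (cstar T) \<and> closed K \<and> completely_isometric_quotient T K"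

text \<open>
  The largest boundary ideal is unique if it exists; its existence for every operator is
  Hamana's theorem, which is not proved here.
\<close>

definition shilov_ideal :: "oper \<Rightarrow> oper set"
  where "shilov_ideal T =
    (THE S. boundary_ideal T S \<and> (\<forall>K. boundary_ideal T K \<longrightarrow> K \<subseteq> S))"

definition cstar_envelope :: "oper \<Rightarrow> oper set star_algebra"
  where "cstar_envelope T = quotient_algebra (cstar T) (shilov_ideal T)"

text \<open>
  The identification of the Hilbert space with the Hilbert sum of the spaces
  \<open>\<complex>\<^bsup>m k\<^esup>\<close>, \<open>k = 0, 1, \<dots>\<close>, lists the coordinates of the summands one after the other:
  coordinate \<open>i\<close> of summand \<open>k\<close> is coordinate \<open>block_start m k + i\<close> of the sequence.
\<close>

definition block_start :: "(nat \<Rightarrow> nat) \<Rightarrow> nat \<Rightarrow> nat"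
  where "block_start m k = (\<Sum>l<k. m l)"

definition block_index :: "(nat \<Rightarrow> nat) \<Rightarrow> nat \<Rightarrow> nat"
  where "block_index m n = (LEAST k. n < block_start m (Suc k))"

definition direct_sum_fun :: "(nat \<Rightarrow> complex mat) \<Rightarrow> (nat \<Rightarrow> complex) \<Rightarrow> nat \<Rightarrow> complex"
  where "direct_sum_fun A x n =
    (let m = (\<lambda>k. dim_row (A k)); k = block_index m n; s = block_start m k
     in \<Sum>j<m k. A k $$ (n - s, j) * x (s + j))"

text \<open>
  Meaningful for square matrices of positive size with uniformly bounded operator norms.
\<close>

definition direct_sum :: "(nat \<Rightarrow> complex mat) \<Rightarrow> oper"
  where "direct_sum A = Blinfun (\<lambda>x. Abs_ell2 (direct_sum_fun A (coord x)))"

definition jordan_sum :: "complex \<Rightarrow> (nat \<Rightarrow> nat) \<Rightarrow> oper"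
  where "jordan_sum lam m = direct_sum (\<lambda>k. jordan_block (m k) lam)"

lemma block_index_eq:
  assumes "i < m k"
  shows "block_index m (block_start m k + i) = k"
  unfolding block_index_def
proof (rule Least_equality)
  show "block_start m k + i < block_start m (Suc k)"
    using assms by (simp add: block_start_def)
  fix l assume *: "block_start m k + i < block_start m (Suc l)"
  show "k \<le> l"
  proof (rule ccontr)
    assume "\<not> k \<le> l"
    then have "block_start m (Suc l) \<le> block_start m k"
      unfolding block_start_def by (intro sum_mono2) auto
    with * show False by simp
  qed
qed

lemma block_decompose:
  assumes "\<And>k. 0 < m k"
  obtains k i where "n = block_start m k + i" "i < m k"
proof -
  have "l \<le> block_start m l" for l
  proof (induction l)
    case (Suc l)
    then show ?case using assms[of l] by (simp add: block_start_def)
  qed simp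
  then have ex: "\<exists>l. n < block_start m (Suc l)"
    using less_le_trans[of n "Suc n"] by blast
  define k where "k = (LEAST l. n < block_start m (Suc l))"
  have up: "n < block_start m (Suc k)" unfolding k_def using ex by (rule LeastI_ex)
  have lo: "block_start m k \<le> n"
  proof (cases k)
    case 0
    then show ?thesis by (simp add: block_start_def)
  next
    case (Suc l)
    then have "\<not> n < block_start m (Suc l)"
      unfolding k_def by (intro not_less_Least) simp
    with Suc show ?thesis by simp
  qed
  show thesis
    by (rule that[of k "n - block_start m k"]) (use up lo in \<open>auto simp: block_start_def\<close>)
qed

lemma direct_sum_fun_jordan:
  assumes "i < m k"
  shows "direct_sum_fun (\<lambda>k. jordan_block (m k) lam) x (block_start m k + i) =
    lam * x (block_start m k + i) +
    (if Suc i < m k then x (block_start m k + Suc i) else 0)"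
proof -
  let ?s = "block_start m k"
  have "direct_sum_fun (\<lambda>k. jordan_block (m k) lam) x (?s + i) =
      (\<Sum>j<m k. jordan_block (m k) lam $$ (i, j) * x (?s + j))"
    by (simp add: direct_sum_fun_def Let_def block_index_eq[of i m k, OF assms])
  also have "\<dots> = (\<Sum>j<m k. (if i = j then lam * x (?s + j) else 0) +
      (if Suc i = j then x (?s + j) else 0))"
    using assms by (intro sum.cong) auto
  also have "\<dots> = lam * x (?s + i) + (if Suc i < m k then x (?s + Suc i) else 0)"
    unfolding sum.distrib using assms by (simp add: sum.delta')
  finally show ?thesis .
qed

text \<open>
  Hence the constructors \<^const>\<open>Blinfun\<close> and \<^const>\<open>Abs_ell2\<close> in \<open>direct_sum\<close> are applied
  within their domains.
\<close>

lemma jordan_sum_apply: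
  assumes pos: "\<And>k. 0 < m k"
  shows "coord (blinfun_apply (jordan_sum lam m) x) =
    direct_sum_fun (\<lambda>k. jordan_block (m k) lam) (coord x)"
proof -
  define F where "F = direct_sum_fun (\<lambda>k. jordan_block (m k) lam)"
  define N where "N x n = F x n - lam * x n" for x n
  have N_val: "N x n = x (Suc n) \<or> N x n = 0" for x n
  proof -
    obtain k i where n: "n = block_start m k + i" and i: "i < m k"
      by (rule block_decompose[OF pos])
    show ?thesis
      unfolding N_def F_def n direct_sum_fun_jordan[of i m k, OF i] by simp
  qed
  have N_le: "(norm (N x n))\<^sup>2 \<le> (norm (x (Suc n)))\<^sup>2" for x n
    using N_val[of x n] by auto
  have shift: "summable (\<lambda>n. (norm (coord x (Suc n)))\<^sup>2)" for x
    using coord_square_summable[of x] summable_Suc_iff[of "\<lambda>n. (norm (coord x n))\<^sup>2"] by simp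
  have N_summ: "summable (\<lambda>n. (norm (N (coord x) n))\<^sup>2)" for x
    by (rule summable_comparison_test'[OF shift[of x]]) (use N_le in simp)
  have F_eq: "F x = (\<lambda>n. lam * x n + N x n)" for x
    by (simp add: N_def)
  have F_summ: "summable (\<lambda>n. (norm (F (coord x) n))\<^sup>2)" for x
    unfolding F_eq
    by (intro summable_square_add summable_square_scale coord_square_summable N_summ)
  have coord_F: "coord (Abs_ell2 (F (coord x))) = F (coord x)" for x
    using F_summ by (simp add: Abs_ell2_inverse)
  have coord_N: "coord (Abs_ell2 (N (coord x))) = N (coord x)" for x
    using N_summ by (simp add: Abs_ell2_inverse)
  have split: "Abs_ell2 (F (coord x)) = cscale lam x + Abs_ell2 (N (coord x))" for x
    unfolding coord_inject[symmetric] coord_F plus_ell2.rep_eq cscale.rep_eq coord_N by (rule F_eq)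
  have norm_N: "norm (Abs_ell2 (N (coord x))) \<le> norm x" for x
  proof -
    have "(\<Sum>n. (norm (N (coord x) n))\<^sup>2) \<le> (\<Sum>n. (norm (coord x (Suc n)))\<^sup>2)"
      by (rule suminf_le[OF N_le N_summ shift])
    also have "\<dots> \<le> (\<Sum>n. (norm (coord x n))\<^sup>2)"
      using suminf_split_head[OF coord_square_summable[of x]] by simp
    finally show ?thesis by (simp add: norm_ell2_eq coord_N)
  qed
  have F_add: "F (\<lambda>n. x n + y n) = (\<lambda>n. F x n + F y n)" for x y
    unfolding F_def direct_sum_fun_def Let_def
    by (simp add: distrib_left sum.distrib)
  have F_scale: "F (\<lambda>n. r *\<^sub>R x n) = (\<lambda>n. r *\<^sub>R F x n)" for r :: real and x
    unfolding F_def direct_sum_fun_def Let_def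
    by (simp add: scaleR_sum_right)
  have "bounded_linear (\<lambda>x. Abs_ell2 (F (coord x)))"
  proof (rule bounded_linear_intro)
    show "Abs_ell2 (F (coord (x + y))) = Abs_ell2 (F (coord x)) + Abs_ell2 (F (coord y))" for x y
      unfolding coord_inject[symmetric] coord_F
      unfolding plus_ell2.rep_eq coord_F by (rule F_add)
    show "Abs_ell2 (F (coord (r *\<^sub>R x))) = r *\<^sub>R Abs_ell2 (F (coord x))" for r x
      unfolding coord_inject[symmetric] coord_F
      unfolding scaleR_ell2.rep_eq coord_F by (rule F_scale)
    show "norm (Abs_ell2 (F (coord x))) \<le> norm x * (norm lam + 1)" for x
      unfolding split using norm_triangle_ineq[of "cscale lam x" "Abs_ell2 (N (coord x))"] norm_N[of x]
      by (simp add: norm_cscale algebra_simps)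
  qed
  then show ?thesis
    by (simp add: jordan_sum_def direct_sum_def bounded_linear_Blinfun_apply F_def[symmetric] coord_F)
qed

lemma jordan_sum_bounded_operator:
  assumes pos: "\<And>k. 0 < m k"
  shows "jordan_sum lam m \<in> bounded_operators"
  unfolding bounded_operators_def
  by (auto simp: coord_inject[symmetric] cscale.rep_eq jordan_sum_apply[OF pos] fun_eq_iff
      direct_sum_fun_def Let_def sum_distrib_left mult.left_commute)

end

theory Submission
  imports Defs
begin

text \<open>
  The operator system of \<open>J\<close> contains the identity, so the eigenvalue may be subtracted: \<open>J\<close> may be
  replaced by the direct sum \<open>N\<close> of truncated shifts. The Shilov ideal is found by presenting the
  C*-algebra of \<open>N\<close> as an extension. It is enough to have a *-homomorphism onto the expected envelope
  whose kernel is a boundary ideal and contains every boundary ideal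
  (\<open>cstar_envelope_isomorphic\<close>). The kernel is a boundary ideal if the norm of a matrix over the
  operator system can be recovered from its image. The entries of such a matrix are Toeplitz operators
  \<open>a + b N + c N*\<close>, and its norm is the supremum of the norms of its finite Toeplitz sections, of the
  sizes of the blocks.

  If the block sizes are bounded with maximum \<open>M\<close>, the homomorphism restricts an operator to a block
  of size \<open>M\<close>. Smaller Toeplitz sections are corners of larger ones, so the restriction is completely
  isometric on the operator system (\<open>block_matrix_isometric\<close>). Since \<open>N ^ (M - 1)\<close> lives on the
  maximal blocks only, it generates matrix units supported there. An ideal outside the kernel contains
  them, hence the projection \<open>P\<close> onto the maximal blocks. But the norm of \<open>2 + N + N*\<close> drops when it is
  multiplied by \<open>1 - P\<close>: the largest eigenvalue of a path of \<open>r\<close> vertices is \<open>2 cos (\<pi> / (r + 1))\<close>,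
  which increases with \<open>r\<close> (\<open>block_matrix_maximal\<close>).

  If the block sizes are unbounded, the vectors \<open>(1, z, z\<^sup>2, \<dots>)\<close> in large blocks are, for \<open>z\<close> on the
  circle, approximate joint eigenvectors of \<open>N\<close> and \<open>N*\<close>. Every operator of the C*-algebra acts
  asymptotically as a scalar on such vectors, its symbol at \<open>z\<close>, and the homomorphism sends an operator
  to its symbol. A finite Toeplitz section is bounded by its symbol, because sampling at roots of unity
  turns it into a compression of a multiplication operator (\<open>toeplitz_bounded_symbol\<close>). This yields
  the complete isometry (\<open>symbol_isometric\<close>). It also yields surjectivity (\<open>symbol_surj\<close>): by
  Stone--Weierstrass every continuous function on the circle is a uniform limit of Laurent polynomials,
  and these lift to Toeplitz operators without increase of the norm. Finally, \<open>1 + cnj z N\<close> attains its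
  norm 2 asymptotically only on approximate eigenvectors for \<open>z\<close>, by uniform convexity. An ideal whose
  symbols do not all vanish at \<open>z\<close> could push these vectors away and lower the norm
  (\<open>symbol_maximal\<close>).
\<close>

section \<open>The complex inner product on the sequence space\<close>

lemma ell2_eqI: "(\<And>n. coord x n = coord y n) \<Longrightarrow> x = y"
  by (simp add: coord_inject[symmetric] fun_eq_iff)

lemma cscale_simps [simp]:
  "cscale 1 x = x" "cscale 0 x = 0" "cscale c 0 = 0"
  "cscale c (cscale d x) = cscale (c * d) x"
  by (auto intro!: ell2_eqI simp: cscale.rep_eq zero_ell2.rep_eq)

lemma cscale_add_right: "cscale c (x + y) = cscale c x + cscale c y"
  and cscale_diff_right: "cscale c (x - y) = cscale c x - cscale c y"
  and cscale_add_left: "cscale (c + d) x = cscale c x + cscale d x"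
  and cscale_diff_left: "cscale (c - d) x = cscale c x - cscale d x"
  by (auto intro!: ell2_eqI simp: cscale.rep_eq plus_ell2.rep_eq minus_ell2.rep_eq algebra_simps)

lemma scaleR_eq_cscale: "r *\<^sub>R x = cscale (of_real r) x"
  by (auto intro!: ell2_eqI simp: cscale.rep_eq scaleR_ell2.rep_eq scaleR_conv_of_real)

lemma coord_add: "coord (x + y) n = coord x n + coord y n"
  and coord_diff: "coord (x - y) n = coord x n - coord y n"
  and coord_zero: "coord 0 n = 0"
  and coord_cscale: "coord (cscale c x) n = c * coord x n"
  by (simp_all add: cscale.rep_eq plus_ell2.rep_eq minus_ell2.rep_eq zero_ell2.rep_eq)

lemma coord_sum: "coord (\<Sum>i\<in>I. x i) n = (\<Sum>i\<in>I. coord (x i) n)"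
  by (induction I rule: infinite_finite_induct) (auto simp: coord_zero coord_add)

lemma norm_ell2_sq: "(norm x)\<^sup>2 = (\<Sum>n. (norm (coord x n))\<^sup>2)"
  unfolding norm_ell2_eq by (simp add: suminf_nonneg coord_square_summable)

lemma norm_sq_sums: "(\<lambda>n. (norm (coord x n))\<^sup>2) sums (norm x)\<^sup>2"
  unfolding norm_ell2_sq using coord_square_summable by (rule summable_sums)

lemma norm_coord_le: "norm (coord x n) \<le> norm x"
proof -
  have "(norm (coord x n))\<^sup>2 \<le> (norm x)\<^sup>2"
    using sum_le_suminf[OF coord_square_summable[of x], of "{n}"] by (simp add: norm_ell2_sq)
  then show ?thesis by (simp add: power2_le_iff_abs_le)
qed

lemma bounded_linear_coord: "bounded_linear (\<lambda>x. coord x n)"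
  by (rule bounded_linear_intro[of _ 1])
    (auto simp: coord_add scaleR_ell2.rep_eq norm_coord_le)

lemma cinner_summable: "summable (\<lambda>n. coord x n * cnj (coord y n))"
proof (rule summable_comparison_test')
  show "summable (\<lambda>n. (norm (coord x n))\<^sup>2 + (norm (coord y n))\<^sup>2)"
    by (intro summable_add coord_square_summable)
  fix n
  have "norm (coord x n) * norm (coord y n) \<le> (norm (coord x n))\<^sup>2 + (norm (coord y n))\<^sup>2"
    using sum_squares_bound[of "norm (coord x n)" "norm (coord y n)"]
      mult_nonneg_nonneg[OF norm_ge_zero[of "coord x n"] norm_ge_zero[of "coord y n"]] by linarith
  then show "norm (coord x n * cnj (coord y n)) \<le> (norm (coord x n))\<^sup>2 + (norm (coord y n))\<^sup>2"
    by (simp add: norm_mult)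
qed

lemma cinner_add_left: "cinner (x + y) z = cinner x z + cinner y z"
  unfolding cinner_def using suminf_add[OF cinner_summable[of x z] cinner_summable[of y z]]
  by (simp add: coord_add distrib_right)

lemma cinner_cscale_left: "cinner (cscale c x) z = c * cinner x z"
  unfolding cinner_def using suminf_mult[OF cinner_summable[of x z], of c]
  by (simp add: coord_cscale mult.assoc)

lemma cinner_commute: "cinner x y = cnj (cinner y x)"
proof -
  have "(\<lambda>n. cnj (coord y n * cnj (coord x n))) sums cnj (cinner y x)"
    unfolding cinner_def sums_cnj using cinner_summable by (rule summable_sums)
  then show ?thesis
    unfolding cinner_def by (simp add: sums_iff mult.commute)
qed

lemma cinner_add_right: "cinner x (y + z) = cinner x y + cinner x z"
  by (metis cinner_add_left cinner_commute complex_cnj_add)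

lemma cinner_cscale_right: "cinner x (cscale c z) = cnj c * cinner x z"
  by (metis cinner_cscale_left cinner_commute complex_cnj_mult)

lemma cinner_zero [simp]: "cinner 0 x = 0" "cinner x 0 = 0"
  using cinner_cscale_left[of 0 0 x] cinner_cscale_right[of x 0 0] by simp_all

lemma cinner_diff_left: "cinner (x - y) z = cinner x z - cinner y z"
  using cinner_add_left[of "x - y" y z] by simp

lemma cinner_diff_right: "cinner x (y - z) = cinner x y - cinner x z"
  using cinner_add_right[of x "y - z" z] by simp

lemma cinner_sum_left: "cinner (\<Sum>i\<in>I. x i) y = (\<Sum>i\<in>I. cinner (x i) y)"
  by (induction I rule: infinite_finite_induct) (auto simp: cinner_add_left)

lemma Re_cinner: "Re (cinner x y) = inner x y"
proof -
  have "(\<lambda>n. Re (coord x n * cnj (coord y n))) sums Re (cinner x y)"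
    unfolding cinner_def using cinner_summable by (intro sums_Re summable_sums)
  then have "(\<lambda>n. inner (coord x n) (coord y n)) sums Re (cinner x y)"
    by (simp add: inner_complex_def)
  then show ?thesis unfolding inner_ell2_def by (simp add: sums_iff)
qed

lemma cinner_self: "cinner x x = of_real ((norm x)\<^sup>2)"
proof (rule complex_eqI)
  show "Re (cinner x x) = Re (of_real ((norm x)\<^sup>2))"
    by (simp add: Re_cinner power2_norm_eq_inner)
  have "cinner x x = cnj (cinner x x)" by (rule cinner_commute)
  then have "Im (cinner x x) = 0" by (simp add: complex_eq_iff)
  then show "Im (cinner x x) = Im (of_real ((norm x)\<^sup>2))"
    by simp
qed

text \<open>The Cauchy--Schwarz inequality for the complex inner product follows from the one for
  its real part, after rotating the phase of the product away.\<close>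

lemma norm_cinner_le: "norm (cinner x y) \<le> norm x * norm y"
proof (cases "cinner x y = 0")
  case False
  define u where "u = cnj (sgn (cinner x y))"
  have u: "norm u = 1" using False by (simp add: u_def norm_sgn)
  have "u * cinner x y = of_real (norm (cinner x y))"
  proof -
    define w where "w = cinner x y"
    have "cnj w * w = of_real (norm w) * of_real (norm w)"
      using complex_norm_square[of w] by (simp add: power2_eq_square mult.commute)
    then show ?thesis
      using False by (simp add: u_def sgn_eq w_def[symmetric])
  qed
  then have "norm (cinner x y) = Re (cinner (cscale u x) y)"
    by (simp add: cinner_cscale_left)
  also have "\<dots> \<le> norm (cscale u x) * norm y"
    unfolding Re_cinner using norm_cauchy_schwarz by blast
  finally show ?thesis using u by (simp add: norm_cscale)
qed simp

lemma cinner_eqI: "(\<And>z. cinner z x = cinner z y) \<Longrightarrow> x = y"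
proof -
  assume "\<And>z. cinner z x = cinner z y"
  then have "cinner (x - y) (x - y) = 0" by (simp add: cinner_diff_right)
  then show ?thesis by (simp add: cinner_self)
qed

lift_definition unit_vec :: "nat \<Rightarrow> ell2" is "\<lambda>k n. if n = k then 1 else 0"
proof -
  fix k :: nat
  show "summable (\<lambda>n. (norm (if n = k then 1 else 0 :: complex))\<^sup>2)"
    by (rule summable_finite[of "{k}"]) auto
qed

lemma coord_unit_vec: "coord (unit_vec k) n = (if n = k then 1 else 0)"
  by (simp add: unit_vec.rep_eq)

lemma cinner_unit_vec_right: "cinner x (unit_vec k) = coord x k"
proof -
  have "(\<lambda>n. coord x n * cnj (coord (unit_vec k) n)) = (\<lambda>n. if n = k then coord x k else 0)"
    by (auto simp: coord_unit_vec)
  moreover have "(\<lambda>n. if n = k then coord x k else 0) sums coord x k"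
    using sums_If_finite_set[of "{k}" "\<lambda>_. coord x k"] by simp
  ultimately show ?thesis by (simp add: cinner_def sums_iff)
qed

lemma cinner_unit_vec_left: "cinner (unit_vec k) x = cnj (coord x k)"
  by (metis cinner_commute cinner_unit_vec_right)

text \<open>Finitely supported sequences are dense; they are the place where coordinate
  computations meet continuity.\<close>

definition truncate :: "nat \<Rightarrow> ell2 \<Rightarrow> ell2"
  where "truncate K x = (\<Sum>n<K. cscale (coord x n) (unit_vec n))"

lemma coord_truncate: "coord (truncate K x) n = (if n < K then coord x n else 0)"
proof -
  have "coord (truncate K x) n = (\<Sum>i<K. if n = i then coord x i else 0)"
    by (simp add: truncate_def coord_sum coord_cscale coord_unit_vec if_distrib cong: if_cong)
  then show ?thesis by simp
qed

lemma truncate_tendsto: "(\<lambda>K. truncate K x) \<longlonglongrightarrow> x"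
proof -
  define f where "f = (\<lambda>n. (norm (coord x n))\<^sup>2)"
  have sq: "(norm (x - truncate K x))\<^sup>2 = (norm x)\<^sup>2 - (\<Sum>n<K. f n)" for K
  proof -
    have "(\<lambda>n. f n - (if n \<in> {..<K} then f n else 0)) sums ((norm x)\<^sup>2 - (\<Sum>n<K. f n))"
      unfolding f_def by (intro sums_diff norm_sq_sums sums_If_finite_set) simp
    moreover have "(\<lambda>n. f n - (if n \<in> {..<K} then f n else 0)) =
        (\<lambda>n. (norm (coord (x - truncate K x) n))\<^sup>2)"
      by (auto simp: f_def coord_diff coord_truncate)
    ultimately show ?thesis using norm_sq_sums sums_unique2 by metis
  qed
  have "(\<lambda>K. \<Sum>n<K. f n) \<longlonglongrightarrow> (norm x)\<^sup>2"
    using norm_sq_sums unfolding f_def sums_def .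
  then have "(\<lambda>K. (norm x)\<^sup>2 - (\<Sum>n<K. f n)) \<longlonglongrightarrow> (norm x)\<^sup>2 - (norm x)\<^sup>2"
    by (intro tendsto_intros)
  then have "(\<lambda>K. sqrt ((norm (x - truncate K x))\<^sup>2)) \<longlonglongrightarrow> sqrt 0"
    unfolding sq by (intro tendsto_real_sqrt) simp
  then have "(\<lambda>K. norm (x - truncate K x)) \<longlonglongrightarrow> 0" by simp
  then have "(\<lambda>K. norm (truncate K x - x)) \<longlonglongrightarrow> 0" by (simp add: norm_minus_commute)
  then have "(\<lambda>K. truncate K x - x) \<longlonglongrightarrow> 0" by (rule tendsto_norm_zero_cancel)
  then show ?thesis by (rule LIM_zero_cancel)
qed

lemma bounded_linear_cinner_left: "bounded_linear (\<lambda>x. cinner x y)"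
  by (rule bounded_linear_intro[of _ "norm y"])
    (auto simp: cinner_add_left scaleR_eq_cscale cinner_cscale_left norm_cinner_le
      scaleR_conv_of_real)

text \<open>Limits of Cauchy sequences and adjoints are first known coordinate by coordinate, with
  estimates for finite sections only; this turns them into vectors.\<close>

lemma ell2_from_sections:
  fixes a :: "nat \<Rightarrow> complex"
  assumes "\<And>K. (\<Sum>n<K. (norm (a n))\<^sup>2) \<le> c\<^sup>2" and "0 \<le> c"
  shows "coord (Abs_ell2 a) = a" and "norm (Abs_ell2 a) \<le> c"
proof -
  have s: "summable (\<lambda>n. (norm (a n))\<^sup>2)"
    by (rule summableI_nonneg_bounded[where x = "c\<^sup>2"]) (use assms in auto)
  then show e: "coord (Abs_ell2 a) = a" by (simp add: Abs_ell2_inverse)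
  have "(norm (Abs_ell2 a))\<^sup>2 \<le> c\<^sup>2"
    unfolding norm_ell2_sq e by (rule suminf_le_const[OF s assms(1)])
  then show "norm (Abs_ell2 a) \<le> c" using assms(2) by (rule power2_le_imp_le)
qed

text \<open>Completeness: a Cauchy sequence converges coordinatewise, and the Cauchy estimate for
  finite sections survives the limit.\<close>

instance ell2 :: banach
proof
  fix X :: "nat \<Rightarrow> ell2"
  assume X: "Cauchy X"
  have "Cauchy (\<lambda>j. coord (X j) n)" for n
    by (rule bounded_linear.Cauchy[OF bounded_linear_coord X])
  then have "\<exists>l. (\<lambda>j. coord (X j) n) \<longlonglongrightarrow> l" for n
    using Cauchy_convergent convergent_def by blast
  then obtain a where a: "\<And>n. (\<lambda>j. coord (X j) n) \<longlonglongrightarrow> a n" by metis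
  have tail: "\<exists>M. \<forall>j\<ge>M. \<forall>K. (\<Sum>n<K. (norm (a n - coord (X j) n))\<^sup>2) \<le> e\<^sup>2" if e: "0 < e" for e :: real
  proof -
    obtain M where M: "\<And>i j. i \<ge> M \<Longrightarrow> j \<ge> M \<Longrightarrow> norm (X i - X j) < e"
      using CauchyD[OF X e] by blast
    have "(\<Sum>n<K. (norm (a n - coord (X j) n))\<^sup>2) \<le> e\<^sup>2" if j: "j \<ge> M" for j K
    proof (rule LIMSEQ_le_const2)
      show "(\<lambda>i. \<Sum>n<K. (norm (coord (X i) n - coord (X j) n))\<^sup>2) \<longlonglongrightarrow>
          (\<Sum>n<K. (norm (a n - coord (X j) n))\<^sup>2)"
        by (intro tendsto_intros a)
      have "(\<Sum>n<K. (norm (coord (X i) n - coord (X j) n))\<^sup>2) \<le> e\<^sup>2" if i: "i \<ge> M" for i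
      proof -
        have "(\<Sum>n<K. (norm (coord (X i) n - coord (X j) n))\<^sup>2) \<le> (norm (X i - X j))\<^sup>2"
          unfolding norm_ell2_sq coord_diff[symmetric]
          by (intro sum_le_suminf coord_square_summable) auto
        also have "\<dots> \<le> e\<^sup>2" using M[OF i j] by (intro power_mono) auto
        finally show ?thesis .
      qed
      then show "\<exists>N. \<forall>i\<ge>N. (\<Sum>n<K. (norm (coord (X i) n - coord (X j) n))\<^sup>2) \<le> e\<^sup>2" by blast
    qed
    then show ?thesis by blast
  qed
  obtain M where M: "\<And>j K. j \<ge> M \<Longrightarrow> (\<Sum>n<K. (norm (a n - coord (X j) n))\<^sup>2) \<le> 1\<^sup>2"
    using tail[of 1] by auto
  define x where "x = X M + Abs_ell2 (\<lambda>n. a n - coord (X M) n)"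
  have x: "coord x n = a n" for n
    using ell2_from_sections(1)[OF M[of M]] by (simp add: x_def coord_add)
  have "X \<longlonglongrightarrow> x"
  proof (rule metric_LIMSEQ_I)
    fix r :: real assume r: "0 < r"
    then obtain M' where M': "\<And>j K. j \<ge> M' \<Longrightarrow> (\<Sum>n<K. (norm (a n - coord (X j) n))\<^sup>2) \<le> (r/2)\<^sup>2"
      using tail[of "r/2"] by auto
    have "dist (X j) x < r" if j: "j \<ge> M'" for j
    proof -
      have "Abs_ell2 (\<lambda>n. a n - coord (X j) n) = x - X j"
        using ell2_from_sections(1)[OF M'[OF j]] r by (auto intro!: ell2_eqI simp: coord_diff x)
      then have "norm (x - X j) \<le> r/2"
        using ell2_from_sections(2)[OF M'[OF j]] r by simp
      then show ?thesis using r by (simp add: dist_norm norm_minus_commute)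
    qed
    then show "\<exists>no. \<forall>n\<ge>no. dist (X n) x < r" by blast
  qed
  then show "convergent X" by (auto simp: convergent_def)
qed

section \<open>Adjoints\<close>

lemma bounded_operatorsD: "T \<in> bounded_operators \<Longrightarrow> T (cscale c x) = cscale c (T x)"
  by (simp add: bounded_operators_def)

lemma oscale_simps [simp]:
  "oscale 1 S = S" "oscale 0 S = 0" "oscale c 0 = 0" "oscale c (oscale d S) = oscale (c * d) S"
  by (auto intro!: blinfun_eqI simp: oscale_apply)

lemma oscale_add_right: "oscale c (S + T) = oscale c S + oscale c T"
  and oscale_add_left: "oscale (c + d) S = oscale c S + oscale d S"
  and oscale_diff_left: "oscale (c - d) S = oscale c S - oscale d S"
  and oscale_minus_one: "oscale (-1) S = - S"
  by (auto intro!: blinfun_eqI ell2_eqI simp: oscale_apply blinfun.add_left blinfun.diff_left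
      blinfun.minus_left coord_add coord_diff coord_cscale uminus_ell2.rep_eq algebra_simps)

lemma bounded_operators_closure:
  assumes "S \<in> bounded_operators" "T \<in> bounded_operators"
  shows "S + T \<in> bounded_operators" "S o\<^sub>L T \<in> bounded_operators"
    "S - T \<in> bounded_operators"
  using assms by (auto simp: bounded_operators_def blinfun.add_left blinfun.diff_left
      cscale_add_right cscale_diff_right)

lemma oscale_bounded_operator: "S \<in> bounded_operators \<Longrightarrow> oscale c S \<in> bounded_operators"
  by (simp add: bounded_operators_def oscale_apply mult.commute)

lemma id_bounded_operator: "id_blinfun \<in> bounded_operators"
  by (auto simp: bounded_operators_def)

text \<open>The adjoint is given by the conjugates of the coefficients
  \<open>cinner (S (unit_vec n)) y\<close>; testing \<open>S\<close> on the vector with exactly these coordinates bounds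
  their finite sections.\<close>

lemma adjoint_exists:
  assumes S: "S \<in> bounded_operators"
  shows "\<exists>S'. \<forall>x y. cinner (S x) y = cinner x (blinfun_apply S' y)"
proof -
  define a where "a y n = cnj (cinner (S (unit_vec n)) y)" for y n
  have S_finite: "S (\<Sum>n<K. cscale (b n) (unit_vec n)) = (\<Sum>n<K. cscale (b n) (S (unit_vec n)))"
    for b :: "nat \<Rightarrow> complex" and K
    by (simp add: blinfun.sum_right bounded_operatorsD[OF S])
  have sections: "(\<Sum>n<K. (norm (a y n))\<^sup>2) \<le> (norm S * norm y)\<^sup>2" for y K
  proof -
    define v where "v = (\<Sum>n<K. cscale (a y n) (unit_vec n))"
    have cv: "coord v n = (if n < K then a y n else 0)" for n
      by (simp add: v_def coord_sum coord_cscale coord_unit_vec if_distrib cong: if_cong)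
    have "(\<lambda>n. if n \<in> {..<K} then (norm (a y n))\<^sup>2 else 0) sums (\<Sum>n<K. (norm (a y n))\<^sup>2)"
      by (rule sums_If_finite_set) simp
    moreover have "(\<lambda>n. if n \<in> {..<K} then (norm (a y n))\<^sup>2 else 0) = (\<lambda>n. (norm (coord v n))\<^sup>2)"
      by (auto simp: cv)
    ultimately have nv: "(norm v)\<^sup>2 = (\<Sum>n<K. (norm (a y n))\<^sup>2)"
      using norm_sq_sums sums_unique2 by metis
    have "cinner (S v) y = (\<Sum>n<K. a y n * cnj (a y n))"
      unfolding v_def S_finite by (simp add: cinner_sum_left cinner_cscale_left a_def)
    also have "\<dots> = of_real ((norm v)\<^sup>2)"
      unfolding nv of_real_sum complex_norm_square ..
    finally have "(norm v)\<^sup>2 = norm (cinner (S v) y)" by (simp add: norm_power)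
    also have "\<dots> \<le> norm (S v) * norm y" by (rule norm_cinner_le)
    also have "\<dots> \<le> norm S * norm v * norm y" by (intro mult_right_mono norm_blinfun) simp
    finally have "norm v * norm v \<le> (norm S * norm y) * norm v"
      by (simp add: power2_eq_square mult_ac)
    then have "norm v \<le> norm S * norm y"
      by (cases "norm v = 0") (auto simp: mult_le_cancel_right)
    then show ?thesis unfolding nv[symmetric] by (intro power_mono) auto
  qed
  define f where "f y = Abs_ell2 (a y)" for y
  have cf: "coord (f y) = a y" and nf: "norm (f y) \<le> norm S * norm y" for y
    unfolding f_def using ell2_from_sections[OF sections[of y]] by simp_all
  have adj: "cinner (S x) y = cinner x (f y)" for x y
  proof (rule LIMSEQ_unique)
    have "(\<lambda>K. S (truncate K x)) \<longlonglongrightarrow> S x"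
      by (intro tendsto_intros truncate_tendsto)
    then show "(\<lambda>K. cinner (S (truncate K x)) y) \<longlonglongrightarrow> cinner (S x) y"
      by (rule bounded_linear.tendsto[OF bounded_linear_cinner_left])
    have "cinner (S (truncate K x)) y = cinner (truncate K x) (f y)" for K
      unfolding truncate_def S_finite
      by (simp add: cinner_sum_left cinner_cscale_left cinner_unit_vec_left cf a_def)
    then show "(\<lambda>K. cinner (S (truncate K x)) y) \<longlonglongrightarrow> cinner x (f y)"
      using bounded_linear.tendsto[OF bounded_linear_cinner_left truncate_tendsto] by simp
  qed
  have "bounded_linear f"
  proof (rule bounded_linear_intro)
    show "f (x + y) = f x + f y" for x y
      by (rule cinner_eqI) (simp add: adj[symmetric] cinner_add_right)
    show "f (r *\<^sub>R x) = r *\<^sub>R f x" for r x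
      by (rule cinner_eqI) (simp add: adj[symmetric] cinner_cscale_right scaleR_eq_cscale)
    show "norm (f x) \<le> norm x * norm S" for x
      using nf[of x] by (simp add: mult.commute)
  qed
  then show ?thesis
    by (intro exI[of _ "Blinfun f"]) (simp add: bounded_linear_Blinfun_apply adj)
qed

lemma adj_eqI:
  assumes "\<And>x y. cinner (blinfun_apply S x) y = cinner x (blinfun_apply S' y)"
  shows "adj S = S'"
  unfolding adj_def
proof (rule the_equality)
  fix R assume "\<forall>x y. cinner (blinfun_apply S x) y = cinner x (blinfun_apply R y)"
  with assms show "R = S'" by (intro blinfun_eqI cinner_eqI) metis
qed (use assms in blast)

lemma cinner_adj:
  assumes "S \<in> bounded_operators"
  shows "cinner (S x) y = cinner x (adj S y)"
  using adjoint_exists[OF assms] adj_eqI by metis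

lemma cinner_adj': "S \<in> bounded_operators \<Longrightarrow> cinner (adj S x) y = cinner x (S y)"
  by (metis cinner_adj cinner_commute)

lemma adj_bounded_operator:
  assumes "S \<in> bounded_operators" shows "adj S \<in> bounded_operators"
proof -
  have "adj S (cscale c x) = cscale c (adj S x)" for c x
    by (rule cinner_eqI) (simp add: cinner_adj[OF assms, symmetric] cinner_cscale_right)
  then show ?thesis by (simp add: bounded_operators_def)
qed

lemma adj_adj: "S \<in> bounded_operators \<Longrightarrow> adj (adj S) = S"
  by (rule adj_eqI) (rule cinner_adj')

lemma adj_id: "adj id_blinfun = id_blinfun"
  by (rule adj_eqI) simp

lemma adj_add: "S \<in> bounded_operators \<Longrightarrow> T \<in> bounded_operators \<Longrightarrow> adj (S + T) = adj S + adj T"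
  by (rule adj_eqI) (simp add: blinfun.add_left cinner_add_left cinner_add_right cinner_adj)

lemma adj_diff: "S \<in> bounded_operators \<Longrightarrow> T \<in> bounded_operators \<Longrightarrow> adj (S - T) = adj S - adj T"
  by (rule adj_eqI) (simp add: blinfun.diff_left cinner_diff_left cinner_diff_right cinner_adj)

lemma adj_compose:
  "S \<in> bounded_operators \<Longrightarrow> T \<in> bounded_operators \<Longrightarrow> adj (S o\<^sub>L T) = adj T o\<^sub>L adj S"
  by (rule adj_eqI) (simp add: cinner_adj)

lemma adj_oscale: "S \<in> bounded_operators \<Longrightarrow> adj (oscale c S) = oscale (cnj c) (adj S)"
  by (rule adj_eqI) (simp add: oscale_apply cinner_cscale_left cinner_cscale_right cinner_adj)

lemma norm_adj_le:
  assumes "S \<in> bounded_operators" shows "norm (adj S) \<le> norm S"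
proof (rule norm_blinfun_bound)
  fix y
  have "(norm (adj S y))\<^sup>2 = norm (cinner (adj S y) (adj S y))" by (simp add: cinner_self norm_power)
  also have "\<dots> = norm (cinner (S (adj S y)) y)" by (simp add: cinner_adj[OF assms])
  also have "\<dots> \<le> norm (S (adj S y)) * norm y" by (rule norm_cinner_le)
  also have "\<dots> \<le> norm S * norm (adj S y) * norm y" by (intro mult_right_mono norm_blinfun) simp
  finally have "norm (adj S y) * norm (adj S y) \<le> (norm S * norm y) * norm (adj S y)"
    by (simp add: power2_eq_square mult_ac)
  then show "norm (adj S y) \<le> norm S * norm y"
    by (cases "norm (adj S y) = 0") (auto simp: mult_le_cancel_right)
qed simp

section \<open>The generated C*-algebra and its quotients\<close>

lemma carrier_cstar: "carrier (cstar T) = cstar_subalgebra hull operator_system T"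
  by (simp add: cstar_def)

lemma cstar_sel [simp]:
  "mult (cstar T) = (o\<^sub>L)" "one (cstar T) = id_blinfun" "zero (cstar T) = 0"
  "add (cstar T) = (+)" "scal (cstar T) = oscale" "star (cstar T) = adj"
  by (simp_all add: cstar_def)

lemma closed_bounded_operators: "closed bounded_operators"
proof -
  have "bounded_operators = (\<Inter>c. \<Inter>x. {T. blinfun_apply T (cscale c x) = cscale c (blinfun_apply T x)})"
    by (auto simp: bounded_operators_def)
  moreover have "closed {T :: oper. T (cscale c x) = cscale c (T x)}" for c x
    by (intro closed_Collect_eq continuous_intros bounded_linear.continuous_on[OF bounded_linear_cscale])
  ultimately show ?thesis by (metis (no_types, lifting) closed_INT)
qed

lemma tendsto_adj:
  assumes "S \<longlonglongrightarrow> T" "\<And>n. S n \<in> bounded_operators"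
  shows "(\<lambda>n. adj (S n)) \<longlonglongrightarrow> adj T"
proof -
  have T: "T \<in> bounded_operators"
    using closed_sequentially[OF closed_bounded_operators] assms by blast
  have "norm (adj (S n) - adj T) \<le> norm (S n - T)" for n
    using norm_adj_le[OF bounded_operators_closure(3)[OF assms(2)[of n] T]]
    by (simp add: adj_diff T assms(2))
  moreover have "(\<lambda>n. norm (S n - T)) \<longlonglongrightarrow> 0"
    using assms(1) by (simp add: LIM_zero tendsto_norm_zero)
  ultimately have "(\<lambda>n. adj (S n) - adj T) \<longlonglongrightarrow> 0"
    by (intro Lim_null_comparison[of "\<lambda>n. adj (S n) - adj T"]) auto
  then show ?thesis by (rule LIM_zero_cancel)
qed

text \<open>The elements of \<open>Q\<close> whose adjoint is also in \<open>Q\<close> form a C*-algebra. So a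
  property that is inherited by sums, products, multiples and norm limits holds throughout
  the C*-algebra generated by \<open>T\<close> once it holds for \<open>T\<close> and its adjoint.\<close>

lemma cstar_subset:
  assumes T: "T \<in> bounded_operators" and Q: "Q \<subseteq> bounded_operators" "closed Q" "id_blinfun \<in> Q"
    and add: "\<And>S R. S \<in> Q \<Longrightarrow> R \<in> Q \<Longrightarrow> S + R \<in> Q"
    and comp: "\<And>S R. S \<in> Q \<Longrightarrow> R \<in> Q \<Longrightarrow> S o\<^sub>L R \<in> Q"
    and scale: "\<And>S c. S \<in> Q \<Longrightarrow> oscale c S \<in> Q"
    and gen: "T \<in> Q" "adj T \<in> Q"
  shows "carrier (cstar T) \<subseteq> Q"
proof -
  define Q' where "Q' = {S \<in> Q. adj S \<in> Q}"
  have "closed Q'"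
    unfolding closed_sequential_limits
  proof (intro allI impI, elim conjE)
    fix X l assume X: "\<forall>n. X n \<in> Q'" "X \<longlonglongrightarrow> l"
    have "(\<lambda>n. adj (X n)) \<longlonglongrightarrow> adj l"
      using X Q(1) by (intro tendsto_adj) (auto simp: Q'_def)
    then have "adj l \<in> Q"
      by (rule closed_sequentially[OF Q(2), rotated]) (use X(1) in \<open>auto simp: Q'_def\<close>)
    moreover have "l \<in> Q"
      by (rule closed_sequentially[OF Q(2) _ X(2)]) (use X(1) in \<open>auto simp: Q'_def\<close>)
    ultimately show "l \<in> Q'" by (simp add: Q'_def)
  qed
  then have "cstar_subalgebra Q'"
    unfolding cstar_subalgebra_def
    using Q add comp scale by (auto simp: Q'_def adj_id adj_add adj_compose adj_adj adj_oscale subset_iff)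
  moreover have "operator_system T \<subseteq> Q'"
  proof -
    have "oscale a id_blinfun + oscale b T + oscale c (adj T) \<in> Q'" for a b c
      unfolding Q'_def using T Q(3) gen
      by (simp add: add scale adj_add adj_oscale adj_id adj_adj
          adj_bounded_operator bounded_operators_closure oscale_bounded_operator id_bounded_operator)
    then show ?thesis by (auto simp: operator_system_def)
  qed
  ultimately show ?thesis
    unfolding carrier_cstar Q'_def using hull_minimal by blast
qed

lemma cstar_subalgebra_bounded_operators: "cstar_subalgebra bounded_operators"
  unfolding cstar_subalgebra_def
  by (auto simp: closed_bounded_operators bounded_operators_closure oscale_bounded_operator id_bounded_operator
      adj_bounded_operator)

lemma operator_system_bounded:
  "T \<in> bounded_operators \<Longrightarrow> operator_system T \<subseteq> bounded_operators"
  by (auto simp: operator_system_def bounded_operators_closure oscale_bounded_operator id_bounded_operator adj_bounded_operator)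

lemma cstar_subalgebra_cstar:
  assumes "T \<in> bounded_operators"
  shows "cstar_subalgebra (carrier (cstar T))"
proof -
  have "carrier (cstar T) \<subseteq> bounded_operators"
    unfolding carrier_cstar
    by (rule hull_minimal[of "operator_system T" bounded_operators cstar_subalgebra, OF
          operator_system_bounded[OF assms] cstar_subalgebra_bounded_operators])
  then show ?thesis
    unfolding carrier_cstar cstar_subalgebra_def[of "_ hull _"]
    by (auto simp: hull_def cstar_subalgebra_def intro!: closed_Inter)
qed

lemma
  assumes "T \<in> bounded_operators"
  shows cstar_bounded: "S \<in> carrier (cstar T) \<Longrightarrow> S \<in> bounded_operators"
    and cstar_id: "id_blinfun \<in> carrier (cstar T)"
    and cstar_closed: "closed (carrier (cstar T))"
    and cstar_add: "S \<in> carrier (cstar T) \<Longrightarrow> R \<in> carrier (cstar T) \<Longrightarrow> S + R \<in> carrier (cstar T)"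
    and cstar_comp: "S \<in> carrier (cstar T) \<Longrightarrow> R \<in> carrier (cstar T) \<Longrightarrow> S o\<^sub>L R \<in> carrier (cstar T)"
    and cstar_adj: "S \<in> carrier (cstar T) \<Longrightarrow> adj S \<in> carrier (cstar T)"
    and cstar_scale: "S \<in> carrier (cstar T) \<Longrightarrow> oscale c S \<in> carrier (cstar T)"
  using cstar_subalgebra_cstar[OF assms] unfolding cstar_subalgebra_def by blast+

lemma cstar_zero: "T \<in> bounded_operators \<Longrightarrow> 0 \<in> carrier (cstar T)"
  using cstar_scale[OF _ cstar_id, of T 0] by simp

lemma cstar_diff:
  "T \<in> bounded_operators \<Longrightarrow> S \<in> carrier (cstar T) \<Longrightarrow> R \<in> carrier (cstar T) \<Longrightarrow> S - R \<in> carrier (cstar T)"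
  using cstar_add[of T S "oscale (-1) R"] cstar_scale[of T R "-1"] by (simp add: oscale_minus_one)

lemma cstar_sum:
  "T \<in> bounded_operators \<Longrightarrow> (\<And>i. i \<in> I \<Longrightarrow> f i \<in> carrier (cstar T)) \<Longrightarrow> sum f I \<in> carrier (cstar T)"
  by (induction I rule: infinite_finite_induct) (auto simp: cstar_zero cstar_add)

lemma operator_system_subset_cstar: "operator_system T \<subseteq> carrier (cstar T)"
  unfolding carrier_cstar by (rule hull_subset)

lemma operator_systemI: "oscale a id_blinfun + oscale b T + oscale c (adj T) \<in> operator_system T"
  by (auto simp: operator_system_def)

lemma generator_in_cstar: "T \<in> carrier (cstar T)"
  using operator_systemI[of 0 1 T 0] operator_system_subset_cstar by auto

lemma ring_cstar:
  assumes T: "T \<in> bounded_operators"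
  shows "ring (cstar T)"
proof (intro ringI)
  show "abelian_group (cstar T)"
  proof (intro abelian_groupI)
    fix x assume "x \<in> carrier (cstar T)"
    then show "\<exists>y\<in>carrier (cstar T). y \<oplus>\<^bsub>cstar T\<^esub> x = \<zero>\<^bsub>cstar T\<^esub>"
      using cstar_diff[OF T cstar_zero[OF T]] by (intro bexI[of _ "0 - x"]) auto
  qed (auto simp: T cstar_add cstar_zero add_ac)
  show "Group.monoid (cstar T)"
    by (intro Group.monoidI) (auto intro!: blinfun_eqI simp: T cstar_comp cstar_id)
qed (auto intro!: blinfun_eqI simp: blinfun.add_left blinfun.add_right)

text \<open>The first isomorphism theorem for *-algebras. The target is a ring because it is the
  image of one.\<close>

lemma star_isomorphic_quotient:
  fixes A :: "'a star_algebra" and B :: "'b star_algebra"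
  assumes "ring A" and hom: "h \<in> Ring.ring_hom A B" and surj: "h ` carrier A = carrier B"
    and zero: "h (zero A) = zero B"
    and scal: "\<And>a c. a \<in> carrier A \<Longrightarrow> scal A c a \<in> carrier A"
      "\<And>a c. a \<in> carrier A \<Longrightarrow> h (scal A c a) = scal B c (h a)"
    and star: "\<And>a. a \<in> carrier A \<Longrightarrow> star A a \<in> carrier A"
      "\<And>a. a \<in> carrier A \<Longrightarrow> h (star A a) = star B (h a)"
  shows "star_isomorphic (quotient_algebra A (a_kernel A B h)) B"
proof -
  define K where "K = a_kernel A B h"
  have "ring (B \<lparr> carrier := h ` (carrier A), zero := h (zero A) \<rparr>)"
    by (rule ring.ring_hom_imp_img_ring[OF \<open>ring A\<close> hom])
  then have "ring B" by (simp add: surj zero)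
  then interpret ring_hom_ring A B h
    using \<open>ring A\<close> hom by (intro ring_hom_ringI2)
  define \<Phi> where "\<Phi> = (\<lambda>X. the_elem (h ` X))"
  have iso: "\<Phi> \<in> ring_iso (A Quot K) B"
    unfolding \<Phi>_def K_def by (rule FactRing_iso_set[OF surj])
  have coset: "K +>\<^bsub>A\<^esub> a = {x \<in> carrier A. h x = h a}" if "a \<in> carrier A" for a
    unfolding K_def using rcos_eq_homeq[OF that] .
  have \<Phi>_coset: "\<Phi> (K +>\<^bsub>A\<^esub> a) = h a" if "a \<in> carrier A" for a
    unfolding \<Phi>_def K_def using the_elem_simp[OF that] .
  have lift: "\<Phi> (\<Union>b\<in>K +>\<^bsub>A\<^esub> a. K +>\<^bsub>A\<^esub> g b) = h (g a)"
    if a: "a \<in> carrier A" and g: "\<And>b. b \<in> carrier A \<Longrightarrow> g b \<in> carrier A"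
      and hg: "\<And>b. b \<in> carrier A \<Longrightarrow> h b = h a \<Longrightarrow> h (g b) = h (g a)" for a g
  proof -
    have "K +>\<^bsub>A\<^esub> g b = K +>\<^bsub>A\<^esub> g a" if "b \<in> K +>\<^bsub>A\<^esub> a" for b
    proof -
      have b: "b \<in> carrier A" "h b = h a" using that a by (simp_all add: coset)
      show ?thesis
        unfolding coset[OF g[OF b(1)]] coset[OF g[OF a]] hg[OF b] ..
    qed
    moreover have "a \<in> K +>\<^bsub>A\<^esub> a" using a by (simp add: coset)
    ultimately have "(\<Union>b\<in>K +>\<^bsub>A\<^esub> a. K +>\<^bsub>A\<^esub> g b) = K +>\<^bsub>A\<^esub> g a" by blast
    then show ?thesis by (simp add: \<Phi>_coset g a)
  qed
  have "\<Phi> \<in> ring_iso (quotient_algebra A K) B"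
    using iso by (simp add: ring_iso_def Ring.ring_hom_def quotient_algebra_def)
  moreover have "(\<forall>c. \<Phi> (scal (quotient_algebra A K) c X) = scal B c (\<Phi> X)) \<and>
      \<Phi> (star (quotient_algebra A K) X) = star B (\<Phi> X)" if X: "X \<in> carrier (quotient_algebra A K)" for X
  proof -
    obtain a where a: "a \<in> carrier A" and X: "X = K +>\<^bsub>A\<^esub> a"
      using X by (auto simp: quotient_algebra_def FactRing_def A_RCOSETS_def')
    have "\<Phi> (\<Union>b\<in>K +>\<^bsub>A\<^esub> a. K +>\<^bsub>A\<^esub> scal A c b) = scal B c (h a)" for c
      by (subst lift[OF a scal(1)]) (simp_all only: scal(2) a)
    moreover have "\<Phi> (\<Union>b\<in>K +>\<^bsub>A\<^esub> a. K +>\<^bsub>A\<^esub> star A b) = star B (h a)"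
      by (subst lift[OF a star(1)]) (simp_all only: star(2) a)
    ultimately show ?thesis
      unfolding X by (simp add: quotient_algebra_def \<Phi>_coset[OF a])
  qed
  ultimately show ?thesis unfolding star_isomorphic_def K_def by blast
qed

section \<open>Matrix norms and boundary ideals\<close>

lemma matrix_norm_bdd:
  fixes n :: nat and A :: "nat \<Rightarrow> nat \<Rightarrow> oper"
  shows "bdd_above ((\<lambda>x. L2_set (\<lambda>i. norm (\<Sum>j<n. blinfun_apply (A i j) (x j))) {..<n}) `
     {x. L2_set (\<lambda>j. norm (x j)) {..<n} \<le> 1})"
proof (rule bdd_aboveI2)
  fix x :: "nat \<Rightarrow> ell2" assume "x \<in> {x. L2_set (\<lambda>j :: nat. norm (x j :: ell2)) {..<n} \<le> 1}"
  then have x: "norm (x j) \<le> 1" if "j < n" for j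
    using member_le_L2_set[of "{..<n}" j "\<lambda>j. norm (x j)"] that by force
  show "L2_set (\<lambda>i. norm (\<Sum>j<n. blinfun_apply (A i j) (x j))) {..<n} \<le>
      L2_set (\<lambda>i. \<Sum>j<n. norm (A i j)) {..<n}"
  proof (rule L2_set_mono)
    fix i
    have "norm (\<Sum>j<n. blinfun_apply (A i j) (x j)) \<le> (\<Sum>j<n. norm (blinfun_apply (A i j) (x j)))"
      by (rule norm_sum)
    also have "\<dots> \<le> (\<Sum>j<n. norm (A i j))"
    proof (rule sum_mono)
      fix j assume "j \<in> {..<n}"
      then have "norm (A i j) * norm (x j) \<le> norm (A i j) * 1" using x by (intro mult_left_mono) auto
      then show "norm (blinfun_apply (A i j) (x j)) \<le> norm (A i j)"
        using norm_blinfun[of "A i j" "x j"] by simp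
    qed
    finally show "norm (\<Sum>j<n. blinfun_apply (A i j) (x j)) \<le> (\<Sum>j<n. norm (A i j))" .
  qed simp
qed

lemma matrix_norm_nonneg: "0 \<le> matrix_norm n A"
  unfolding matrix_norm_def by (rule cSUP_upper2[OF matrix_norm_bdd, of "\<lambda>_. 0"]) (auto simp: L2_set_def)

lemma matrix_norm_apply:
  "L2_set (\<lambda>i. norm (\<Sum>j<n. blinfun_apply (A i j) (x j))) {..<n} \<le> matrix_norm n A * L2_set (\<lambda>j. norm (x j)) {..<n}"
proof (cases "L2_set (\<lambda>j. norm (x j)) {..<n} = 0")
  case True
  then have "x j = 0" if "j < n" for j
    using that by (simp add: L2_set_eq_0_iff)
  then have "L2_set (\<lambda>i. norm (\<Sum>j<n. blinfun_apply (A i j) (x j))) {..<n} = 0"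
    by (simp add: L2_set_def)
  with True show ?thesis by simp
next
  case False
  define r where "r = L2_set (\<lambda>j. norm (x j)) {..<n}"
  have r: "0 < r" using False L2_set_nonneg[of "\<lambda>j. norm (x j)" "{..<n}"] unfolding r_def by linarith
  have "L2_set (\<lambda>j. norm (inverse r *\<^sub>R x j)) {..<n} = inverse r * r"
    using r unfolding r_def by (simp add: L2_set_right_distrib)
  then have "L2_set (\<lambda>i. norm (\<Sum>j<n. blinfun_apply (A i j) (inverse r *\<^sub>R x j))) {..<n} \<le> matrix_norm n A"
    unfolding matrix_norm_def using r
    by (intro cSUP_upper matrix_norm_bdd) (simp only: mem_Collect_eq, simp)
  moreover have "norm (\<Sum>j<n. blinfun_apply (A i j) (inverse r *\<^sub>R x j)) =
      inverse r * norm (\<Sum>j<n. blinfun_apply (A i j) (x j))" for i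
    using r by (simp add: blinfun.scaleR_right flip: scaleR_sum_right)
  ultimately have "inverse r * L2_set (\<lambda>i. norm (\<Sum>j<n. blinfun_apply (A i j) (x j))) {..<n} \<le> matrix_norm n A"
    using r by (simp add: L2_set_right_distrib)
  then show ?thesis using r unfolding r_def by (simp add: field_simps)
qed

lemma matrix_norm_le:
  assumes "0 \<le> s" and "\<And>x. L2_set (\<lambda>i. norm (\<Sum>j<n. blinfun_apply (A i j) (x j))) {..<n} \<le> s * L2_set (\<lambda>j. norm (x j)) {..<n}"
  shows "matrix_norm n A \<le> s"
  unfolding matrix_norm_def
proof (rule cSUP_least)
  show "{x. L2_set (\<lambda>j. norm (x j :: ell2)) {..<n} \<le> 1} \<noteq> {}"
    by (auto simp: L2_set_def intro!: exI[of _ "\<lambda>_. 0"])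
  fix x :: "nat \<Rightarrow> ell2" assume "x \<in> {x. L2_set (\<lambda>j :: nat. norm (x j :: ell2)) {..<n} \<le> 1}"
  then have "s * L2_set (\<lambda>j. norm (x j)) {..<n} \<le> s * 1" using assms(1) by (intro mult_left_mono) auto
  with assms(2)[of x] show "L2_set (\<lambda>i. norm (\<Sum>j<n. blinfun_apply (A i j) (x j))) {..<n} \<le> s"
    by simp
qed

lemma matrix_norm_one: "matrix_norm 1 (\<lambda>_ _. A) = norm A"
proof (rule antisym)
  show "matrix_norm 1 (\<lambda>_ _. A) \<le> norm A"
    by (rule matrix_norm_le) (auto simp: L2_set_def norm_blinfun)
  show "norm A \<le> matrix_norm 1 (\<lambda>_ _. A)"
    using matrix_norm_apply[of "\<lambda>_ _. A" _ 1] matrix_norm_nonneg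
    by (intro norm_blinfun_bound) (auto simp: L2_set_def)
qed

lemma mem_coset_cstar: "B \<in> L +>\<^bsub>cstar T\<^esub> A \<longleftrightarrow> B - A \<in> L"
  by (force simp: a_r_coset_def' intro: bexI[of _ "B - A"])

text \<open>The quotient norm never exceeds the norm, so only the reverse estimate has to be
  checked.\<close>

lemma completely_isometric_quotientI:
  assumes "0 \<in> K"
    and "\<And>n A B. (\<And>i j. i < n \<Longrightarrow> j < n \<Longrightarrow> A i j \<in> operator_system T) \<Longrightarrow>
      (\<And>i j. i < n \<Longrightarrow> j < n \<Longrightarrow> B i j - A i j \<in> K) \<Longrightarrow> matrix_norm n A \<le> matrix_norm n B"
  shows "completely_isometric_quotient T K"
  unfolding completely_isometric_quotient_def quotient_matrix_norm_def mem_coset_cstar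
proof (intro allI impI)
  fix n and A :: "nat \<Rightarrow> nat \<Rightarrow> oper"
  assume A: "\<forall>i<n. \<forall>j<n. A i j \<in> operator_system T"
  show "(INF B \<in> {B. \<forall>i<n. \<forall>j<n. B i j - A i j \<in> K}. matrix_norm n B) = matrix_norm n A"
  proof (rule antisym)
    show "(INF B \<in> {B. \<forall>i<n. \<forall>j<n. B i j - A i j \<in> K}. matrix_norm n B) \<le> matrix_norm n A"
      using assms(1) by (intro cINF_lower bdd_belowI2[where m = 0] matrix_norm_nonneg) auto
    show "matrix_norm n A \<le> (INF B \<in> {B. \<forall>i<n. \<forall>j<n. B i j - A i j \<in> K}. matrix_norm n B)"
      using assms A by (intro cINF_greatest) (auto intro!: exI[of _ A])
  qed
qed

text \<open>The scalar case of complete isometry. Both maximality arguments below refute a boundary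
  ideal by exhibiting an element of norm smaller than \<open>norm A\<close> in the coset of some \<open>A\<close>.\<close>

lemma boundary_ideal_norm_le:
  assumes "boundary_ideal T L" "A \<in> operator_system T" "B \<in> L"
  shows "norm A \<le> norm (A + B)"
proof -
  have "quotient_matrix_norm 1 (\<lambda>i j. L +>\<^bsub>cstar T\<^esub> A) = matrix_norm 1 (\<lambda>_ _. A)"
    using assms(1,2) by (simp add: boundary_ideal_def completely_isometric_quotient_def)
  then have "norm A = quotient_matrix_norm 1 (\<lambda>i j. L +>\<^bsub>cstar T\<^esub> A)"
    unfolding matrix_norm_one ..
  also have "\<dots> \<le> matrix_norm 1 (\<lambda>_ _. A + B)"
    unfolding quotient_matrix_norm_def mem_coset_cstar
    using assms(3) by (intro cINF_lower bdd_belowI2[where m = 0] matrix_norm_nonneg) auto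
  finally show ?thesis unfolding matrix_norm_one .
qed

lemma
  assumes "boundary_ideal T L"
  shows boundary_ideal_subset: "B \<in> L \<Longrightarrow> B \<in> carrier (cstar T)"
    and boundary_ideal_add: "B \<in> L \<Longrightarrow> C \<in> L \<Longrightarrow> B + C \<in> L"
    and boundary_ideal_zero: "0 \<in> L"
    and boundary_ideal_left: "B \<in> L \<Longrightarrow> S \<in> carrier (cstar T) \<Longrightarrow> S o\<^sub>L B \<in> L"
    and boundary_ideal_right: "B \<in> L \<Longrightarrow> S \<in> carrier (cstar T) \<Longrightarrow> B o\<^sub>L S \<in> L"
proof -
  interpret ideal L "cstar T" using assms by (simp add: boundary_ideal_def)
  show "B \<in> L \<Longrightarrow> B \<in> carrier (cstar T)" by (rule a_Hcarr)
  show "B \<in> L \<Longrightarrow> C \<in> L \<Longrightarrow> B + C \<in> L" using additive_subgroup.a_closed[OF is_additive_subgroup, of B C] by simp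
  show "0 \<in> L" using additive_subgroup.zero_closed[OF is_additive_subgroup] by simp
  show "B \<in> L \<Longrightarrow> S \<in> carrier (cstar T) \<Longrightarrow> S o\<^sub>L B \<in> L" using I_l_closed by simp
  show "B \<in> L \<Longrightarrow> S \<in> carrier (cstar T) \<Longrightarrow> B o\<^sub>L S \<in> L" using I_r_closed by simp
qed

text \<open>To identify the envelope it suffices to present the C*-algebra as an extension: a
  surjective *-homomorphism whose kernel is a boundary ideal that contains every other one.\<close>

lemma cstar_envelope_isomorphic:
  fixes B :: "'b star_algebra"
  assumes T: "T \<in> bounded_operators" and hom: "h \<in> Ring.ring_hom (cstar T) B"
    and surj: "h ` carrier (cstar T) = carrier B" and zero: "h 0 = zero B"
    and scal: "\<And>S c. S \<in> carrier (cstar T) \<Longrightarrow> h (oscale c S) = scal B c (h S)"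
    and star: "\<And>S. S \<in> carrier (cstar T) \<Longrightarrow> h (adj S) = star B (h S)"
    and closed: "closed {S \<in> carrier (cstar T). h S = zero B}"
    and isometric: "\<And>n A C. (\<And>i j. i < n \<Longrightarrow> j < n \<Longrightarrow> A i j \<in> operator_system T) \<Longrightarrow>
      (\<And>i j. i < n \<Longrightarrow> j < n \<Longrightarrow> C i j - A i j \<in> carrier (cstar T)) \<Longrightarrow>
      (\<And>i j. i < n \<Longrightarrow> j < n \<Longrightarrow> h (C i j - A i j) = zero B) \<Longrightarrow> matrix_norm n A \<le> matrix_norm n C"
    and maximal: "\<And>L S. boundary_ideal T L \<Longrightarrow> S \<in> L \<Longrightarrow> h S = zero B"
  shows "star_isomorphic (cstar_envelope T) B"
proof -
  define K where "K = a_kernel (cstar T) B h"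
  have K: "K = {S \<in> carrier (cstar T). h S = zero B}"
    by (simp add: K_def a_kernel_def')
  note ring = ring_cstar[OF T]
  have "ring (B \<lparr> carrier := h ` (carrier (cstar T)), zero := h (zero (cstar T)) \<rparr>)"
    by (rule ring.ring_hom_imp_img_ring[OF ring hom])
  then have "ring B" by (simp add: surj zero)
  then interpret ring_hom_ring "cstar T" B h
    using ring hom by (intro ring_hom_ringI2)
  have "boundary_ideal T K"
    unfolding boundary_ideal_def
  proof (intro conjI)
    show "ideal K (cstar T)" unfolding K_def by (rule kernel_is_ideal)
    show "closed K" unfolding K by (rule closed)
    show "completely_isometric_quotient T K"
      by (rule completely_isometric_quotientI) (auto simp: K cstar_zero[OF T] zero intro!: isometric)
  qed
  moreover have "L \<subseteq> K" if "boundary_ideal T L" for L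
    using that maximal boundary_ideal_subset unfolding K by blast
  ultimately have "shilov_ideal T = K"
    unfolding shilov_ideal_def by (intro the_equality) blast+
  then show ?thesis
    unfolding cstar_envelope_def K_def
    using star_isomorphic_quotient[OF ring hom surj] T zero scal star
    by (simp add: cstar_scale cstar_adj)
qed

section \<open>Finite Toeplitz sections\<close>

text \<open>The block Toeplitz matrix with \<open>n \<times> n\<close> symbol coefficients \<open>c i j l\<close>, cut to \<open>r\<close> diagonal
  blocks, has norm at most \<open>s\<close>. The size \<open>r\<close> is a number because it varies with the Jordan
  block.\<close>

definition toeplitz_bounded :: "nat \<Rightarrow> nat \<Rightarrow> (nat \<Rightarrow> nat \<Rightarrow> int \<Rightarrow> complex) \<Rightarrow> real \<Rightarrow> bool"
  where "toeplitz_bounded n r c s \<longleftrightarrow>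
    (\<forall>x :: nat \<Rightarrow> nat \<Rightarrow> complex.
      (\<Sum>i<n. \<Sum>t<r. (norm (\<Sum>j<n. \<Sum>u<r. c i j (int u - int t) * x j u))\<^sup>2)
        \<le> s\<^sup>2 * (\<Sum>j<n. \<Sum>u<r. (norm (x j u))\<^sup>2))"

text \<open>A smaller section is a corner of a larger one.\<close>

lemma toeplitz_bounded_mono:
  assumes "toeplitz_bounded n r' c s" "r \<le> r'"
  shows "toeplitz_bounded n r c s"
  unfolding toeplitz_bounded_def
proof
  fix x :: "nat \<Rightarrow> nat \<Rightarrow> complex"
  define x' where "x' j u = (if u < r then x j u else 0)" for j u
  have ext: "(\<Sum>u<r'. f u) = (\<Sum>u<r. f u)" if "\<And>u. u \<ge> r \<Longrightarrow> f u = 0"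
    for f :: "nat \<Rightarrow> 'x :: comm_monoid_add"
    using that assms(2) by (intro sum.mono_neutral_right) (auto simp: not_less)
  have "(\<Sum>u<r'. c i j (int u - int t) * x' j u) = (\<Sum>u<r. c i j (int u - int t) * x j u)" for i j t
    by (subst ext) (simp_all add: x'_def)
  then have y: "(\<Sum>j<n. \<Sum>u<r'. c i j (int u - int t) * x' j u) =
      (\<Sum>j<n. \<Sum>u<r. c i j (int u - int t) * x j u)" for i t
    by simp
  have x': "(\<Sum>u<r'. (norm (x' j u))\<^sup>2) = (\<Sum>u<r. (norm (x j u))\<^sup>2)" for j
    by (subst ext) (simp_all add: x'_def)
  have "(\<Sum>i<n. \<Sum>t<r. (norm (\<Sum>j<n. \<Sum>u<r. c i j (int u - int t) * x j u))\<^sup>2) \<le>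
      (\<Sum>i<n. \<Sum>t<r'. (norm (\<Sum>j<n. \<Sum>u<r. c i j (int u - int t) * x j u))\<^sup>2)"
    using assms(2) by (intro sum_mono sum_mono2) auto
  also have "\<dots> \<le> s\<^sup>2 * (\<Sum>j<n. \<Sum>u<r'. (norm (x' j u))\<^sup>2)"
    using assms(1)[unfolded toeplitz_bounded_def, rule_format, of x'] by (simp add: y)
  also have "(\<Sum>j<n. \<Sum>u<r'. (norm (x' j u))\<^sup>2) = (\<Sum>j<n. \<Sum>u<r. (norm (x j u))\<^sup>2)"
    by (simp add: x')
  finally show "(\<Sum>i<n. \<Sum>t<r. (norm (\<Sum>j<n. \<Sum>u<r. c i j (int u - int t) * x j u))\<^sup>2) \<le>
      s\<^sup>2 * (\<Sum>j<n. \<Sum>u<r. (norm (x j u))\<^sup>2)" .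
qed

lemma sum_roots_of_unity_powi:
  fixes e :: int
  assumes "\<bar>e\<bar> < int M"
  shows "(\<Sum>k<M. cis (2 * pi * of_nat k / of_nat M) powi e) = (if e = 0 then of_nat M else 0)"
proof (cases "e = 0")
  case False
  define q where "q = cis (2 * pi * of_int e / of_nat M)"
  have M: "0 < M" using assms by (cases M) auto
  have q: "cis (2 * pi * of_nat k / of_nat M) powi e = q ^ k" for k
    by (simp add: q_def cis_power_int Complex.DeMoivre mult_ac)
  have "q ^ M = cis (2 * pi) powi e"
    using M unfolding q_def Complex.DeMoivre cis_power_int by (simp add: mult.commute)
  then have qM: "q ^ M = 1" by simp
  have "q \<noteq> 1"
  proof
    assume "q = 1"
    then have "cos (2 * pi * of_int e / of_nat M) = 1"
      by (simp add: q_def complex_eq_iff)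
    then obtain l :: int where "2 * pi * of_int e / of_nat M = of_int l * 2 * pi"
      unfolding cos_one_2pi_int by blast
    then have "(of_int e :: real) = of_int l * of_nat M"
      using M by (simp add: field_simps)
    then have "e = l * int M" by (metis of_int_eq_iff of_int_mult of_int_of_nat_eq)
    then have "int M \<le> \<bar>e\<bar>" using False by (simp add: abs_mult)
      (metis M mult_le_cancel_right1 of_nat_0_less_iff zero_less_abs_iff abs_of_nat int_one_le_iff_zero_less)
    with assms show False by simp
  qed
  then show ?thesis using False qM by (simp add: q sum_gp_strict)
qed simp

text \<open>Parseval's identity for trigonometric polynomials sampled at the \<open>M\<close>-th roots of unity:
  the monomials that occur stay distinguishable as long as their exponents differ by less than \<open>M\<close>.\<close>

lemma roots_of_unity_inner:
  fixes f :: "'a \<Rightarrow> complex" and g :: "'b \<Rightarrow> complex"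
  defines "w \<equiv> \<lambda>k M. cis (2 * pi * of_nat k / of_nat M)"
  assumes bound: "\<And>a b. a \<in> A \<Longrightarrow> b \<in> B \<Longrightarrow> \<bar>p a - q b\<bar> < int M"
  shows "(\<Sum>k<M. (\<Sum>a\<in>A. f a * w k M powi p a) * cnj (\<Sum>b\<in>B. g b * w k M powi q b)) =
    of_nat M * (\<Sum>a\<in>A. \<Sum>b\<in>B. if p a = q b then f a * cnj (g b) else 0)"
proof -
  have w: "w k M powi a * cnj (w k M powi b) = w k M powi (a - b)" for k a b
    by (simp add: w_def cis_power_int cis_cnj cis_mult left_diff_distrib diff_divide_distrib)
  have "(\<Sum>k<M. (\<Sum>a\<in>A. f a * w k M powi p a) * cnj (\<Sum>b\<in>B. g b * w k M powi q b)) =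
      (\<Sum>k<M. \<Sum>a\<in>A. \<Sum>b\<in>B. f a * cnj (g b) * w k M powi (p a - q b))"
    by (simp add: sum_product cnj_sum w[symmetric] mult_ac)
  also have "\<dots> = (\<Sum>a\<in>A. \<Sum>b\<in>B. \<Sum>k<M. f a * cnj (g b) * w k M powi (p a - q b))"
    by (subst sum.swap) (intro sum.cong refl sum.swap)
  also have "\<dots> = (\<Sum>a\<in>A. \<Sum>b\<in>B. of_nat M * (if p a = q b then f a * cnj (g b) else 0))"
    using sum_roots_of_unity_powi[OF bound]
    by (intro sum.cong refl) (auto simp: w_def simp flip: sum_distrib_left)
  finally show ?thesis by (simp add: sum_distrib_left)
qed

text \<open>Sampled at sufficiently many roots of unity, the section becomes multiplication by the symbol
  followed by an orthogonal projection, so its norm is dominated by the supremum of the symbol.\<close>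

lemma toeplitz_bounded_symbol:
  fixes c :: "nat \<Rightarrow> nat \<Rightarrow> int \<Rightarrow> complex"
  assumes E: "finite E" and supp: "\<And>i j l. l \<notin> E \<Longrightarrow> c i j l = 0"
    and symbol: "\<And>z v. norm z = 1 \<Longrightarrow>
      (\<Sum>i<n. (norm (\<Sum>j<n. (\<Sum>l\<in>E. c i j l * z powi l) * v j))\<^sup>2) \<le> s\<^sup>2 * (\<Sum>j<n. (norm (v j))\<^sup>2)"
  shows "toeplitz_bounded n r c s"
  unfolding toeplitz_bounded_def
proof
  fix x :: "nat \<Rightarrow> nat \<Rightarrow> complex"
  define y where "y i t = (\<Sum>j<n. \<Sum>u<r. c i j (int u - int t) * x j u)" for i t
  obtain d where d: "\<And>l. l \<in> E \<Longrightarrow> \<bar>l\<bar> \<le> int d"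
  proof -
    have "finite (abs ` E)" using E by simp
    then obtain b where "\<And>l. l \<in> E \<Longrightarrow> \<bar>l\<bar> \<le> b"
      by (metis bdd_above_def bdd_above_finite imageI)
    then show thesis by (intro that[of "nat b"]) fastforce
  qed
  \<comment> \<open>The exponents \<open>l - u + t\<close> to be distinguished below lie strictly between \<open>- M\<close> and \<open>M\<close>.\<close>
  define M where "M = r + d + 1"
  define w where "w k = cis (2 * pi * of_nat k / of_nat M)" for k
  define X where "X j k = (\<Sum>u<r. x j u * w k powi (- int u))" for j k
  define Y where "Y i k = (\<Sum>t<r. y i t * w k powi (- int t))" for i k
  define Z where "Z i k = (\<Sum>j<n. (\<Sum>l\<in>E. c i j l * w k powi l) * X j k)" for i k
  have w: "norm (w k) = 1" "w k \<noteq> 0" for k by (simp_all add: w_def)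
  have parseval: "(\<Sum>k<M. (norm (\<Sum>u<r. f u * w k powi (- int u)))\<^sup>2) = of_nat M * (\<Sum>u<r. (norm (f u))\<^sup>2)"
    for f :: "nat \<Rightarrow> complex"
  proof -
    have "of_real (\<Sum>k<M. (norm (\<Sum>u<r. f u * w k powi (- int u)))\<^sup>2) =
        (\<Sum>k<M. (\<Sum>u<r. f u * w k powi (- int u)) * cnj (\<Sum>u<r. f u * w k powi (- int u)))"
      unfolding of_real_sum complex_norm_square ..
    also have "\<dots> = of_nat M * (\<Sum>a<r. \<Sum>b<r. if - int a = - int b then f a * cnj (f b) else 0)"
      unfolding w_def by (rule roots_of_unity_inner) (auto simp: M_def)
    also have "\<dots> = of_real (of_nat M * (\<Sum>u<r. (norm (f u))\<^sup>2))"
      unfolding of_real_mult of_real_sum complex_norm_square by simp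
    finally show ?thesis by (simp only: of_real_eq_iff)
  qed
  have cross: "(\<Sum>k<M. Z i k * cnj (Y i k)) = of_nat M * of_real (\<Sum>t<r. (norm (y i t))\<^sup>2)" for i
  proof -
    define A where "A = {..<n} \<times> E \<times> {..<r}"
    have "Z i k = (\<Sum>(j,l,u)\<in>A. (c i j l * x j u) * w k powi (l - int u))" for k
      unfolding Z_def X_def A_def sum.cartesian_product[symmetric]
      by (simp add: sum_product power_int_diff power_int_minus w field_simps)
    then have "(\<Sum>k<M. Z i k * cnj (Y i k)) =
        (\<Sum>k<M. (\<Sum>a\<in>A. (case a of (j,l,u) \<Rightarrow> c i j l * x j u) * w k powi (case a of (j,l,u) \<Rightarrow> l - int u)) *
          cnj (\<Sum>t<r. y i t * w k powi (- int t)))"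
      unfolding Y_def by (simp add: case_prod_unfold)
    also have "\<dots> = of_nat M * (\<Sum>a\<in>A. \<Sum>t<r. if (case a of (j,l,u) \<Rightarrow> l - int u) = - int t
        then (case a of (j,l,u) \<Rightarrow> c i j l * x j u) * cnj (y i t) else 0)"
      unfolding w_def
    proof (rule roots_of_unity_inner)
      fix a t assume a: "a \<in> A" and t: "t \<in> {..<r}"
      obtain j l u where "a = (j, l, u)" "l \<in> E" "u < r" using a by (auto simp: A_def)
      then show "\<bar>(case a of (j,l,u) \<Rightarrow> l - int u) - - int t\<bar> < int M"
        using d[of l] t by (auto simp: M_def)
    qed
    also have "(\<Sum>a\<in>A. \<Sum>t<r. if (case a of (j,l,u) \<Rightarrow> l - int u) = - int t
        then (case a of (j,l,u) \<Rightarrow> c i j l * x j u) * cnj (y i t) else 0) =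
        (\<Sum>t<r. \<Sum>(j,l,u)\<in>A. if l - int u = - int t then c i j l * x j u * cnj (y i t) else 0)"
      by (subst sum.swap) (simp only: case_prod_unfold)
    also have "\<dots> = (\<Sum>t<r. y i t * cnj (y i t))"
    proof (rule sum.cong[OF refl])
      fix t
      have "(\<Sum>l\<in>E. if l - int u = - int t then c i j l * x j u * cnj (y i t) else 0) =
          c i j (int u - int t) * x j u * cnj (y i t)" for j u
      proof -
        have "(\<Sum>l\<in>E. if l - int u = - int t then c i j l * x j u * cnj (y i t) else 0) =
            (\<Sum>l\<in>E. if int u - int t = l then c i j l * x j u * cnj (y i t) else 0)"
          by (intro sum.cong) auto
        then show ?thesis using E supp by simp
      qed
      then have "(\<Sum>j<n. \<Sum>u<r. \<Sum>l\<in>E. if l - int u = - int t then c i j l * x j u * cnj (y i t) else 0) =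
          y i t * cnj (y i t)"
        unfolding y_def[of i t] by (simp add: sum_distrib_right)
      then show "(\<Sum>(j,l,u)\<in>A. if l - int u = - int t then c i j l * x j u * cnj (y i t) else 0) =
          y i t * cnj (y i t)"
        unfolding A_def sum.cartesian_product[symmetric] by (subst sum.swap)
    qed
    finally show ?thesis unfolding of_real_sum complex_norm_square .
  qed
  \<comment> \<open>By \<open>cross\<close> and \<open>parseval\<close>, \<open>Z - Y\<close> is orthogonal to \<open>Y\<close>; expanding the square of its length
    shows that \<open>Y\<close> is no longer than \<open>Z\<close>.\<close>
  have ineq: "2 * Re (a * cnj b) \<le> (norm a)\<^sup>2 + (norm b)\<^sup>2" for a b :: complex
  proof -
    have "0 \<le> (norm (a - b))\<^sup>2" by simp
    also have "\<dots> = (norm a)\<^sup>2 + (norm b)\<^sup>2 - 2 * Re (a * cnj b)"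
      unfolding cmod_power2 by (simp add: power2_eq_square algebra_simps)
    finally show ?thesis by simp
  qed
  have le_of_double_le: "p \<le> q" if "2 * p \<le> q + p" for p q :: real using that by simp
  have "2 * (of_nat M * (\<Sum>t<r. (norm (y i t))\<^sup>2)) \<le> (\<Sum>k<M. (norm (Z i k))\<^sup>2) + of_nat M * (\<Sum>t<r. (norm (y i t))\<^sup>2)"
    for i
  proof -
    have "2 * (of_nat M * (\<Sum>t<r. (norm (y i t))\<^sup>2)) = 2 * Re (\<Sum>k<M. Z i k * cnj (Y i k))"
      unfolding cross by simp
    also have "\<dots> = (\<Sum>k<M. 2 * Re (Z i k * cnj (Y i k)))" by (simp add: sum_distrib_left)
    also have "\<dots> \<le> (\<Sum>k<M. (norm (Z i k))\<^sup>2 + (norm (Y i k))\<^sup>2)" by (intro sum_mono ineq)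
    finally show ?thesis unfolding sum.distrib Y_def parseval .
  qed
  then have "of_nat M * (\<Sum>t<r. (norm (y i t))\<^sup>2) \<le> (\<Sum>k<M. (norm (Z i k))\<^sup>2)" for i
    by (rule le_of_double_le)
  then have "of_nat M * (\<Sum>i<n. \<Sum>t<r. (norm (y i t))\<^sup>2) \<le> (\<Sum>i<n. \<Sum>k<M. (norm (Z i k))\<^sup>2)"
    unfolding sum_distrib_left by (simp add: sum_mono sum_distrib_left)
  also have "\<dots> = (\<Sum>k<M. \<Sum>i<n. (norm (Z i k))\<^sup>2)" by (rule sum.swap)
  also have "\<dots> \<le> (\<Sum>k<M. s\<^sup>2 * (\<Sum>j<n. (norm (X j k))\<^sup>2))"
    unfolding Z_def by (intro sum_mono symbol w)
  also have "\<dots> = s\<^sup>2 * (\<Sum>j<n. \<Sum>k<M. (norm (X j k))\<^sup>2)"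
    unfolding sum_distrib_left[symmetric] by (subst sum.swap) simp
  also have "\<dots> = of_nat M * (s\<^sup>2 * (\<Sum>j<n. \<Sum>u<r. (norm (x j u))\<^sup>2))"
    unfolding X_def parseval by (simp add: sum_distrib_left mult_ac)
  finally show "(\<Sum>i<n. \<Sum>t<r. (norm (\<Sum>j<n. \<Sum>u<r. c i j (int u - int t) * x j u))\<^sup>2) \<le>
      s\<^sup>2 * (\<Sum>j<n. \<Sum>u<r. (norm (x j u))\<^sup>2)"
    unfolding y_def by (simp add: M_def)
qed

text \<open>Schur's test. Cauchy--Schwarz is applied to the factorization of \<open>K t u * norm (x u)\<close> into
  \<open>sqrt (K t u * v u)\<close> and \<open>sqrt (K t u * (norm (x u))\<^sup>2 / v u)\<close>; the inequality \<open>K v \<le> C v\<close> is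
  used once along rows and once, by symmetry, along columns.\<close>

lemma schur_test:
  fixes K :: "nat \<Rightarrow> nat \<Rightarrow> real" and x :: "nat \<Rightarrow> complex"
  assumes K: "\<And>t u. 0 \<le> K t u" "\<And>t u. K t u = K u t"
    and v: "\<And>t. t < r \<Longrightarrow> 0 < v t"
    and super: "\<And>t. t < r \<Longrightarrow> (\<Sum>u<r. K t u * v u) \<le> C * v t" and C: "0 \<le> C"
  shows "(\<Sum>t<r. (norm (\<Sum>u<r. of_real (K t u) * x u))\<^sup>2) \<le> C\<^sup>2 * (\<Sum>u<r. (norm (x u))\<^sup>2)"
proof -
  define b where "b u = (norm (x u))\<^sup>2 / v u" for u
  have b: "0 \<le> b u" if "u < r" for u using v[OF that] by (simp add: b_def)
  have "(norm (\<Sum>u<r. of_real (K t u) * x u))\<^sup>2 \<le> C * v t * (\<Sum>u<r. K t u * b u)" if t: "t < r" for t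
  proof -
    have "norm (\<Sum>u<r. of_real (K t u) * x u) \<le> (\<Sum>u<r. K t u * norm (x u))"
      by (rule order_trans[OF norm_sum]) (simp add: norm_mult K)
    also have "\<dots> = (\<Sum>u<r. sqrt (K t u * v u) * sqrt (K t u * b u))"
    proof (rule sum.cong[OF refl])
      fix u assume "u \<in> {..<r}"
      then have "0 < v u" using v by simp
      then have "K t u * v u * (K t u * b u) = (K t u * norm (x u))\<^sup>2"
        by (simp add: b_def power2_eq_square field_simps)
      then show "K t u * norm (x u) = sqrt (K t u * v u) * sqrt (K t u * b u)"
        using K by (simp flip: real_sqrt_mult)
    qed
    finally have "(norm (\<Sum>u<r. of_real (K t u) * x u))\<^sup>2 \<le>
        (\<Sum>u<r. sqrt (K t u * v u) * sqrt (K t u * b u))\<^sup>2"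
      by (intro power_mono) auto
    also have "\<dots> \<le> (\<Sum>u<r. (sqrt (K t u * v u))\<^sup>2) * (\<Sum>u<r. (sqrt (K t u * b u))\<^sup>2)"
      by (rule Cauchy_Schwarz_ineq_sum)
    also have "\<dots> = (\<Sum>u<r. K t u * v u) * (\<Sum>u<r. K t u * b u)"
    proof (intro arg_cong2[where f = "(*)"] sum.cong refl real_sqrt_pow2)
      fix u assume "u \<in> {..<r}"
      then show "0 \<le> K t u * v u" "0 \<le> K t u * b u"
        using K(1)[of t u] v[of u] b[of u] by simp_all
    qed
    also have "\<dots> \<le> C * v t * (\<Sum>u<r. K t u * b u)"
      using K b by (intro mult_right_mono super[OF t] sum_nonneg) auto
    finally show ?thesis .
  qed
  then have "(\<Sum>t<r. (norm (\<Sum>u<r. of_real (K t u) * x u))\<^sup>2) \<le> (\<Sum>t<r. C * v t * (\<Sum>u<r. K t u * b u))"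
    by (intro sum_mono) simp
  also have "\<dots> = C * (\<Sum>t<r. \<Sum>u<r. b u * (K u t * v t))"
    by (simp add: sum_distrib_left K(2) mult_ac)
  also have "\<dots> = C * (\<Sum>u<r. b u * (\<Sum>t<r. K u t * v t))"
    by (subst sum.swap) (simp add: sum_distrib_left)
  also have "\<dots> \<le> C * (\<Sum>u<r. b u * (C * v u))"
    using b by (intro mult_left_mono C sum_mono super) auto
  also have "\<dots> = C\<^sup>2 * (\<Sum>u<r. (norm (x u))\<^sup>2)"
  proof -
    have "C * (b u * (C * v u)) = C\<^sup>2 * (norm (x u))\<^sup>2" if "u < r" for u
      using v[OF that] by (simp add: b_def power2_eq_square[of C])
    then show ?thesis by (simp add: sum_distrib_left)
  qed
  finally show ?thesis .
qed

section \<open>Block coordinates\<close>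

primrec opow :: "oper \<Rightarrow> nat \<Rightarrow> oper" where
  "opow S 0 = id_blinfun"
| "opow S (Suc l) = S o\<^sub>L opow S l"

lemma opow_cstar:
  "T \<in> bounded_operators \<Longrightarrow> S \<in> carrier (cstar T) \<Longrightarrow> opow S l \<in> carrier (cstar T)"
  by (induction l) (auto simp: cstar_id cstar_comp)

locale nilpotent_sum =
  fixes m :: "nat \<Rightarrow> nat"
  assumes pos: "0 < m k"
begin

definition N :: oper where "N = jordan_sum 0 m"

definition entry :: "ell2 \<Rightarrow> nat \<Rightarrow> nat \<Rightarrow> complex"
  where "entry x k t = coord x (block_start m k + t)"

lemma entry_simps [simp]:
  "entry (x + y) k t = entry x k t + entry y k t" "entry (x - y) k t = entry x k t - entry y k t"
  "entry (cscale c x) k t = c * entry x k t" "entry 0 k t = 0"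
  "entry (\<Sum>i\<in>I. g i) k t = (\<Sum>i\<in>I. entry (g i) k t)"
  by (simp_all add: entry_def coord_add coord_diff coord_cscale coord_zero coord_sum)

lemma bounded_linear_entry: "bounded_linear (\<lambda>x. entry x k t)"
  unfolding entry_def by (rule bounded_linear_coord)

lemma entry_eqI:
  assumes "\<And>k t. t < m k \<Longrightarrow> entry x k t = entry y k t" shows "x = y"
proof (rule ell2_eqI)
  fix n show "coord x n = coord y n"
    by (rule block_decompose[of m n, OF pos]) (use assms in \<open>auto simp: entry_def\<close>)
qed

lemma block_position_inj:
  assumes "t < m k" "u < m l"
  shows "block_start m k + t = block_start m l + u \<longleftrightarrow> k = l \<and> t = u"
  using block_index_eq[of t m k, OF assms(1)] block_index_eq[of u m l, OF assms(2)] by auto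

definition block_vec :: "nat \<Rightarrow> nat \<Rightarrow> ell2"
  where "block_vec k t = unit_vec (block_start m k + t)"

lemma entry_block_vec:
  "t < m k \<Longrightarrow> u < m l \<Longrightarrow> entry (block_vec k t) l u = (if k = l \<and> t = u then 1 else 0)"
  using block_position_inj[of t k u l] by (auto simp: entry_def block_vec_def coord_unit_vec)

lemma cinner_block_vec: "cinner x (block_vec k t) = entry x k t"
  by (simp add: block_vec_def entry_def cinner_unit_vec_right)

lemma norm_sq_blocks: "(\<lambda>k. \<Sum>t<m k. (norm (entry x k t))\<^sup>2) sums (norm x)\<^sup>2"
proof -
  define f where "f n = (norm (coord x n))\<^sup>2" for n
  have start: "block_start m (Suc k) = block_start m k + m k" for k
    by (simp add: block_start_def)
  have "(\<Sum>k<K. \<Sum>t<m k. f (block_start m k + t)) = (\<Sum>n<block_start m K. f n)" for K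
  proof (induction K)
    case (Suc K)
    have "(\<Sum>n<block_start m K + d. f n) = (\<Sum>n<block_start m K. f n) + (\<Sum>t<d. f (block_start m K + t))" for d
      by (induction d) (auto simp: add.assoc)
    with Suc show ?case by (simp add: start)
  qed (simp add: block_start_def)
  moreover have "(\<lambda>K. \<Sum>n<block_start m K. f n) \<longlonglongrightarrow> (norm x)\<^sup>2"
  proof -
    have "strict_mono (block_start m)"
      using pos by (intro strict_monoI_Suc) (simp add: start)
    then show ?thesis
      using LIMSEQ_subseq_LIMSEQ[OF norm_sq_sums[of x, unfolded sums_def], of "block_start m"]
      by (simp add: f_def o_def)
  qed
  ultimately show ?thesis by (simp add: sums_def entry_def f_def)
qed

lemma norm_entries_le: "(\<Sum>t<m k. (norm (entry x k t))\<^sup>2) \<le> (norm x)\<^sup>2"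
proof -
  have "(\<Sum>k'\<in>{k}. \<Sum>t<m k'. (norm (entry x k' t))\<^sup>2) \<le> (\<Sum>k. \<Sum>t<m k. (norm (entry x k t))\<^sup>2)"
    by (rule sum_le_suminf) (auto intro: sums_summable[OF norm_sq_blocks] sum_nonneg)
  then show ?thesis using sums_unique[OF norm_sq_blocks[of x]] by simp
qed

definition block_embed :: "nat \<Rightarrow> (nat \<Rightarrow> complex) \<Rightarrow> ell2"
  where "block_embed k v = (\<Sum>t<m k. cscale (v t) (block_vec k t))"

lemma entry_block_embed: "t < m l \<Longrightarrow> entry (block_embed k v) l t = (if k = l then v t else 0)"
  by (auto simp: block_embed_def entry_block_vec if_distrib cong: if_cong)

lemma norm_block_embed: "(norm (block_embed k v))\<^sup>2 = (\<Sum>t<m k. (norm (v t))\<^sup>2)"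
proof -
  have "(\<lambda>l. \<Sum>t<m l. (norm (entry (block_embed k v) l t))\<^sup>2) =
      (\<lambda>l. if l = k then \<Sum>t<m k. (norm (v t))\<^sup>2 else 0)"
    by (rule ext) (simp add: entry_block_embed)
  then have "(\<lambda>l. if l = k then \<Sum>t<m k. (norm (v t))\<^sup>2 else 0) sums (norm (block_embed k v))\<^sup>2"
    using norm_sq_blocks[of "block_embed k v"] by simp
  moreover have "(\<lambda>l. if l = k then \<Sum>t<m k. (norm (v t))\<^sup>2 else 0) sums (\<Sum>t<m k. (norm (v t))\<^sup>2)"
    using sums_If_finite_set[of "{k}" "\<lambda>_. \<Sum>t<m k. (norm (v t))\<^sup>2"] by simp
  ultimately show ?thesis by (rule sums_unique2)
qed

text \<open>The squared norm is the sum over the blocks, so blockwise estimates can be added up.\<close>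

lemma norm_le_blockwise:
  assumes s: "0 \<le> s" and blk: "\<And>k. (\<Sum>i<n. \<Sum>t<m k. (norm (entry (y i) k t))\<^sup>2) \<le>
      s\<^sup>2 * (\<Sum>j<n. \<Sum>t<m k. (norm (entry (x j) k t))\<^sup>2)"
  shows "L2_set (\<lambda>i. norm (y i)) {..<n} \<le> s * L2_set (\<lambda>j. norm (x j)) {..<n}"
proof -
  have sums: "(\<lambda>k. \<Sum>i<n. \<Sum>t<m k. (norm (entry (y i) k t))\<^sup>2) sums (\<Sum>i<n. (norm (y i))\<^sup>2)" for y
    by (intro sums_sum norm_sq_blocks)
  have "(\<Sum>i<n. (norm (y i))\<^sup>2) \<le> s\<^sup>2 * (\<Sum>j<n. (norm (x j))\<^sup>2)"
    by (rule sums_le[OF _ sums sums_mult[OF sums]]) (use blk in auto)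
  then have "sqrt (\<Sum>i<n. (norm (y i))\<^sup>2) \<le> sqrt (s\<^sup>2 * (\<Sum>j<n. (norm (x j))\<^sup>2))" by simp
  then show ?thesis using s by (simp add: L2_set_def real_sqrt_mult)
qed

section \<open>The shift and its powers\<close>

lemma N_bounded: "N \<in> bounded_operators"
  unfolding N_def by (rule jordan_sum_bounded_operator[OF pos])

lemma entry_N: "t < m k \<Longrightarrow> entry (N x) k t = (if Suc t < m k then entry x k (Suc t) else 0)"
  unfolding entry_def N_def jordan_sum_apply[OF pos] by (simp add: direct_sum_fun_jordan)

lemma N_block_vec: "t < m k \<Longrightarrow> N (block_vec k t) = (if t = 0 then 0 else block_vec k (t - 1))"
  by (rule entry_eqI) (auto simp: entry_N entry_block_vec)

lemma entry_adj_N: "t < m k \<Longrightarrow> entry (adj N x) k t = (if t = 0 then 0 else entry x k (t - 1))"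
  using N_block_vec[of t k]
  by (simp add: cinner_block_vec[symmetric] cinner_adj'[OF N_bounded])

lemma N_in_cstar: "N \<in> carrier (cstar N)" and adj_N_in_cstar: "adj N \<in> carrier (cstar N)"
  by (auto intro: generator_in_cstar cstar_adj N_bounded)

lemma jordan_sum_eq: "jordan_sum lam m = N + oscale lam id_blinfun"
  by (intro blinfun_eqI entry_eqI)
    (simp add: blinfun.add_left oscale_apply N_def, simp add: entry_def jordan_sum_apply[OF pos]
      direct_sum_fun_jordan)

text \<open>The eigenvalue only adds a multiple of the identity, which the operator system absorbs; the
  envelope depends on the block sizes alone.\<close>

lemma operator_system_jordan_sum: "operator_system (jordan_sum lam m) = operator_system N"
proof -
  have adj: "adj (jordan_sum lam m) = adj N + oscale (cnj lam) id_blinfun"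
    unfolding jordan_sum_eq
    by (simp add: adj_add adj_oscale adj_id N_bounded oscale_bounded_operator id_bounded_operator)
  have eq: "oscale a id_blinfun + oscale b (jordan_sum lam m) + oscale c (adj (jordan_sum lam m)) =
      oscale (a + b * lam + c * cnj lam) id_blinfun + oscale b N + oscale c (adj N)" for a b c
    unfolding adj unfolding jordan_sum_eq by (simp add: oscale_add_right oscale_add_left add_ac)
  show ?thesis
  proof (intro equalityI subsetI)
    fix S assume "S \<in> operator_system N"
    then obtain a b c where "S = oscale a id_blinfun + oscale b N + oscale c (adj N)"
      by (auto simp: operator_system_def)
    then have "S = oscale (a - b * lam - c * cnj lam) id_blinfun + oscale b (jordan_sum lam m) +
        oscale c (adj (jordan_sum lam m))"
      unfolding eq by simp
    then show "S \<in> operator_system (jordan_sum lam m)" using operator_systemI by simp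
  qed (auto simp: operator_system_def eq)
qed

lemma cstar_envelope_jordan_sum: "cstar_envelope (jordan_sum lam m) = cstar_envelope N"
proof -
  have c: "cstar (jordan_sum lam m) = cstar N"
    unfolding cstar_def operator_system_jordan_sum ..
  have "boundary_ideal (jordan_sum lam m) = boundary_ideal N"
    unfolding boundary_ideal_def[abs_def] completely_isometric_quotient_def
      operator_system_jordan_sum c ..
  then show ?thesis unfolding cstar_envelope_def shilov_ideal_def c by simp
qed

lemma entry_opow_N:
  "t < m k \<Longrightarrow> entry (opow N l x) k t = (if t + l < m k then entry x k (t + l) else 0)"
  by (induction l arbitrary: t) (auto simp: entry_N)

lemma entry_opow_adj_N:
  "t < m k \<Longrightarrow> entry (opow (adj N) l x) k t = (if l \<le> t then entry x k (t - l) else 0)"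
  by (induction l arbitrary: t) (auto simp: entry_adj_N)

definition shift :: "int \<Rightarrow> oper"
  where "shift l = (if 0 \<le> l then opow N (nat l) else opow (adj N) (nat (- l)))"

lemma shift_in_cstar: "shift l \<in> carrier (cstar N)"
  by (simp add: shift_def opow_cstar N_bounded N_in_cstar adj_N_in_cstar)

lemma shift_simps: "shift 0 = id_blinfun" "shift 1 = N" "shift (-1) = adj N"
  by (auto intro!: blinfun_eqI simp: shift_def)

definition toeplitz :: "int set \<Rightarrow> (int \<Rightarrow> complex) \<Rightarrow> oper"
  where "toeplitz E c = (\<Sum>l\<in>E. oscale (c l) (shift l))"

lemma toeplitz_in_cstar: "toeplitz E c \<in> carrier (cstar N)"
  unfolding toeplitz_def by (intro cstar_sum cstar_scale N_bounded shift_in_cstar)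

lemma entry_shift:
  assumes "t < m k"
  shows "entry (shift l x) k t = (\<Sum>u<m k. if int u - int t = l then entry x k u else 0)"
proof -
  have "(\<Sum>u<m k. if int u - int t = l then entry x k u else 0) =
      (\<Sum>u<m k. if u = nat (int t + l) then (if 0 \<le> int t + l then entry x k u else 0) else 0)"
    by (intro sum.cong) auto
  also have "\<dots> = (if nat (int t + l) < m k \<and> 0 \<le> int t + l then entry x k (nat (int t + l)) else 0)"
    by simp
  also have "\<dots> = entry (shift l x) k t"
    using assms by (cases "0 \<le> l") (auto simp: shift_def entry_opow_N entry_opow_adj_N nat_add_distrib
        nat_diff_distrib intro!: arg_cong[where f = "entry x k"])
  finally show ?thesis ..
qed

lemma entry_toeplitz:
  assumes "finite E" "\<And>l. l \<notin> E \<Longrightarrow> c l = 0" "t < m k"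
  shows "entry (toeplitz E c x) k t = (\<Sum>u<m k. c (int u - int t) * entry x k u)"
proof -
  have "entry (toeplitz E c x) k t = (\<Sum>l\<in>E. c l * entry (shift l x) k t)"
    by (simp add: toeplitz_def blinfun.sum_left oscale_apply)
  also have "\<dots> = (\<Sum>u<m k. \<Sum>l\<in>E. if int u - int t = l then c l * entry x k u else 0)"
    unfolding entry_shift[OF assms(3)] sum_distrib_left
    by (subst sum.swap) (simp add: if_distrib cong: if_cong)
  also have "\<dots> = (\<Sum>u<m k. c (int u - int t) * entry x k u)"
    using assms(1,2) by (intro sum.cong refl) simp
  finally show ?thesis .
qed

lemma operator_system_toeplitz:
  assumes "S \<in> operator_system N"
  obtains c where "S = toeplitz {-1, 0, 1} c" "\<And>l. l \<notin> {-1, 0, 1} \<Longrightarrow> c l = 0"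
proof -
  obtain a b d where S: "S = oscale a id_blinfun + oscale b N + oscale d (adj N)"
    using assms by (auto simp: operator_system_def)
  show thesis
    by (rule that[of "\<lambda>l. if l = -1 then d else if l = 0 then a else if l = 1 then b else 0"])
      (auto simp: toeplitz_def S shift_simps add_ac)
qed

lemma operator_system_toeplitz_matrix:
  assumes "\<And>i j. i < n \<Longrightarrow> j < n \<Longrightarrow> A i j \<in> operator_system N"
  shows "\<exists>c. (\<forall>i j l. l \<notin> {-1, 0, 1} \<longrightarrow> c i j l = 0) \<and>
    (\<forall>i j. i < n \<longrightarrow> j < n \<longrightarrow> A i j = toeplitz {-1, 0, 1} (c i j))"
proof -
  have "\<exists>c. (\<forall>l. l \<notin> {-1, 0, 1} \<longrightarrow> c l = 0) \<and> (i < n \<and> j < n \<longrightarrow> A i j = toeplitz {-1, 0, 1} c)" for i j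
  proof (cases "i < n \<and> j < n")
    case True
    then show ?thesis using operator_system_toeplitz[OF assms] by metis
  qed (auto intro!: exI[of _ "\<lambda>_. 0"])
  then show ?thesis by metis
qed

text \<open>On each block the operator matrix acts as a finite Toeplitz section of the size of the block,
  and the blocks are mutually orthogonal.\<close>

lemma matrix_norm_toeplitz_le:
  assumes "0 \<le> s" "finite E" and supp: "\<And>i j l. l \<notin> E \<Longrightarrow> c i j l = 0"
    and bounded: "\<And>k. toeplitz_bounded n (m k) c s"
    and A: "\<And>i j. i < n \<Longrightarrow> j < n \<Longrightarrow> A i j = toeplitz E (c i j)"
  shows "matrix_norm n A \<le> s"
proof (rule matrix_norm_le[OF assms(1)], rule norm_le_blockwise[OF assms(1)])
  fix x :: "nat \<Rightarrow> ell2" and k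
  have "(\<Sum>i<n. \<Sum>t<m k. (norm (entry (\<Sum>j<n. A i j (x j)) k t))\<^sup>2) =
      (\<Sum>i<n. \<Sum>t<m k. (norm (\<Sum>j<n. \<Sum>u<m k. c i j (int u - int t) * entry (x j) k u))\<^sup>2)"
    by (intro sum.cong refl arg_cong[where f = "\<lambda>a. (norm a)\<^sup>2"])
      (simp add: A entry_toeplitz[OF assms(2) supp])
  also have "\<dots> \<le> s\<^sup>2 * (\<Sum>j<n. \<Sum>t<m k. (norm (entry (x j) k t))\<^sup>2)"
    using bounded[of k, unfolded toeplitz_bounded_def, rule_format, of "\<lambda>j. entry (x j) k"] .
  finally show "(\<Sum>i<n. \<Sum>t<m k. (norm (entry (\<Sum>j<n. A i j (x j)) k t))\<^sup>2) \<le>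
      s\<^sup>2 * (\<Sum>j<n. \<Sum>t<m k. (norm (entry (x j) k t))\<^sup>2)" .
qed

end

section \<open>Bounded block sizes\<close>

lemma tridiagonal_sum:
  fixes f :: "nat \<Rightarrow> 'a :: real_algebra_1"
  assumes "t < r"
  shows "(\<Sum>u<r. (if int u - int t = 0 then 2 else if \<bar>int u - int t\<bar> = 1 then 1 else 0) * f u) =
    2 * f t + (if t = 0 then 0 else f (t - 1)) + (if Suc t < r then f (Suc t) else 0)"
proof -
  have "(\<Sum>u<r. (if int u - int t = 0 then 2 else if \<bar>int u - int t\<bar> = 1 then 1 else 0) * f u) =
      (\<Sum>u<r. (if u = t then 2 * f u else 0) + (if u = t - 1 then if t = 0 then 0 else f u else 0) +
        (if u = Suc t then f u else 0))"
    using assms by (intro sum.cong refl) (auto split: if_splits)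
  then show ?thesis using assms by (simp add: sum.distrib less_imp_diff_less)
qed

lemma sin_recurrence:
  "sin (real t * \<phi>) + sin (real (t + 2) * \<phi>) = 2 * cos \<phi> * sin (real (t + 1) * \<phi>)"
proof -
  have "real t * \<phi> = real (t + 1) * \<phi> - \<phi>" "real (t + 2) * \<phi> = real (t + 1) * \<phi> + \<phi>"
    by (simp_all add: algebra_simps)
  moreover have "sin (a - \<phi>) + sin (a + \<phi>) = 2 * cos \<phi> * sin a" for a
    by (simp add: sin_diff sin_add)
  ultimately show ?thesis by metis
qed

locale bounded_nilpotent_sum = nilpotent_sum +
  fixes M k0 :: nat
  assumes le_M: "m k \<le> M" and k0: "m k0 = M"
begin

lemma M_pos: "0 < M"
  using pos[of k0] k0 by simp

text \<open>The coefficients are read off in a fixed block \<open>k0\<close> of maximal size.\<close>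

definition coef :: "oper \<Rightarrow> nat \<Rightarrow> nat \<Rightarrow> complex"
  where "coef S t u = entry (S (block_vec k0 u)) k0 t"

lemma coef_simps:
  "coef (S + R) t u = coef S t u + coef R t u" "coef (S - R) t u = coef S t u - coef R t u"
  "coef (oscale c S) t u = c * coef S t u" "coef (\<Sum>i\<in>I. F i) t u = (\<Sum>i\<in>I. coef (F i) t u)"
  "coef 0 t u = 0"
  by (simp_all add: coef_def blinfun.add_left blinfun.diff_left oscale_apply blinfun.sum_left)

lemma continuous_entry_apply: "continuous_on UNIV (\<lambda>S. entry (blinfun_apply S x) k t)"
  by (intro bounded_linear.continuous_on[OF bounded_linear_entry] continuous_intros)

lemma coef_shift:
  assumes "t < M" "u < M"
  shows "coef (shift l) t u = (if int u - int t = l then 1 else 0)"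
proof -
  have "coef (shift l) t u = (\<Sum>v<M. if int v - int t = l then entry (block_vec k0 u) k0 v else 0)"
    using entry_shift[of t k0 l "block_vec k0 u"] assms k0 by (simp add: coef_def)
  also have "\<dots> = (\<Sum>v<M. if v = u then (if int u - int t = l then 1 else 0) else 0)"
    using assms k0 by (intro sum.cong refl) (simp add: entry_block_vec)
  finally show ?thesis using assms by simp
qed

text \<open>The shift treats all blocks of the same size alike, and sums, products and limits inherit
  this. So the block \<open>k0\<close> speaks for all blocks of maximal size.\<close>

lemma entry_maximal_block:
  assumes "S \<in> carrier (cstar N)" "m k = M" "t < M"
  shows "entry (S x) k t = (\<Sum>u<M. coef S t u * entry x k u)"
proof -
  define good where "good S \<longleftrightarrow> (\<forall>k x t. m k = M \<longrightarrow> t < M \<longrightarrow>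
      entry (blinfun_apply S x) k t = (\<Sum>u<M. coef S t u * entry x k u))" for S
  define Q where "Q = {S \<in> bounded_operators. good S}"
  have shift: "good (shift l)" for l
    unfolding good_def
  proof (intro allI impI)
    fix k x t assume "m k = M" "t < M"
    then show "entry (shift l x) k t = (\<Sum>u<M. coef (shift l) t u * entry x k u)"
      by (subst entry_shift) (auto simp: coef_shift intro!: sum.cong)
  qed
  have compose: "good (S o\<^sub>L R)" if S: "good S" and R: "good R" for S R
    unfolding good_def
  proof (intro allI impI)
    fix k x t assume k: "m k = M" and t: "t < M"
    have "entry (S (R x)) k t = (\<Sum>u<M. coef S t u * (\<Sum>v<M. coef R u v * entry x k v))"
      using S R k t unfolding good_def by simp
    also have "\<dots> = (\<Sum>v<M. (\<Sum>u<M. coef S t u * coef R u v) * entry x k v)"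
      unfolding sum_distrib_left sum_distrib_right by (subst sum.swap) (simp add: mult.assoc)
    also have "\<dots> = (\<Sum>v<M. coef (S o\<^sub>L R) t v * entry x k v)"
    proof -
      have "coef (S o\<^sub>L R) t v = (\<Sum>u<M. coef S t u * coef R u v)" for v
        unfolding coef_def[of "S o\<^sub>L R"] coef_def[of R] blinfun_apply_blinfun_compose
        using S k0 t unfolding good_def by blast
      then show ?thesis by simp
    qed
    finally show "entry ((S o\<^sub>L R) x) k t = (\<Sum>v<M. coef (S o\<^sub>L R) t v * entry x k v)" by simp
  qed
  have "closed Q"
  proof -
    have "closed {S. m k = M \<longrightarrow> t < M \<longrightarrow>
        entry (blinfun_apply S x) k t = (\<Sum>u<M. coef S t u * entry x k u)}" for k x t
    proof (cases "m k = M \<and> t < M")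
      case True
      have "closed {S. entry (blinfun_apply S x) k t = (\<Sum>u<M. coef S t u * entry x k u)}"
        unfolding coef_def
        by (intro closed_Collect_eq continuous_on_sum continuous_on_mult continuous_entry_apply continuous_on_const)
      with True show ?thesis by simp
    qed auto
    then have "closed {S. good S}" unfolding good_def by (intro closed_Collect_all)
    moreover have "Q = bounded_operators \<inter> {S. good S}" by (auto simp: Q_def)
    ultimately show ?thesis using closed_bounded_operators by (simp add: closed_Int)
  qed
  moreover have "S + R \<in> Q" if "S \<in> Q" "R \<in> Q" for S R
    using that unfolding Q_def good_def
    by (simp add: bounded_operators_closure blinfun.add_left coef_simps distrib_right sum.distrib)
  moreover have "oscale c S \<in> Q" if "S \<in> Q" for c S
    using that unfolding Q_def good_def
    by (simp add: oscale_bounded_operator oscale_apply coef_simps sum_distrib_left mult.assoc)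
  moreover have "id_blinfun \<in> Q" "N \<in> Q" "adj N \<in> Q"
    unfolding Q_def using shift[of 0] shift[of 1] shift[of "-1"]
    by (simp_all add: shift_simps id_bounded_operator N_bounded adj_bounded_operator)
  ultimately have "carrier (cstar N) \<subseteq> Q"
    by (intro cstar_subset N_bounded) (auto simp: Q_def compose bounded_operators_closure)
  then show ?thesis using assms unfolding Q_def good_def by blast
qed

lemma coef_compose:
  assumes "S \<in> carrier (cstar N)" "t < M"
  shows "coef (S o\<^sub>L R) t v = (\<Sum>u<M. coef S t u * coef R u v)"
  unfolding coef_def[of "S o\<^sub>L R"] coef_def[of R] blinfun_apply_blinfun_compose
  by (rule entry_maximal_block[OF assms(1) k0 assms(2)])

lemma coef_adj:
  assumes "S \<in> bounded_operators"
  shows "coef (adj S) t u = cnj (coef S u t)"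
  unfolding coef_def cinner_block_vec[symmetric]
  unfolding cinner_adj'[OF assms] by (rule cinner_commute)

definition block_matrix :: "oper \<Rightarrow> complex mat"
  where "block_matrix S = mat M M (\<lambda>(t, u). coef S t u)"

lemma block_matrix_eq_zero_iff: "block_matrix S = 0\<^sub>m M M \<longleftrightarrow> (\<forall>t<M. \<forall>u<M. coef S t u = 0)"
  by (auto simp: block_matrix_def mat_eq_iff)

lemma block_matrix_hom: "block_matrix \<in> Ring.ring_hom (cstar N) (matrix_algebra M)"
proof (rule ring_hom_memI)
  fix S R assume S: "S \<in> carrier (cstar N)" and "R \<in> carrier (cstar N)"
  show "block_matrix (S \<otimes>\<^bsub>cstar N\<^esub> R) = block_matrix S \<otimes>\<^bsub>matrix_algebra M\<^esub> block_matrix R"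
    by (rule eq_matI)
      (auto simp: matrix_algebra_def block_matrix_def coef_compose[OF S] scalar_prod_def atLeast0LessThan)
  show "block_matrix (S \<oplus>\<^bsub>cstar N\<^esub> R) = block_matrix S \<oplus>\<^bsub>matrix_algebra M\<^esub> block_matrix R"
    by (rule eq_matI) (auto simp: matrix_algebra_def block_matrix_def coef_simps)
next
  show "block_matrix \<one>\<^bsub>cstar N\<^esub> = \<one>\<^bsub>matrix_algebra M\<^esub>"
    by (rule eq_matI) (auto simp: matrix_algebra_def block_matrix_def coef_def entry_block_vec k0)
qed (simp add: block_matrix_def matrix_algebra_def)

text \<open>Matrix units. The power \<open>M - 1\<close> of the shift vanishes on every block that is not of
  maximal size and has a single nonzero entry, in the corner, on the others.\<close>

definition matrix_unit :: "nat \<Rightarrow> nat \<Rightarrow> oper"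
  where "matrix_unit a b = opow (adj N) a o\<^sub>L opow N (M - 1) o\<^sub>L opow (adj N) (M - 1 - b)"

lemma entry_matrix_unit:
  assumes "t < m k" "a < M" "b < M"
  shows "entry (matrix_unit a b x) k t = (if m k = M \<and> t = a then entry x k b else 0)"
proof (cases "a \<le> t \<and> t - a + (M - 1) < m k")
  case True
  then have "m k = M" "t = a" using le_M[of k] M_pos by auto
  then show ?thesis
    using assms by (auto simp: matrix_unit_def entry_opow_N entry_opow_adj_N)
next
  case False
  then have "\<not> (m k = M \<and> t = a)" using M_pos by auto
  with False show ?thesis
    using assms by (auto simp: matrix_unit_def entry_opow_N entry_opow_adj_N)
qed

lemma matrix_unit_in_cstar: "matrix_unit a b \<in> carrier (cstar N)"
  unfolding matrix_unit_def
  by (intro cstar_comp opow_cstar N_bounded N_in_cstar adj_N_in_cstar)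

lemma coef_matrix_unit:
  "t < M \<Longrightarrow> u < M \<Longrightarrow> a < M \<Longrightarrow> b < M \<Longrightarrow> coef (matrix_unit a b) t u = (if t = a \<and> u = b then 1 else 0)"
  unfolding coef_def by (subst entry_matrix_unit) (auto simp: k0 entry_block_vec)

lemma block_matrix_surj: "block_matrix ` carrier (cstar N) = carrier (matrix_algebra M)"
proof (intro equalityI subsetI)
  fix X assume "X \<in> carrier (matrix_algebra M)"
  then have X: "X \<in> carrier_mat M M" by (simp add: matrix_algebra_def)
  define S where "S = (\<Sum>a<M. \<Sum>b<M. oscale (X $$ (a, b)) (matrix_unit a b))"
  have "S \<in> carrier (cstar N)"
    unfolding S_def by (intro cstar_sum cstar_scale N_bounded matrix_unit_in_cstar)
  moreover have "coef S t u = X $$ (t, u)" if "t < M" "u < M" for t u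
  proof -
    have "coef S t u = (\<Sum>a<M. \<Sum>b<M. if b = u then (if a = t then X $$ (a, b) else 0) else 0)"
      unfolding S_def coef_simps using that
      by (intro sum.cong refl) (auto simp: coef_matrix_unit)
    then show ?thesis using that by simp
  qed
  then have "block_matrix S = X"
    using X by (intro eq_matI) (auto simp: block_matrix_def)
  ultimately show "X \<in> block_matrix ` carrier (cstar N)" by blast
qed (auto simp: block_matrix_def matrix_algebra_def)

text \<open>Blocks of smaller size are corners of the maximal ones as far as the operator system is
  concerned, so the norm of a matrix over the operator system is attained on a maximal block.\<close>

lemma block_matrix_isometric:
  assumes A: "\<And>i j. i < n \<Longrightarrow> j < n \<Longrightarrow> A i j \<in> operator_system N"
    and CA: "\<And>i j. i < n \<Longrightarrow> j < n \<Longrightarrow> C i j - A i j \<in> carrier (cstar N)"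
    and ker: "\<And>i j. i < n \<Longrightarrow> j < n \<Longrightarrow> block_matrix (C i j - A i j) = 0\<^sub>m M M"
  shows "matrix_norm n A \<le> matrix_norm n C"
proof -
  let ?E = "{-1, 0, 1 :: int}"
  define s where "s = matrix_norm n C"
  obtain c where supp: "\<And>i j l. l \<notin> ?E \<Longrightarrow> c i j l = 0"
    and Ac: "\<And>i j. i < n \<Longrightarrow> j < n \<Longrightarrow> A i j = toeplitz ?E (c i j)"
    using operator_system_toeplitz_matrix[of n A, OF A] by metis
  have "toeplitz_bounded n M c s"
    unfolding toeplitz_bounded_def
  proof
    fix x :: "nat \<Rightarrow> nat \<Rightarrow> complex"
    define v where "v j = block_embed k0 (x j)" for j
    have entry: "entry (C i j (v j)) k0 t = (\<Sum>u<M. c i j (int u - int t) * x j u)"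
      if "i < n" "j < n" "t < M" for i j t
    proof -
      have "entry ((C i j - A i j) (v j)) k0 t = 0"
        using entry_maximal_block[OF CA k0] ker that by (simp add: block_matrix_eq_zero_iff)
      then have "entry (C i j (v j)) k0 t = entry (A i j (v j)) k0 t"
        by (simp add: blinfun.diff_left)
      also have "\<dots> = (\<Sum>u<m k0. c i j (int u - int t) * entry (v j) k0 u)"
        unfolding Ac[OF that(1,2)] by (rule entry_toeplitz[OF _ supp]) (use that k0 in auto)
      finally show ?thesis by (simp add: v_def entry_block_embed k0)
    qed
    have "(\<Sum>i<n. \<Sum>t<M. (norm (\<Sum>j<n. \<Sum>u<M. c i j (int u - int t) * x j u))\<^sup>2) =
        (\<Sum>i<n. \<Sum>t<m k0. (norm (entry (\<Sum>j<n. C i j (v j)) k0 t))\<^sup>2)"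
      by (simp add: entry k0)
    also have "\<dots> \<le> (\<Sum>i<n. (norm (\<Sum>j<n. C i j (v j)))\<^sup>2)"
      by (intro sum_mono norm_entries_le)
    also have "\<dots> = (L2_set (\<lambda>i. norm (\<Sum>j<n. C i j (v j))) {..<n})\<^sup>2"
      by (simp add: L2_set_def sum_nonneg)
    also have "\<dots> \<le> (s * L2_set (\<lambda>j. norm (v j)) {..<n})\<^sup>2"
      unfolding s_def by (intro power_mono matrix_norm_apply) simp
    also have "\<dots> = s\<^sup>2 * (\<Sum>j<n. (norm (v j))\<^sup>2)"
      by (simp add: L2_set_def sum_nonneg power_mult_distrib)
    finally show "(\<Sum>i<n. \<Sum>t<M. (norm (\<Sum>j<n. \<Sum>u<M. c i j (int u - int t) * x j u))\<^sup>2) \<le>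
        s\<^sup>2 * (\<Sum>j<n. \<Sum>u<M. (norm (x j u))\<^sup>2)"
      by (simp add: v_def norm_block_embed k0)
  qed
  then show ?thesis
    unfolding s_def[symmetric]
    using le_M supp Ac by (intro matrix_norm_toeplitz_le[of s ?E c])
      (auto simp: s_def matrix_norm_nonneg intro: toeplitz_bounded_mono)
qed

text \<open>Multiplication by matrix units on both sides isolates a nonzero coefficient. It is the same
  in all maximal blocks, and the smaller blocks are annihilated, so what is left is a multiple of a
  matrix unit.\<close>

lemma ideal_contains_matrix_units:
  assumes L: "boundary_ideal N L" and S: "S \<in> L" and nz: "coef S p q \<noteq> 0" and pq: "p < M" "q < M"
    and ab: "a < M" "b < M"
  shows "matrix_unit a b \<in> L"
proof -
  have S': "S \<in> carrier (cstar N)" by (rule boundary_ideal_subset[OF L S])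
  have "matrix_unit a b = oscale (1 / coef S p q) (matrix_unit a p o\<^sub>L S o\<^sub>L matrix_unit q b)"
  proof (intro blinfun_eqI entry_eqI)
    fix x k t assume t: "t < m k"
    have "entry (S (matrix_unit q b x)) k p = coef S p q * entry x k b" if k: "m k = M"
    proof -
      have "entry (S (matrix_unit q b x)) k p = (\<Sum>u<M. coef S p u * entry (matrix_unit q b x) k u)"
        by (rule entry_maximal_block[OF S' k pq(1)])
      also have "\<dots> = (\<Sum>u<M. if u = q then coef S p u * entry x k b else 0)"
        using pq ab k by (intro sum.cong refl) (simp add: entry_matrix_unit)
      finally show ?thesis using pq by simp
    qed
    then show "entry (matrix_unit a b x) k t =
        entry (oscale (1 / coef S p q) (matrix_unit a p o\<^sub>L S o\<^sub>L matrix_unit q b) x) k t"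
      using t ab pq nz by (simp add: oscale_apply entry_matrix_unit)
  qed
  also have "\<dots> = oscale (1 / coef S p q) id_blinfun o\<^sub>L (matrix_unit a p o\<^sub>L S o\<^sub>L matrix_unit q b)"
    by (rule blinfun_eqI) (simp add: oscale_apply)
  also have "\<dots> \<in> L"
    by (intro boundary_ideal_left[OF L] boundary_ideal_right[OF L] S matrix_unit_in_cstar
        cstar_scale cstar_id N_bounded)
  finally show ?thesis .
qed

text \<open>The norm of \<open>2 + N + N*\<close> on a block of size \<open>r\<close> is \<open>2 + 2 cos (\<pi> / (r + 1))\<close>, with an
  eigenvector of sines. It increases strictly with \<open>r\<close>, so it drops when the maximal blocks are
  removed; a boundary ideal cannot contain the projection onto them. The summand \<open>2\<close> makes the
  argument work for \<open>M = 1\<close> as well, where \<open>N\<close> is zero.\<close>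

lemma block_matrix_maximal:
  assumes L: "boundary_ideal N L" and S: "S \<in> L"
  shows "block_matrix S = 0\<^sub>m M M"
proof (rule ccontr)
  assume "block_matrix S \<noteq> 0\<^sub>m M M"
  then obtain p q where pq: "p < M" "q < M" "coef S p q \<noteq> 0"
    unfolding block_matrix_eq_zero_iff by blast
  define P where "P = (\<Sum>a<M. matrix_unit a a)"
  have "(\<Sum>a\<in>I. matrix_unit a a) \<in> L" if "I \<subseteq> {..<M}" for I
    using finite_subset[OF that finite_lessThan] that
    by (induction I rule: finite_induct)
      (auto intro!: boundary_ideal_zero[OF L] boundary_ideal_add[OF L]
        ideal_contains_matrix_units[OF L S pq(3,1,2)])
  then have P: "P \<in> L" unfolding P_def by blast
  have entry_P: "entry (P x) k t = (if m k = M then entry x k t else 0)" if t: "t < m k" for x k t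
  proof -
    have "entry (P x) k t = (\<Sum>a<M. if a = t then (if m k = M then entry x k t else 0) else 0)"
      using t by (auto simp: P_def blinfun.sum_left entry_matrix_unit intro!: sum.cong)
    then show ?thesis using t le_M[of k] by auto
  qed
  define c :: "int \<Rightarrow> complex" where "c l = (if l = 0 then 2 else if \<bar>l\<bar> = 1 then 1 else 0)" for l
  define A where "A = toeplitz {-1, 0, 1} c"
  have supp: "c l = 0" if "l \<notin> {-1, 0, 1}" for l using that by (auto simp: c_def)
  have A_eq: "A = oscale 2 id_blinfun + oscale 1 N + oscale 1 (adj N)"
    by (simp add: A_def toeplitz_def c_def shift_simps add_ac)
  have A: "A \<in> operator_system N" unfolding A_eq by (rule operator_systemI)
  have entry_A: "entry (A x) k t =
      2 * entry x k t + (if t = 0 then 0 else entry x k (t - 1)) +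
      (if Suc t < m k then entry x k (Suc t) else 0)" if "t < m k" for x k t
  proof -
    have "entry (A x) k t = (\<Sum>u<m k. c (int u - int t) * entry x k u)"
      unfolding A_def by (rule entry_toeplitz[OF _ supp that]) simp
    then show ?thesis unfolding c_def tridiagonal_sum[OF that] .
  qed
  define B where "B = - (A o\<^sub>L P)"
  have "B = oscale (-1) A o\<^sub>L P"
    by (rule blinfun_eqI) (simp add: B_def oscale_minus_one blinfun.minus_left)
  then have B: "B \<in> L"
    using A operator_system_subset_cstar
    by (auto intro!: boundary_ideal_left[OF L] P cstar_scale N_bounded)
  have lower: "2 + 2 * cos (pi / real (M + 1)) \<le> norm A"
  proof -
    define \<phi> where "\<phi> = pi / real (M + 1)"
    define v where "v t = sin (real (t + 1) * \<phi>)" for t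
    define x where "x = block_embed k0 (\<lambda>t. of_real (v t))"
    have end_zero: "sin (real (M + 1) * \<phi>) = 0" by (simp add: \<phi>_def)
    have "A x = cscale (of_real (2 + 2 * cos \<phi>)) x"
    proof (rule entry_eqI)
      fix k t assume t: "t < m k"
      show "entry (A x) k t = entry (cscale (of_real (2 + 2 * cos \<phi>)) x) k t"
      proof (cases "k = k0")
        case True
        have "(if t = 0 then 0 else v (t - 1)) = sin (real t * \<phi>)" by (simp add: v_def)
        moreover have "(if Suc t < M then v (Suc t) else 0) = sin (real (t + 2) * \<phi>)"
        proof (cases "Suc t < M")
          case False
          then have "t + 2 = M + 1" using t True k0 by simp
          then show ?thesis using False end_zero by metis
        qed (simp add: v_def)
        ultimately have "2 * v t + (if t = 0 then 0 else v (t - 1)) + (if Suc t < M then v (Suc t) else 0) =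
            (2 + 2 * cos \<phi>) * v t"
          using sin_recurrence[of t \<phi>] unfolding v_def by (simp add: algebra_simps)
        then have "of_real (2 * v t + (if t = 0 then 0 else v (t - 1)) + (if Suc t < M then v (Suc t) else 0)) =
            (of_real ((2 + 2 * cos \<phi>) * v t) :: complex)"
          by (rule arg_cong)
        moreover have "entry (A x) k t =
            of_real (2 * v t + (if t = 0 then 0 else v (t - 1)) + (if Suc t < M then v (Suc t) else 0))"
          using t True k0 by (auto simp: entry_A x_def entry_block_embed)
        ultimately show ?thesis using t True by (simp add: x_def entry_block_embed)
      qed (use t in \<open>simp add: entry_A x_def entry_block_embed\<close>)
    qed
    then have "norm A * norm x \<ge> (2 + 2 * cos \<phi>) * norm x"
    proof -
      have "\<bar>2 + 2 * cos \<phi>\<bar> * norm x = norm (A x)"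
        using \<open>A x = _\<close> by (simp only: norm_cscale norm_of_real)
      also have "\<dots> \<le> norm A * norm x" by (rule norm_blinfun)
      finally show ?thesis using cos_ge_minus_one[of \<phi>] by simp
    qed
    moreover have "x \<noteq> 0"
    proof
      assume "x = 0"
      then have "entry x k0 0 = 0" by simp
      then have "v 0 = 0" using M_pos k0 by (simp add: x_def entry_block_embed)
      moreover have "0 < \<phi>" "\<phi> < pi" using M_pos by (auto simp: \<phi>_def field_simps)
      ultimately show False using sin_gt_zero[of \<phi>] by (simp add: v_def)
    qed
    ultimately show ?thesis by (simp add: \<phi>_def)
  qed
  have upper: "norm (A + B) \<le> 2 + 2 * cos (pi / real M)"
  proof -
    define \<phi> where "\<phi> = pi / real M"
    define C where "C = 2 + 2 * cos \<phi>"
    have C: "0 \<le> C" using cos_ge_minus_one[of \<phi>] unfolding C_def by linarith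
    have "norm ((A + B) x) \<le> C * norm x" for x
    proof -
      have eq: "(A + B) x = A (x - P x)"
        by (simp add: B_def blinfun.diff_left blinfun.diff_right)
      have "(\<Sum>t<m k. (norm (entry ((A + B) x) k t))\<^sup>2) \<le> C\<^sup>2 * (\<Sum>t<m k. (norm (entry x k t))\<^sup>2)" for k
      proof (cases "m k = M")
        case True
        then have "entry ((A + B) x) k t = 0" if "t < m k" for t
          unfolding eq using that by (auto simp: entry_A entry_P)
        then show ?thesis by (simp add: sum_nonneg)
      next
        case False
        then have less: "m k < M" using le_M[of k] by simp
        define K :: "nat \<Rightarrow> nat \<Rightarrow> real"
          where "K t u = (if int u - int t = 0 then 2 else if \<bar>int u - int t\<bar> = 1 then 1 else 0)" for t u
        define v where "v t = sin (real (t + 1) * \<phi>)" for t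
        have ent: "entry ((A + B) x) k t = (\<Sum>u<m k. of_real (K t u) * entry x k u)" if "t < m k" for t
        proof -
          have "(\<Sum>u<m k. of_real (K t u) * entry x k u) =
            (\<Sum>u<m k. (if int u - int t = 0 then 2 else if \<bar>int u - int t\<bar> = 1 then 1 else 0) * entry x k u)"
            by (intro sum.cong refl) (simp add: K_def)
          also have "\<dots> = entry ((A + B) x) k t"
            unfolding tridiagonal_sum[OF that] eq using that False by (auto simp: entry_A entry_P)
          finally show ?thesis ..
        qed
        have sin_nonneg: "0 \<le> sin (real t * \<phi>)" if "t \<le> M" for t
        proof (rule sin_ge_zero)
          show "real t * \<phi> \<le> pi" using that M_pos by (simp add: \<phi>_def field_simps)
        qed (simp add: \<phi>_def)
        have "(\<Sum>t<m k. (norm (\<Sum>u<m k. of_real (K t u) * entry x k u))\<^sup>2) \<le> C\<^sup>2 * (\<Sum>u<m k. (norm (entry x k u))\<^sup>2)"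
        proof (rule schur_test[OF _ _ _ _ C])
          show "0 \<le> K t u" "K t u = K u t" for t u
            by (auto simp: K_def)
          fix t assume t: "t < m k"
          show "0 < v t"
            unfolding v_def
          proof (rule sin_gt_zero)
            show "0 < real (t + 1) * \<phi>" using M_pos by (simp add: \<phi>_def)
            have "real (t + 1) < real M" using t less by linarith
            then have "real (t + 1) * pi < real M * pi" by (intro mult_strict_right_mono) auto
            then show "real (t + 1) * \<phi> < pi" using M_pos by (simp add: \<phi>_def field_simps)
          qed
          have "(\<Sum>u<m k. K t u * v u) =
              2 * v t + (if t = 0 then 0 else v (t - 1)) + (if Suc t < m k then v (Suc t) else 0)"
            unfolding K_def by (rule tridiagonal_sum[OF t])
          also have "\<dots> \<le> 2 * v t + sin (real t * \<phi>) + sin (real (t + 2) * \<phi>)"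
            using sin_nonneg[of "t + 2"] t less by (auto simp: v_def)
          also have "\<dots> = C * v t"
            using sin_recurrence[of t \<phi>] by (simp add: C_def v_def algebra_simps)
          finally show "(\<Sum>u<m k. K t u * v u) \<le> C * v t" .
        qed
        then show ?thesis by (simp add: ent)
      qed
      then have "L2_set (\<lambda>i. norm ((A + B) x)) {..<1::nat} \<le> C * L2_set (\<lambda>j. norm x) {..<1::nat}"
        by (intro norm_le_blockwise C) simp
      then show ?thesis by (simp add: L2_set_def)
    qed
    then show ?thesis
      using C unfolding C_def \<phi>_def by (intro norm_blinfun_bound) auto
  qed
  have "cos (pi / real M) < cos (pi / real (M + 1))"
    using M_pos by (intro cos_monotone_0_pi) (auto simp: field_simps)
  then show False
    using lower upper boundary_ideal_norm_le[OF L A B] by linarith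
qed

lemma mat_adjoint_index:
  "X \<in> carrier_mat n n \<Longrightarrow> i < n \<Longrightarrow> j < n \<Longrightarrow> mat_adjoint X $$ (i, j) = cnj (X $$ (j, i))"
  by (simp add: mat_adjoint_def mat_of_rows_index)

proposition envelope_bounded: "star_isomorphic (cstar_envelope N) (matrix_algebra M)"
proof (rule cstar_envelope_isomorphic[OF N_bounded block_matrix_hom block_matrix_surj])
  show "block_matrix 0 = zero (matrix_algebra M)"
    by (simp add: matrix_algebra_def block_matrix_eq_zero_iff coef_simps)
  show "block_matrix (oscale c S) = scal (matrix_algebra M) c (block_matrix S)" for S c
    by (rule eq_matI) (auto simp: matrix_algebra_def block_matrix_def coef_simps)
  show "block_matrix (adj S) = star (matrix_algebra M) (block_matrix S)"
    if "S \<in> carrier (cstar N)" for S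
  proof (rule eq_matI)
    have X: "block_matrix S \<in> carrier_mat M M" by (simp add: block_matrix_def)
    show "dim_row (block_matrix (adj S)) = dim_row (star (matrix_algebra M) (block_matrix S))"
      "dim_col (block_matrix (adj S)) = dim_col (star (matrix_algebra M) (block_matrix S))"
      by (simp_all add: matrix_algebra_def block_matrix_def mat_adjoint_def)
    fix i j assume "i < dim_row (star (matrix_algebra M) (block_matrix S))"
      "j < dim_col (star (matrix_algebra M) (block_matrix S))"
    then have "i < M" "j < M" by (simp_all add: matrix_algebra_def block_matrix_def mat_adjoint_def)
    then show "block_matrix (adj S) $$ (i, j) = star (matrix_algebra M) (block_matrix S) $$ (i, j)"
      using mat_adjoint_index[OF X] coef_adj[OF cstar_bounded[OF N_bounded that]]
      by (simp add: matrix_algebra_def block_matrix_def)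
  qed
  have "closed {S. \<forall>t u. t < M \<longrightarrow> u < M \<longrightarrow> coef S t u = 0}"
  proof (intro closed_Collect_all)
    fix t u
    have "closed {S. coef S t u = 0}"
      unfolding coef_def by (intro closed_Collect_eq continuous_entry_apply continuous_on_const)
    then show "closed {S. t < M \<longrightarrow> u < M \<longrightarrow> coef S t u = 0}"
      by (cases "t < M \<and> u < M") auto
  qed
  then have "closed (carrier (cstar N) \<inter> {S. \<forall>t u. t < M \<longrightarrow> u < M \<longrightarrow> coef S t u = 0})"
    by (intro closed_Int cstar_closed N_bounded)
  moreover have "carrier (cstar N) \<inter> {S. \<forall>t u. t < M \<longrightarrow> u < M \<longrightarrow> coef S t u = 0} =
      {S \<in> carrier (cstar N). block_matrix S = zero (matrix_algebra M)}"
    by (auto simp: matrix_algebra_def block_matrix_eq_zero_iff)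
  ultimately show "closed {S \<in> carrier (cstar N). block_matrix S = zero (matrix_algebra M)}" by simp
qed (auto simp: matrix_algebra_def intro: block_matrix_isometric block_matrix_maximal)

end

section \<open>Laurent polynomials on the circle\<close>

text \<open>On the circle every Laurent polynomial can be written as a power of the conjugate variable times a
  polynomial, which makes closure under products immediate.\<close>

definition laurent_on_circle :: "(complex \<Rightarrow> complex) \<Rightarrow> bool"
  where "laurent_on_circle q \<longleftrightarrow> (\<exists>p d. \<forall>z. norm z = 1 \<longrightarrow> q z = cnj z ^ d * poly p z)"

lemma circle_power_cancel:
  fixes z :: complex
  shows "norm z = 1 \<Longrightarrow> cnj z ^ d * z ^ d = 1"
  using complex_norm_square[of z] by (simp add: power_mult_distrib[symmetric] mult.commute)

lemma laurent_add:
  assumes "laurent_on_circle q" "laurent_on_circle q'"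
  shows "laurent_on_circle (\<lambda>z. q z + q' z)"
proof -
  obtain p d where p: "\<And>z. norm z = 1 \<Longrightarrow> q z = cnj z ^ d * poly p z"
    using assms(1) unfolding laurent_on_circle_def by blast
  obtain p' d' where p': "\<And>z. norm z = 1 \<Longrightarrow> q' z = cnj z ^ d' * poly p' z"
    using assms(2) unfolding laurent_on_circle_def by blast
  have "q z + q' z = cnj z ^ (d + d') * poly (monom 1 d' * p + monom 1 d * p') z" if z: "norm z = 1" for z
  proof -
    have "cnj z ^ (d + d') * poly (monom 1 d' * p + monom 1 d * p') z =
        (cnj z ^ d' * z ^ d') * (cnj z ^ d * poly p z) + (cnj z ^ d * z ^ d) * (cnj z ^ d' * poly p' z)"
      by (simp add: poly_monom power_add algebra_simps)
    then show ?thesis using z by (simp add: circle_power_cancel p p')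
  qed
  then show ?thesis unfolding laurent_on_circle_def by blast
qed

lemma laurent_mult:
  assumes "laurent_on_circle q" "laurent_on_circle q'"
  shows "laurent_on_circle (\<lambda>z. q z * q' z)"
proof -
  obtain p d where p: "\<And>z. norm z = 1 \<Longrightarrow> q z = cnj z ^ d * poly p z"
    using assms(1) unfolding laurent_on_circle_def by blast
  obtain p' d' where p': "\<And>z. norm z = 1 \<Longrightarrow> q' z = cnj z ^ d' * poly p' z"
    using assms(2) unfolding laurent_on_circle_def by blast
  have "q z * q' z = cnj z ^ (d + d') * poly (p * p') z" if "norm z = 1" for z
    using that by (simp add: p p' power_add mult_ac)
  then show ?thesis unfolding laurent_on_circle_def by blast
qed

lemma laurent_const: "laurent_on_circle (\<lambda>z. c)"
  unfolding laurent_on_circle_def by (intro exI[of _ "[:c:]"] exI[of _ 0]) simp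

lemma laurent_real_polynomial:
  assumes "real_polynomial_function g"
  shows "laurent_on_circle (\<lambda>z. of_real (g z))"
  using assms
proof induction
  case (linear f)
  define a where "a = (of_real (f 1) - \<i> * of_real (f \<i>)) / 2"
  have f: "f z = Re z * f 1 + Im z * f \<i>" for z
  proof -
    have "z = Re z *\<^sub>R 1 + Im z *\<^sub>R \<i>" by (simp add: complex_eq_iff)
    then have "f z = f (Re z *\<^sub>R 1 + Im z *\<^sub>R \<i>)" by simp
    also have "\<dots> = Re z * f 1 + Im z * f \<i>"
      by (simp only: linear_simps[OF linear] real_scaleR_def)
    finally show ?thesis .
  qed
  have lin: "of_real (f z) = a * z + cnj a * cnj z" for z
    by (subst f) (simp add: a_def complex_eq_iff field_simps)
  have "of_real (f z) = cnj z ^ 1 * poly [:cnj a, 0, a:] z" if "norm z = 1" for z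
  proof -
    have "cnj z ^ 1 * poly [:cnj a, 0, a:] z = (cnj z ^ 1 * z ^ 1) * (a * z) + cnj a * cnj z"
      by (simp add: algebra_simps)
    then show ?thesis unfolding circle_power_cancel[OF that] lin by simp
  qed
  then show ?case unfolding laurent_on_circle_def by blast
qed (auto intro: laurent_const laurent_add laurent_mult)

lemma laurent_coefficients:
  assumes "laurent_on_circle q"
  obtains E c where "finite E" "\<And>l. l \<notin> E \<Longrightarrow> c l = 0"
    "\<And>z. norm z = 1 \<Longrightarrow> q z = (\<Sum>l\<in>E. c l * z powi l)"
proof -
  obtain p d where p: "\<And>z. norm z = 1 \<Longrightarrow> q z = cnj z ^ d * poly p z"
    using assms unfolding laurent_on_circle_def by blast
  define E where "E = (\<lambda>e. int e - int d) ` {..degree p}"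
  define c where "c l = (if l \<in> E then coeff p (nat (l + int d)) else 0)" for l
  have "q z = (\<Sum>l\<in>E. c l * z powi l)" if z: "norm z = 1" for z
  proof -
    have nz: "z \<noteq> 0" using z by auto
    have inv: "cnj z = inverse z"
      using circle_power_cancel[OF z, of 1] nz by (simp add: field_simps)
    have "(\<Sum>l\<in>E. c l * z powi l) = (\<Sum>e\<le>degree p. c (int e - int d) * z powi (int e - int d))"
      unfolding E_def by (subst sum.reindex) (auto simp: inj_on_def)
    also have "\<dots> = (\<Sum>e\<le>degree p. cnj z ^ d * (coeff p e * z ^ e))"
    proof (intro sum.cong refl)
      fix e assume "e \<in> {..degree p}"
      then have "c (int e - int d) = coeff p e" by (simp add: c_def E_def)
      moreover have "z powi (int e - int d) = cnj z ^ d * z ^ e"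
        using nz by (simp add: power_int_diff inv field_simps)
      ultimately show "c (int e - int d) * z powi (int e - int d) = cnj z ^ d * (coeff p e * z ^ e)"
        by simp
    qed
    also have "\<dots> = q z"
      by (simp add: p[OF z] poly_altdef sum_distrib_left)
    finally show ?thesis ..
  qed
  then show thesis by (intro that[of E c]) (auto simp: E_def c_def)
qed

lemma laurent_approximation:
  assumes "continuous_on (sphere 0 1) f" "0 < e"
  obtains q where "laurent_on_circle q" "\<And>z. norm z = 1 \<Longrightarrow> norm (f z - q z) < e"
proof -
  obtain g where g: "polynomial_function g" "\<And>z. z \<in> sphere 0 1 \<Longrightarrow> norm (f z - g z) < e"
    using Stone_Weierstrass_polynomial_function[OF compact_sphere assms] by blast
  have "real_polynomial_function (Re \<circ> g)" "real_polynomial_function (Im \<circ> g)"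
    using g(1) bounded_linear_Re bounded_linear_Im unfolding polynomial_function_def by blast+
  then have "laurent_on_circle (\<lambda>z. of_real ((Re \<circ> g) z) + \<i> * of_real ((Im \<circ> g) z))"
    by (intro laurent_add laurent_mult laurent_const laurent_real_polynomial)
  moreover have "(\<lambda>z. of_real ((Re \<circ> g) z) + \<i> * of_real ((Im \<circ> g) z)) = g"
    by (auto simp: complex_eq_iff)
  ultimately show thesis using that g(2) by (metis mem_sphere_0)
qed

section \<open>Unbounded block sizes\<close>

context nilpotent_sum
begin

lemma norm_toeplitz_le:
  assumes "finite E" and supp: "\<And>l. l \<notin> E \<Longrightarrow> c l = 0" and "0 \<le> s"
    and symbol: "\<And>z. norm z = 1 \<Longrightarrow> norm (\<Sum>l\<in>E. c l * z powi l) \<le> s"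
  shows "norm (toeplitz E c) \<le> s"
proof -
  have "toeplitz_bounded 1 r (\<lambda>_ _. c) s" for r
  proof (rule toeplitz_bounded_symbol[OF assms(1) supp])
    fix z :: complex and v :: "nat \<Rightarrow> complex"
    assume "norm z = 1"
    then have "(norm (\<Sum>l\<in>E. c l * z powi l))\<^sup>2 \<le> s\<^sup>2" by (intro power_mono symbol) auto
    then show "(\<Sum>i<(1::nat). (norm (\<Sum>j<1. (\<Sum>l\<in>E. c l * z powi l) * v j))\<^sup>2) \<le> s\<^sup>2 * (\<Sum>j<1. (norm (v j))\<^sup>2)"
      by (simp add: norm_mult power_mult_distrib mult_right_mono)
  qed
  then have "matrix_norm 1 (\<lambda>_ _. toeplitz E c) \<le> s"
    using assms supp by (intro matrix_norm_toeplitz_le[of s E "\<lambda>_ _. c"]) auto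
  then show ?thesis unfolding matrix_norm_one .
qed

lemma toeplitz_diff:
  assumes "finite E" "\<And>l. l \<notin> E \<Longrightarrow> c l = 0" "finite E'" "\<And>l. l \<notin> E' \<Longrightarrow> c' l = 0"
  shows "toeplitz E c - toeplitz E' c' = toeplitz (E \<union> E') (\<lambda>l. c l - c' l)"
proof -
  have "toeplitz E c = toeplitz (E \<union> E') c" "toeplitz E' c' = toeplitz (E \<union> E') c'"
    unfolding toeplitz_def using assms by (auto intro!: sum.mono_neutral_left)
  then show ?thesis by (simp add: toeplitz_def oscale_diff_left sum_subtractf)
qed

text \<open>Convergence along this filter means convergence along unit vectors that are
  approximate eigenvectors of the shift and its adjoint, for \<open>z\<close> and its conjugate.\<close>

definition eigen_filter :: "complex \<Rightarrow> ell2 filter"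
  where "eigen_filter z =
    inf (filtercomap (\<lambda>x. norm (N x - cscale z x) + norm (adj N x - cscale (cnj z) x)) (nhds 0))
      (principal {x. norm x = 1})"

text \<open>The operator \<open>S\<close> acts on approximate eigenvectors for \<open>z\<close> like the scalar \<open>c\<close>.\<close>

definition is_symbol :: "complex \<Rightarrow> oper \<Rightarrow> complex \<Rightarrow> bool"
  where "is_symbol z S c \<longleftrightarrow> ((\<lambda>x. S x - cscale c x) \<longlongrightarrow> 0) (eigen_filter z)"

lemma eventually_unit: "eventually (\<lambda>x. norm x = 1) (eigen_filter z)"
  unfolding eigen_filter_def by (simp add: eventually_inf_principal)

lemma is_symbol_N: "is_symbol z N z" and is_symbol_adj_N: "is_symbol z (adj N) (cnj z)"
proof -
  have lim: "((\<lambda>x. norm (N x - cscale z x) + norm (adj N x - cscale (cnj z) x)) \<longlongrightarrow> 0) (eigen_filter z)"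
    unfolding eigen_filter_def by (rule filterlim_mono[OF filterlim_filtercomap]) auto
  show "is_symbol z N z" "is_symbol z (adj N) (cnj z)"
    unfolding is_symbol_def by (rule Lim_null_comparison[OF _ lim]; simp)+
qed

lemma is_symbol_id: "is_symbol z id_blinfun 1"
  by (simp add: is_symbol_def)

lemma is_symbol_add: "is_symbol z S c \<Longrightarrow> is_symbol z R d \<Longrightarrow> is_symbol z (S + R) (c + d)"
  unfolding is_symbol_def using tendsto_add[of "\<lambda>x. S x - cscale c x" 0]
  by (fastforce simp: blinfun.add_left cscale_add_left algebra_simps)

lemma is_symbol_oscale: "is_symbol z S c \<Longrightarrow> is_symbol z (oscale a S) (a * c)"
  unfolding is_symbol_def using bounded_linear.tendsto[OF bounded_linear_cscale[of a], of "\<lambda>x. S x - cscale c x" 0]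
  by (simp add: oscale_apply cscale_diff_right)

lemma is_symbol_diff: "is_symbol z S c \<Longrightarrow> is_symbol z R d \<Longrightarrow> is_symbol z (S - R) (c - d)"
  using is_symbol_add[of z S c "oscale (-1) R" "-1 * d"] is_symbol_oscale[of z R d "-1"]
  by (simp add: oscale_minus_one)

lemma is_symbol_zero: "is_symbol z 0 0"
  by (simp add: is_symbol_def)

lemma is_symbol_sum: "(\<And>i. i \<in> I \<Longrightarrow> is_symbol z (F i) (c i)) \<Longrightarrow> is_symbol z (\<Sum>i\<in>I. F i) (\<Sum>i\<in>I. c i)"
  by (induction I rule: infinite_finite_induct) (auto simp: is_symbol_zero is_symbol_add)

lemma is_symbol_compose:
  assumes S: "S \<in> bounded_operators" and "is_symbol z S c" "is_symbol z R d"
  shows "is_symbol z (S o\<^sub>L R) (c * d)"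
proof -
  have "((\<lambda>x. S (R x - cscale d x) + cscale d (S x - cscale c x)) \<longlongrightarrow> S 0 + cscale d 0) (eigen_filter z)"
    using assms(2,3) unfolding is_symbol_def
    by (intro tendsto_add bounded_linear.tendsto[OF bounded_linear_cscale] blinfun.tendsto tendsto_const)
  moreover have "S (R x - cscale d x) + cscale d (S x - cscale c x) = (S o\<^sub>L R) x - cscale (c * d) x" for x
    by (simp add: blinfun.diff_right bounded_operatorsD[OF S] cscale_diff_right mult.commute)
  ultimately show ?thesis by (simp add: is_symbol_def)
qed

lemma is_symbol_toeplitz:
  assumes "norm z = 1"
  shows "is_symbol z (toeplitz E c) (\<Sum>l\<in>E. c l * z powi l)"
proof -
  have pow: "is_symbol z (opow S l) (a ^ l)" if "S \<in> bounded_operators" "is_symbol z S a" for S a l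
    using that by (induction l) (auto simp: is_symbol_id intro: is_symbol_compose)
  have "is_symbol z (shift l) (z powi l)" for l
    using pow[OF N_bounded is_symbol_N, of "nat l"]
      pow[OF adj_bounded_operator[OF N_bounded] is_symbol_adj_N, of "nat (- l)"]
      circle_power_cancel[OF assms, of 1] assms
    by (auto simp: shift_def power_int_def) (metis inverse_unique mult.commute)
  then show ?thesis
    unfolding toeplitz_def by (intro is_symbol_sum is_symbol_oscale)
qed

end

locale unbounded_nilpotent_sum = nilpotent_sum +
  assumes unbounded: "\<exists>k. n \<le> m k"
begin

text \<open>The vector with entries \<open>z ^ t\<close> in a block of size \<open>r\<close> fails to be an eigenvector of the
  shift and of its adjoint only at one end of the block each, with a defect of relative size
  \<open>1 / sqrt r\<close>.\<close>

lemma eigen_filter_nontrivial: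
  assumes z: "norm z = 1"
  shows "eigen_filter z \<noteq> bot"
proof
  assume "eigen_filter z = bot"
  then have "eventually (\<lambda>_. False) (eigen_filter z)" by simp
  then obtain P where P: "eventually P (nhds (0::real))"
    and none: "\<And>x. P (norm (N x - cscale z x) + norm (adj N x - cscale (cnj z) x)) \<Longrightarrow> norm x \<noteq> 1"
    unfolding eigen_filter_def
    by (auto simp: eventually_inf_principal eventually_filtercomap)
  obtain e where e: "0 < e" "\<And>y. \<bar>y\<bar> < e \<Longrightarrow> P y"
    using P unfolding eventually_nhds_metric by (auto simp: dist_real_def)
  \<comment> \<open>For this block size the total defect \<open>2 / sqrt r\<close> is smaller than \<open>e\<close>.\<close>
  obtain k where k: "nat \<lceil>(2 / e)\<^sup>2\<rceil> + 1 \<le> m k" using unbounded by blast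
  define r where "r = m k"
  have r: "0 < r" "(2 / e)\<^sup>2 < real r" using k by (auto simp: r_def) linarith
  define v where "v t = z ^ t / of_real (sqrt (real r))" for t
  define x where "x = block_embed k v"
  have "(norm x)\<^sup>2 = (\<Sum>t<r. 1 / real r)"
    by (simp add: x_def norm_block_embed r_def v_def norm_divide norm_power z power_divide)
  then have nx: "norm x = 1" using r norm_ge_zero[of x] by (auto simp: power2_eq_1_iff)
  have unit: "norm (block_vec k t) = 1" if "t < m k" for t
  proof -
    have "of_real ((norm (block_vec k t))\<^sup>2) = (1 :: complex)"
      using that unfolding cinner_self[symmetric] by (simp add: cinner_block_vec entry_block_vec)
    then have "(norm (block_vec k t))\<^sup>2 = 1" by (simp only: of_real_eq_1_iff)
    then show ?thesis using norm_ge_zero[of "block_vec k t"] by (auto simp: power2_eq_1_iff)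
  qed
  have zz: "cnj z * z = 1" using circle_power_cancel[OF z, of 1] by simp
  have v_Suc: "v (Suc t) = z * v t" and v_pred: "cnj z * v (Suc t) = v t" for t
    using zz by (simp_all add: v_def flip: mult.assoc)
  have "N x - cscale z x = cscale (- z * v (r - 1)) (block_vec k (r - 1))"
  proof (rule entry_eqI)
    fix l t assume t: "t < m l"
    have "Suc t < r \<or> t = r - 1" if "l = k" using t that r by (auto simp: r_def)
    then show "entry (N x - cscale z x) l t = entry (cscale (- z * v (r - 1)) (block_vec k (r - 1))) l t"
      using t r by (auto simp: x_def entry_N entry_block_embed entry_block_vec v_Suc r_def)
  qed
  then have d1: "norm (N x - cscale z x) = 1 / sqrt (real r)"
    using r by (simp add: norm_cscale unit r_def v_def norm_mult norm_divide norm_power z)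
  have "adj N x - cscale (cnj z) x = cscale (- cnj z * v 0) (block_vec k 0)"
  proof (rule entry_eqI)
    fix l t assume t: "t < m l"
    show "entry (adj N x - cscale (cnj z) x) l t = entry (cscale (- cnj z * v 0) (block_vec k 0)) l t"
    proof (cases t)
      case (Suc u)
      then show ?thesis
        using t r by (auto simp: x_def entry_adj_N entry_block_embed entry_block_vec v_pred r_def)
    qed (use t r in \<open>auto simp: x_def entry_adj_N entry_block_embed entry_block_vec r_def\<close>)
  qed
  then have d2: "norm (adj N x - cscale (cnj z) x) = 1 / sqrt (real r)"
    using r by (simp add: norm_cscale unit r_def v_def norm_mult norm_divide z)
  have "2 / e < sqrt (real r)"
    using r e by (intro real_less_rsqrt) simp
  then have "2 / sqrt (real r) < e" using e r by (simp add: field_simps)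
  then have "P (norm (N x - cscale z x) + norm (adj N x - cscale (cnj z) x))"
    using r by (intro e(2)) (simp add: d1 d2)
  then show False using none nx by blast
qed

lemma is_symbol_norm_le:
  assumes "norm z = 1" "is_symbol z S c"
  shows "norm c \<le> norm S"
proof -
  have "((\<lambda>x. norm (S x - cscale c x)) \<longlongrightarrow> 0) (eigen_filter z)"
    using assms(2) unfolding is_symbol_def by (rule tendsto_norm_zero)
  moreover have "eventually (\<lambda>x. norm c - norm S \<le> norm (S x - cscale c x)) (eigen_filter z)"
    using eventually_unit
  proof (rule eventually_mono)
    fix x :: ell2 assume x: "norm x = 1"
    have "norm c = norm (cscale c x)" using x by (simp add: norm_cscale)
    also have "\<dots> \<le> norm (S x) + norm (S x - cscale c x)"
      by (metis norm_triangle_sub norm_minus_commute)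
    also have "norm (S x) \<le> norm S" using norm_blinfun[of S x] x by simp
    finally show "norm c - norm S \<le> norm (S x - cscale c x)" by simp
  qed
  ultimately have "norm c - norm S \<le> 0"
    by (rule tendsto_lowerbound) (rule eigen_filter_nontrivial[OF assms(1)])
  then show ?thesis by simp
qed

lemma is_symbol_unique:
  "norm z = 1 \<Longrightarrow> is_symbol z S c \<Longrightarrow> is_symbol z S d \<Longrightarrow> c = d"
  using is_symbol_norm_le[of z 0 "c - d"] is_symbol_diff[of z S c S d] by simp

text \<open>Symbols are dominated by operator norms, so along a convergent sequence of operators they form
  a Cauchy sequence.\<close>

lemma is_symbol_limit:
  assumes z: "norm z = 1" and S: "S \<longlonglongrightarrow> T" and c: "\<And>n. is_symbol z (S n) (c n)"
  shows "\<exists>d. is_symbol z T d"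
proof -
  have diff: "norm (c i - c j) \<le> norm (S i - S j)" for i j
    by (intro is_symbol_norm_le[OF z] is_symbol_diff c)
  have "Cauchy c"
  proof (rule CauchyI)
    fix e :: real assume "0 < e"
    then obtain M where "\<And>i j. i \<ge> M \<Longrightarrow> j \<ge> M \<Longrightarrow> norm (S i - S j) < e"
      using CauchyD[OF LIMSEQ_imp_Cauchy[OF S]] by blast
    then show "\<exists>M. \<forall>i\<ge>M. \<forall>j\<ge>M. norm (c i - c j) < e"
      using diff by (meson le_less_trans)
  qed
  then obtain d where d: "c \<longlonglongrightarrow> d" using Cauchy_convergent convergent_def by blast
  have "is_symbol z T d"
    unfolding is_symbol_def
  proof (rule tendstoI)
    fix e :: real assume e: "0 < e"
    have "eventually (\<lambda>n. norm (S n - T) < e / 3) sequentially" "eventually (\<lambda>n. norm (c n - d) < e / 3) sequentially"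
      using tendstoD[OF S, of "e / 3"] tendstoD[OF d, of "e / 3"] e by (simp_all add: dist_norm)
    then obtain n where n: "norm (S n - T) < e / 3" "norm (c n - d) < e / 3"
      using eventually_happens'[OF sequentially_bot eventually_conj] by blast
    have "eventually (\<lambda>x. norm (S n x - cscale (c n) x) < e / 3) (eigen_filter z)"
      using tendstoD[OF c[of n, unfolded is_symbol_def], of "e / 3"] e by (simp add: dist_norm)
    then show "eventually (\<lambda>x. dist (T x - cscale d x) 0 < e) (eigen_filter z)"
      using eventually_unit
    proof (rule eventually_elim2)
      fix x :: ell2 assume a: "norm (S n x - cscale (c n) x) < e / 3" and x: "norm x = 1"
      have "T x - cscale d x = (S n x - cscale (c n) x) - (S n - T) x + cscale (c n - d) x"
        by (simp add: blinfun.diff_left cscale_diff_left)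
      then have "norm (T x - cscale d x) \<le> norm (S n x - cscale (c n) x) + norm ((S n - T) x) + norm (cscale (c n - d) x)"
        using norm_triangle_ineq[of "S n x - cscale (c n) x - (S n - T) x" "cscale (c n - d) x"]
          norm_triangle_ineq4[of "S n x - cscale (c n) x" "(S n - T) x"] by simp
      also have "norm ((S n - T) x) \<le> norm (S n - T)" using norm_blinfun[of "S n - T" x] x by simp
      also have "norm (cscale (c n - d) x) = norm (c n - d)" using x by (simp add: norm_cscale)
      finally show "dist (T x - cscale d x) 0 < e" using a n by simp
    qed
  qed
  then show ?thesis ..
qed

text \<open>The restriction to the circle makes symbols elements of the function algebra, whose members
  are \<open>undefined\<close> elsewhere.\<close>

definition symbol :: "oper \<Rightarrow> complex \<Rightarrow> complex"
  where "symbol S = (\<lambda>z\<in>sphere 0 1. THE c. is_symbol z S c)"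

lemma symbol_extensional: "symbol S \<in> extensional (sphere 0 1)"
  by (simp add: symbol_def)

lemma symbol_eqI: "norm z = 1 \<Longrightarrow> is_symbol z S c \<Longrightarrow> symbol S z = c"
  by (auto simp: symbol_def intro: is_symbol_unique)

lemma is_symbol_symbol:
  assumes z: "norm z = 1" and S: "S \<in> carrier (cstar N)"
  shows "is_symbol z S (symbol S z)"
proof -
  have "carrier (cstar N) \<subseteq> {S \<in> bounded_operators. \<exists>c. is_symbol z S c}"
  proof (rule cstar_subset[OF N_bounded])
    show "closed {S \<in> bounded_operators. \<exists>c. is_symbol z S c}"
      unfolding closed_sequential_limits
    proof (intro allI impI, elim conjE)
      fix X l assume X: "\<forall>n. X n \<in> {S \<in> bounded_operators. \<exists>c. is_symbol z S c}" "X \<longlonglongrightarrow> l"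
      then obtain c where "\<And>n. is_symbol z (X n) (c n)" by simp metis
      then have "\<exists>d. is_symbol z l d" by (rule is_symbol_limit[OF z X(2)])
      moreover have "l \<in> bounded_operators"
        by (rule closed_sequentially[OF closed_bounded_operators _ X(2)]) (use X(1) in auto)
      ultimately show "l \<in> {S \<in> bounded_operators. \<exists>c. is_symbol z S c}" by simp
    qed
  qed (auto intro: is_symbol_add is_symbol_compose is_symbol_oscale is_symbol_id is_symbol_N
      is_symbol_adj_N id_bounded_operator bounded_operators_closure oscale_bounded_operator
      N_bounded adj_bounded_operator)
  then show ?thesis using S symbol_eqI[OF z] by force
qed

lemma symbol_simps:
  assumes "norm z = 1" "S \<in> carrier (cstar N)"
  shows "R \<in> carrier (cstar N) \<Longrightarrow> symbol (S + R) z = symbol S z + symbol R z"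
    and "R \<in> carrier (cstar N) \<Longrightarrow> symbol (S - R) z = symbol S z - symbol R z"
    and "R \<in> carrier (cstar N) \<Longrightarrow> symbol (S o\<^sub>L R) z = symbol S z * symbol R z"
    and "symbol (oscale c S) z = c * symbol S z"
    and "symbol (adj S) z = cnj (symbol S z)"
    and "norm (symbol S z) \<le> norm S"
proof -
  note sym = is_symbol_symbol[OF assms(1)]
  show "R \<in> carrier (cstar N) \<Longrightarrow> symbol (S + R) z = symbol S z + symbol R z"
    "R \<in> carrier (cstar N) \<Longrightarrow> symbol (S - R) z = symbol S z - symbol R z"
    "R \<in> carrier (cstar N) \<Longrightarrow> symbol (S o\<^sub>L R) z = symbol S z * symbol R z"
    "symbol (oscale c S) z = c * symbol S z"
    using sym assms by (auto intro!: symbol_eqI is_symbol_add is_symbol_diff is_symbol_compose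
        is_symbol_oscale cstar_bounded[OF N_bounded])
  show "norm (symbol S z) \<le> norm S"
    by (rule is_symbol_norm_le[OF assms(1) sym[OF assms(2)]])
  define c where "c = symbol S z"
  define d where "d = symbol (adj S) z"
  have lim: "((\<lambda>x. cinner (T x - cscale a x) x) \<longlongrightarrow> 0) (eigen_filter z)" if "is_symbol z T a" for T a
  proof (rule Lim_null_comparison)
    show "eventually (\<lambda>x. norm (cinner (T x - cscale a x) x) \<le> norm (T x - cscale a x)) (eigen_filter z)"
      using eventually_unit
    proof (rule eventually_mono)
      fix x :: ell2 assume "norm x = 1"
      then show "norm (cinner (T x - cscale a x) x) \<le> norm (T x - cscale a x)"
        using norm_cinner_le[of "T x - cscale a x" x] by simp
    qed
    show "((\<lambda>x. norm (T x - cscale a x)) \<longlongrightarrow> 0) (eigen_filter z)"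
      using that unfolding is_symbol_def by (rule tendsto_norm_zero)
  qed
  \<comment> \<open>The diagonal values \<open>cinner (S x) x\<close> tend to \<open>c\<close>; those of the adjoint, which are their
    conjugates, tend to \<open>d\<close>.\<close>
  have "((\<lambda>x. cinner (adj S x - cscale d x) x - cnj (cinner (S x - cscale c x) x)) \<longlongrightarrow> 0 - cnj 0) (eigen_filter z)"
    using sym[OF assms(2)] sym[OF cstar_adj[OF N_bounded assms(2)]] unfolding c_def d_def
    by (intro tendsto_diff tendsto_cnj lim)
  moreover have "eventually (\<lambda>x. cinner (adj S x - cscale d x) x - cnj (cinner (S x - cscale c x) x) = cnj c - d) (eigen_filter z)"
    using eventually_unit
  proof (rule eventually_mono)
    fix x :: ell2 assume x: "norm x = 1"
    have "cinner (adj S x) x = cnj (cinner (S x) x)"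
      using cinner_adj'[OF cstar_bounded[OF N_bounded assms(2)]] cinner_commute by metis
    then show "cinner (adj S x - cscale d x) x - cnj (cinner (S x - cscale c x) x) = cnj c - d"
      using x by (simp add: cinner_diff_left cinner_cscale_left cinner_self)
  qed
  ultimately have "((\<lambda>_. cnj c - d) \<longlongrightarrow> 0) (eigen_filter z)"
    by (simp add: tendsto_cong)
  then have "cnj c - d = 0"
    using tendsto_const_iff[OF eigen_filter_nontrivial[OF assms(1)]] by blast
  then show "symbol (adj S) z = cnj (symbol S z)" by (simp add: c_def d_def)
qed

lemma symbol_toeplitz: "norm z = 1 \<Longrightarrow> symbol (toeplitz E c) z = (\<Sum>l\<in>E. c l * z powi l)"
  by (intro symbol_eqI is_symbol_toeplitz)

lemma symbol_tendsto:
  assumes "norm z = 1" "\<And>n. S n \<in> carrier (cstar N)" "S \<longlonglongrightarrow> T"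
  shows "(\<lambda>n. symbol (S n) z) \<longlonglongrightarrow> symbol T z"
proof -
  have T: "T \<in> carrier (cstar N)"
    using closed_sequentially[OF cstar_closed[OF N_bounded]] assms(2,3) by blast
  have "norm (symbol (S n) z - symbol T z) \<le> norm (S n - T)" for n
    using symbol_simps(2,6)[OF assms(1)] assms(2) T cstar_diff[OF N_bounded] by metis
  moreover have "(\<lambda>n. norm (S n - T)) \<longlonglongrightarrow> 0"
    using assms(3) by (simp add: LIM_zero tendsto_norm_zero)
  ultimately have "(\<lambda>n. symbol (S n) z - symbol T z) \<longlonglongrightarrow> 0"
    by (intro Lim_null_comparison[of "\<lambda>n. symbol (S n) z - symbol T z"]) auto
  then show ?thesis by (rule LIM_zero_cancel)
qed

lemma symbol_continuous:
  assumes "S \<in> carrier (cstar N)"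
  shows "continuous_on (sphere 0 1) (symbol S)"
proof -
  define Q where "Q = {S \<in> carrier (cstar N). continuous_on (sphere 0 1) (symbol S)}"
  have eq: "continuous_on (sphere 0 1) (symbol S) \<longleftrightarrow> continuous_on (sphere 0 1) f"
    if "\<And>z. norm z = 1 \<Longrightarrow> symbol S z = f z" for S f
    using that by (intro continuous_on_cong) auto
  have "carrier (cstar N) \<subseteq> Q"
  proof (rule cstar_subset[OF N_bounded])
    show "Q \<subseteq> bounded_operators" by (auto simp: Q_def cstar_bounded[OF N_bounded])
    show "closed Q"
      unfolding closed_sequential_limits
    proof (intro allI impI, elim conjE)
      fix X l assume X: "\<forall>n. X n \<in> Q" "X \<longlonglongrightarrow> l"
      have l: "l \<in> carrier (cstar N)"
        by (rule closed_sequentially[OF cstar_closed[OF N_bounded] _ X(2)]) (use X(1) in \<open>auto simp: Q_def\<close>)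
      have "uniform_limit (sphere 0 1) (\<lambda>n. symbol (X n)) (symbol l) sequentially"
      proof (rule uniform_limitI)
        fix e :: real assume "0 < e"
        with X(2) have "eventually (\<lambda>n. norm (X n - l) < e) sequentially"
          by (simp add: tendsto_iff dist_norm)
        then show "eventually (\<lambda>n. \<forall>z\<in>sphere 0 1. dist (symbol (X n) z) (symbol l z) < e) sequentially"
        proof (rule eventually_mono, intro ballI)
          fix n z assume n: "norm (X n - l) < e" and z: "z \<in> sphere (0::complex) 1"
          have Xn: "X n \<in> carrier (cstar N)" using X(1) by (simp add: Q_def)
          then have "norm (symbol (X n) z - symbol l z) \<le> norm (X n - l)"
            using symbol_simps(2)[of z, OF _ Xn l] symbol_simps(6)[of z, OF _ cstar_diff[OF N_bounded Xn l]] z by simp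
          then show "dist (symbol (X n) z) (symbol l z) < e" using n by (simp add: dist_norm)
        qed
      qed
      then have "continuous_on (sphere 0 1) (symbol l)"
        by (rule uniform_limit_theorem[rotated]) (use X(1) in \<open>auto simp: Q_def\<close>)
      then show "l \<in> Q" using l by (simp add: Q_def)
    qed
    show "id_blinfun \<in> Q" "N \<in> Q" "adj N \<in> Q"
      unfolding Q_def
      using eq[of id_blinfun "\<lambda>_. 1"] eq[of N "\<lambda>z. z"] eq[of "adj N" cnj]
      by (auto simp: symbol_eqI is_symbol_id is_symbol_N is_symbol_adj_N cstar_id N_bounded
          N_in_cstar adj_N_in_cstar intro!: continuous_intros)
    fix S R assume S: "S \<in> Q" and R: "R \<in> Q"
    then show "S + R \<in> Q" "S o\<^sub>L R \<in> Q"
      using eq[of "S + R" "\<lambda>z. symbol S z + symbol R z"] eq[of "S o\<^sub>L R" "\<lambda>z. symbol S z * symbol R z"]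
      by (auto simp: Q_def symbol_simps cstar_add cstar_comp N_bounded intro!: continuous_intros)
  next
    fix S c assume "S \<in> Q"
    then show "oscale c S \<in> Q"
      using eq[of "oscale c S" "\<lambda>z. c * symbol S z"]
      by (auto simp: Q_def symbol_simps cstar_scale N_bounded intro!: continuous_intros)
  qed
  then show ?thesis using assms by (auto simp: Q_def)
qed

lemma symbol_hom: "symbol \<in> Ring.ring_hom (cstar N) (continuous_function_algebra (sphere 0 1))"
proof (rule ring_hom_memI)
  fix S R assume S: "S \<in> carrier (cstar N)" and R: "R \<in> carrier (cstar N)"
  show "symbol S \<in> carrier (continuous_function_algebra (sphere 0 1))"
    using symbol_continuous[OF S] by (simp add: continuous_function_algebra_def symbol_extensional)
  show "symbol (S \<otimes>\<^bsub>cstar N\<^esub> R) = symbol S \<otimes>\<^bsub>continuous_function_algebra (sphere 0 1)\<^esub> symbol R"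
    "symbol (S \<oplus>\<^bsub>cstar N\<^esub> R) = symbol S \<oplus>\<^bsub>continuous_function_algebra (sphere 0 1)\<^esub> symbol R"
    unfolding continuous_function_algebra_def using S R
    by (auto intro!: extensionalityI[of _ "sphere 0 1"] simp: symbol_simps symbol_extensional)
next
  show "symbol \<one>\<^bsub>cstar N\<^esub> = \<one>\<^bsub>continuous_function_algebra (sphere 0 1)\<^esub>"
    unfolding continuous_function_algebra_def
    by (auto intro!: extensionalityI[of _ "sphere 0 1"] symbol_eqI is_symbol_id simp: symbol_extensional)
qed

text \<open>Toeplitz operators with Laurent polynomial symbols are no larger than their symbols, so a
  uniformly convergent sequence of such symbols lifts to a norm convergent sequence of operators.\<close>

lemma symbol_surj: "symbol ` carrier (cstar N) = carrier (continuous_function_algebra (sphere 0 1))"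
proof (intro equalityI subsetI)
  fix f :: "complex \<Rightarrow> complex" assume "f \<in> carrier (continuous_function_algebra (sphere 0 1))"
  then have f: "f \<in> extensional (sphere 0 1)" "continuous_on (sphere 0 1) f"
    by (simp_all add: continuous_function_algebra_def)
  have "\<exists>E c. finite E \<and> (\<forall>l. l \<notin> E \<longrightarrow> c l = 0) \<and>
      (\<forall>z. norm z = 1 \<longrightarrow> norm (f z - (\<Sum>l\<in>E. c l * z powi l)) < 1 / real (Suc n))" for n
  proof -
    have "0 < 1 / real (Suc n)" by simp
    then obtain q where q: "laurent_on_circle q" "\<And>z. norm z = 1 \<Longrightarrow> norm (f z - q z) < 1 / real (Suc n)"
      using laurent_approximation[OF f(2)] by blast
    from q(1) obtain E c where "finite E" "\<And>l. l \<notin> E \<Longrightarrow> c l = 0"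
      "\<And>z. norm z = 1 \<Longrightarrow> q z = (\<Sum>l\<in>E. c l * z powi l)"
      by (rule laurent_coefficients) blast
    with q(2) show ?thesis by (intro exI[of _ E] exI[of _ c]) simp
  qed
  then obtain E c where E: "\<And>n. finite (E n)" and supp: "\<And>n l. l \<notin> E n \<Longrightarrow> c n l = 0"
    and approx: "\<And>n z. norm z = 1 \<Longrightarrow> norm (f z - (\<Sum>l\<in>E n. c n l * z powi l)) < 1 / real (Suc n)"
    by metis
  define S where "S n = toeplitz (E n) (c n)" for n
  have S: "S n \<in> carrier (cstar N)" for n unfolding S_def by (rule toeplitz_in_cstar)
  have diff: "norm (S i - S j) \<le> 1 / real (Suc i) + 1 / real (Suc j)" for i j
  proof -
    have eq: "S i - S j = toeplitz (E i \<union> E j) (\<lambda>l. c i l - c j l)"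
      unfolding S_def by (rule toeplitz_diff[OF E supp E supp])
    show ?thesis
      unfolding eq
    proof (rule norm_toeplitz_le)
    fix z :: complex assume z: "norm z = 1"
    have ext: "(\<Sum>l\<in>E i. c i l * z powi l) = (\<Sum>l\<in>E i \<union> E j. c i l * z powi l)"
      "(\<Sum>l\<in>E j. c j l * z powi l) = (\<Sum>l\<in>E i \<union> E j. c j l * z powi l)"
      using E supp by (auto intro!: sum.mono_neutral_left)
    have "norm (\<Sum>l\<in>E i \<union> E j. (c i l - c j l) * z powi l) =
        norm ((f z - (\<Sum>l\<in>E j. c j l * z powi l)) - (f z - (\<Sum>l\<in>E i. c i l * z powi l)))"
      unfolding ext by (simp add: left_diff_distrib sum_subtractf)
    also have "\<dots> \<le> norm (f z - (\<Sum>l\<in>E j. c j l * z powi l)) + norm (f z - (\<Sum>l\<in>E i. c i l * z powi l))"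
      by (rule norm_triangle_ineq4)
    also have "\<dots> \<le> 1 / real (Suc i) + 1 / real (Suc j)"
      using approx[OF z, of i] approx[OF z, of j] by simp
    finally show "norm (\<Sum>l\<in>E i \<union> E j. (c i l - c j l) * z powi l) \<le> 1 / real (Suc i) + 1 / real (Suc j)" .
    qed (use E supp in auto)
  qed
  have inv_lim: "(\<lambda>n. 1 / real (Suc n)) \<longlonglongrightarrow> 0"
    by (rule LIMSEQ_Suc[OF lim_const_over_n])
  have "Cauchy S"
  proof (rule CauchyI)
    fix e :: real assume e: "0 < e"
    then obtain M where M: "\<And>n. n \<ge> M \<Longrightarrow> norm (1 / real (Suc n)) < e / 2"
      using LIMSEQ_D[OF inv_lim, of "e / 2"] by auto
    have "norm (S i - S j) < e" if "i \<ge> M" "j \<ge> M" for i j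
      using diff[of i j] M[OF that(1)] M[OF that(2)] by simp
    then show "\<exists>M. \<forall>i\<ge>M. \<forall>j\<ge>M. norm (S i - S j) < e" by blast
  qed
  then obtain T where T: "S \<longlonglongrightarrow> T" using Cauchy_convergent convergent_def by blast
  have T_in: "T \<in> carrier (cstar N)"
    by (rule closed_sequentially[OF cstar_closed[OF N_bounded] _ T]) (use S in auto)
  have "symbol T = f"
  proof (rule extensionalityI[OF symbol_extensional f(1)])
    fix z :: complex assume "z \<in> sphere 0 1"
    then have z: "norm z = 1" by simp
    have "(\<lambda>n. f z - symbol (S n) z) \<longlonglongrightarrow> 0"
      using approx[OF z]
      by (intro Lim_null_comparison[OF _ inv_lim]) (auto simp: S_def symbol_toeplitz[OF z] less_imp_le)
    then have "(\<lambda>n. f z - symbol (S n) z) \<longlonglongrightarrow> 0 \<and> (\<lambda>n. f z - symbol (S n) z) \<longlonglongrightarrow> f z - symbol T z"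
      by (intro conjI tendsto_diff tendsto_const symbol_tendsto z S T)
    then show "symbol T z = f z" using LIMSEQ_unique by force
  qed
  then show "f \<in> symbol ` carrier (cstar N)" using T_in by blast
next
  fix f assume "f \<in> symbol ` carrier (cstar N)"
  then show "f \<in> carrier (continuous_function_algebra (sphere 0 1))"
    using symbol_hom by (auto simp: Ring.ring_hom_def)
qed

text \<open>Testing a representative on approximate eigenvectors bounds the matrix of symbols from above by
  its norm, and Toeplitz sections of the symbol matrix bound the norm over the operator system.\<close>

lemma symbol_isometric:
  assumes A: "\<And>i j. i < n \<Longrightarrow> j < n \<Longrightarrow> A i j \<in> operator_system N"
    and CA: "\<And>i j. i < n \<Longrightarrow> j < n \<Longrightarrow> C i j - A i j \<in> carrier (cstar N)"
    and ker: "\<And>i j z. i < n \<Longrightarrow> j < n \<Longrightarrow> norm z = 1 \<Longrightarrow> symbol (C i j - A i j) z = 0"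
  shows "matrix_norm n A \<le> matrix_norm n C"
proof -
  let ?E = "{-1, 0, 1 :: int}"
  define s where "s = matrix_norm n C"
  obtain c where supp: "\<And>i j l. l \<notin> ?E \<Longrightarrow> c i j l = 0"
    and Ac: "\<And>i j. i < n \<Longrightarrow> j < n \<Longrightarrow> A i j = toeplitz ?E (c i j)"
    using operator_system_toeplitz_matrix[of n A, OF A] by metis
  have "toeplitz_bounded n r c s" for r
  proof (rule toeplitz_bounded_symbol[of ?E])
    fix z :: complex and v :: "nat \<Rightarrow> complex" assume z: "norm z = 1"
    define p where "p i j = (\<Sum>l\<in>?E. c i j l * z powi l)" for i j
    define w where "w i = (\<Sum>j<n. p i j * v j)" for i
    have C: "is_symbol z (C i j) (p i j)" if "i < n" "j < n" for i j
    proof -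
      have "is_symbol z (C i j - A i j + A i j) (0 + p i j)"
        using is_symbol_symbol[OF z CA[OF that]] ker[OF that z] is_symbol_toeplitz[OF z, of ?E "c i j"] Ac[OF that]
        unfolding p_def by (intro is_symbol_add) simp_all
      then show ?thesis by simp
    qed
    have lim: "((\<lambda>x. norm (\<Sum>j<n. C i j (cscale (v j) x))) \<longlongrightarrow> norm (w i)) (eigen_filter z)" if i: "i < n" for i
    proof -
      have C_bounded: "C i j \<in> bounded_operators" if "j < n" for j
      proof -
        have "C i j - A i j + A i j \<in> bounded_operators"
          using cstar_bounded[OF N_bounded CA[OF i that]] operator_system_bounded[OF N_bounded] A[OF i that]
          by (intro bounded_operators_closure(1)) auto
        then show ?thesis by simp
      qed
      have "is_symbol z (\<Sum>j<n. oscale (v j) (C i j)) (\<Sum>j<n. v j * p i j)"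
        using C[OF i] by (intro is_symbol_sum is_symbol_oscale) auto
      then have "((\<lambda>x. norm ((\<Sum>j<n. oscale (v j) (C i j)) x - cscale (w i) x)) \<longlongrightarrow> 0) (eigen_filter z)"
        unfolding is_symbol_def w_def by (intro tendsto_norm_zero) (simp add: mult.commute)
      moreover have "(\<Sum>j<n. oscale (v j) (C i j)) x = (\<Sum>j<n. C i j (cscale (v j) x))" for x
        by (simp add: blinfun.sum_left oscale_apply bounded_operatorsD[OF C_bounded])
      ultimately have lim0: "((\<lambda>x. norm ((\<Sum>j<n. C i j (cscale (v j) x)) - cscale (w i) x)) \<longlongrightarrow> 0) (eigen_filter z)"
        by simp
      have "((\<lambda>x. norm (\<Sum>j<n. C i j (cscale (v j) x)) - norm (w i)) \<longlongrightarrow> 0) (eigen_filter z)"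
      proof (rule Lim_null_comparison[OF _ lim0])
        show "eventually (\<lambda>x. norm (norm (\<Sum>j<n. C i j (cscale (v j) x)) - norm (w i)) \<le>
            norm ((\<Sum>j<n. C i j (cscale (v j) x)) - cscale (w i) x)) (eigen_filter z)"
          using eventually_unit
        proof (rule eventually_mono)
          fix x :: ell2 assume "norm x = 1"
          then have "norm (w i) = norm (cscale (w i) x)" by (simp add: norm_cscale)
          then show "norm (norm (\<Sum>j<n. C i j (cscale (v j) x)) - norm (w i)) \<le>
              norm ((\<Sum>j<n. C i j (cscale (v j) x)) - cscale (w i) x)"
            using norm_triangle_ineq3 by (simp only: real_norm_def)
        qed
      qed
      then show ?thesis by (rule LIM_zero_cancel)
    qed
    have "((\<lambda>x. \<Sum>i<n. (norm (\<Sum>j<n. C i j (cscale (v j) x)))\<^sup>2) \<longlongrightarrow> (\<Sum>i<n. (norm (w i))\<^sup>2)) (eigen_filter z)"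
      by (intro tendsto_sum tendsto_power lim) simp
    moreover have "eventually (\<lambda>x. (\<Sum>i<n. (norm (\<Sum>j<n. C i j (cscale (v j) x)))\<^sup>2) \<le>
        s\<^sup>2 * (\<Sum>j<n. (norm (v j))\<^sup>2)) (eigen_filter z)"
      using eventually_unit
    proof (rule eventually_mono)
      fix x :: ell2 assume x: "norm x = 1"
      have "(\<Sum>i<n. (norm (\<Sum>j<n. C i j (cscale (v j) x)))\<^sup>2) =
          (L2_set (\<lambda>i. norm (\<Sum>j<n. C i j (cscale (v j) x))) {..<n})\<^sup>2"
        by (simp add: L2_set_def sum_nonneg)
      also have "\<dots> \<le> (s * L2_set (\<lambda>j. norm (cscale (v j) x)) {..<n})\<^sup>2"
        unfolding s_def by (intro power_mono matrix_norm_apply) simp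
      also have "\<dots> = s\<^sup>2 * (\<Sum>j<n. (norm (v j))\<^sup>2)"
        using x by (simp add: L2_set_def sum_nonneg power_mult_distrib norm_cscale)
      finally show "(\<Sum>i<n. (norm (\<Sum>j<n. C i j (cscale (v j) x)))\<^sup>2) \<le> s\<^sup>2 * (\<Sum>j<n. (norm (v j))\<^sup>2)" .
    qed
    ultimately show "(\<Sum>i<n. (norm (\<Sum>j<n. (\<Sum>l\<in>?E. c i j l * z powi l) * v j))\<^sup>2) \<le> s\<^sup>2 * (\<Sum>j<n. (norm (v j))\<^sup>2)"
      unfolding w_def p_def by (rule tendsto_upperbound) (rule eigen_filter_nontrivial[OF z])
  qed (use supp in auto)
  then show ?thesis
    unfolding s_def[symmetric] using supp Ac
    by (intro matrix_norm_toeplitz_le[of s ?E c]) (auto simp: s_def matrix_norm_nonneg)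
qed

lemma N_contraction: "norm (N x) \<le> norm x"
proof -
  have "norm (toeplitz {1} (\<lambda>l. if l = 1 then 1 else 0)) \<le> 1"
    by (rule norm_toeplitz_le) auto
  then have "norm N \<le> 1" by (simp add: toeplitz_def shift_simps)
  then show ?thesis
    using norm_blinfun[of N x] mult_right_mono[of "norm N" 1 "norm x"] by simp
qed

lemma adj_N_contraction: "norm (adj N x) \<le> norm x"
proof -
  have "norm N \<le> 1" using N_contraction by (intro norm_blinfun_bound) auto
  then have "norm (adj N) \<le> 1" using norm_adj_le[OF N_bounded] by simp
  then show ?thesis
    using norm_blinfun[of "adj N" x] mult_right_mono[of "norm (adj N)" 1 "norm x"] by simp
qed

lemma norm_diff_sq: "(norm (x - y))\<^sup>2 = (norm x)\<^sup>2 + (norm y)\<^sup>2 - 2 * Re (cinner x y)" for x y :: ell2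
  unfolding Re_cinner
  by (simp add: power2_norm_eq_inner inner_diff_left inner_diff_right inner_commute)

text \<open>Expanding the square on the left gives two terms of size at most 1 and the cross term
  \<open>- 2 Re (z * cinner x (N x))\<close>, which is close to \<open>- 2\<close> if \<open>N x\<close> is close to \<open>z x\<close>. So approximate
  eigenvectors of the shift for \<open>z\<close> need not be tested on the adjoint.\<close>

lemma adj_N_approx_eigen:
  assumes z: "norm z = 1" and x: "norm x = 1"
  shows "(norm (adj N x - cscale (cnj z) x))\<^sup>2 \<le> 2 * norm (N x - cscale z x)"
proof -
  define e where "e = N x - cscale z x"
  have zz: "z * cnj z = 1" using circle_power_cancel[OF z, of 1] by (simp add: mult.commute)
  have "cinner (adj N x) (cscale (cnj z) x) = z * cinner x (N x)"
    by (simp add: cinner_cscale_right cinner_adj'[OF N_bounded])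
  also have "N x = cscale z x + e" by (simp add: e_def)
  also have "z * cinner x (cscale z x + e) = 1 + z * cinner x e"
    using x zz by (simp add: cinner_add_right cinner_cscale_right cinner_self distrib_left flip: mult.assoc)
  finally have re: "Re (cinner (adj N x) (cscale (cnj z) x)) = 1 + Re (z * cinner x e)" by simp
  have "\<bar>Re (z * cinner x e)\<bar> \<le> norm (z * cinner x e)" by (rule abs_Re_le_cmod)
  also have "\<dots> \<le> norm e" using norm_cinner_le[of x e] z x by (simp add: norm_mult)
  finally have re2: "\<bar>Re (z * cinner x e)\<bar> \<le> norm e" .
  have "(norm (adj N x))\<^sup>2 \<le> 1" using adj_N_contraction[of x] x by (simp add: power_le_one)
  moreover have "norm (cscale (cnj z) x) = 1" using z x by (simp add: norm_cscale)
  ultimately show ?thesis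
    unfolding norm_diff_sq re e_def[symmetric] using re2 by (simp add: abs_le_iff)
qed

lemma norm_almost_attained:
  fixes G :: oper
  assumes "0 \<le> c" "c < norm G"
  obtains x where "norm x = 1" "c < norm (G x)"
proof -
  have "\<exists>x. c * norm x < norm (G x)"
  proof (rule ccontr)
    assume "\<not> ?thesis"
    then have "norm G \<le> c" using assms(1) by (intro norm_blinfun_bound) (auto simp: not_less)
    with assms(2) show False by simp
  qed
  then obtain x where x: "c * norm x < norm (G x)" ..
  then have "x \<noteq> 0" by auto
  then have "norm (inverse (norm x) *\<^sub>R x) = 1" "c < norm (G (inverse (norm x) *\<^sub>R x))"
    using x by (simp_all add: blinfun.scaleR_right field_simps)
  then show thesis by (rule that)
qed

text \<open>Let \<open>S\<close> lie in a boundary ideal. The operator \<open>A = 1 + cnj z N\<close> has norm 2, so every element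
  of its coset, in particular \<open>A (1 - b S* S)\<close>, has norm at least 2. Unit vectors on which the latter
  almost attains the norm 2 are annihilated by \<open>S\<close> in the limit, because \<open>1 - b S* S\<close> is a positive contraction for small \<open>b\<close>, and are
  approximate eigenvectors for \<open>z\<close> by uniform convexity. On such vectors \<open>S\<close> acts as its symbol,
  which therefore vanishes at \<open>z\<close>.\<close>

lemma symbol_maximal:
  assumes L: "boundary_ideal N L" and S: "S \<in> L" and z: "norm z = 1"
  shows "symbol S z = 0"
proof -
  have S': "S \<in> carrier (cstar N)" by (rule boundary_ideal_subset[OF L S])
  have zz: "cnj z * z = 1" using circle_power_cancel[OF z, of 1] by simp
  define A where "A = oscale 1 id_blinfun + oscale (cnj z) N + oscale 0 (adj N)"
  have A: "A \<in> operator_system N" unfolding A_def by (rule operator_systemI)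
  have A_apply: "A x = x + cscale (cnj z) (N x)" for x
    by (simp add: A_def blinfun.add_left oscale_apply)
  have A_le: "norm (A x) \<le> 2 * norm x" for x
    unfolding A_apply using norm_triangle_ineq[of x "cscale (cnj z) (N x)"] N_contraction[of x] z
    by (simp add: norm_cscale)
  have "is_symbol z A (1 * 1 + cnj z * z + 0 * cnj z)"
    unfolding A_def by (intro is_symbol_add is_symbol_oscale is_symbol_id is_symbol_N is_symbol_adj_N)
  then have "2 \<le> norm A" using is_symbol_norm_le[OF z] zz by fastforce
  \<comment> \<open>This makes \<open>b S* S\<close> a positive contraction.\<close>
  define b where "b = 1 / (1 + (norm S)\<^sup>2)"
  have den: "0 < 1 + (norm S)\<^sup>2" by (intro add_pos_nonneg) auto
  then have b: "0 < b" "b * (norm S)\<^sup>2 \<le> 1" by (simp_all add: b_def)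
  define D where "D = oscale (of_real b) (adj S) o\<^sub>L S"
  have D: "D \<in> L"
    unfolding D_def by (intro boundary_ideal_left[OF L S] cstar_scale cstar_adj N_bounded S')
  have D_apply: "D x = cscale (of_real b) (adj S (S x))" for x by (simp add: D_def oscale_apply)
  have adjS: "norm (adj S y) \<le> norm S * norm y" for y
    using norm_blinfun[of "adj S" y] norm_adj_le[OF cstar_bounded[OF N_bounded S']]
      mult_right_mono[of "norm (adj S)" "norm S" "norm y"] by simp
  define G where "G = A + (oscale (-1) A o\<^sub>L D)"
  have "norm A \<le> norm G"
    unfolding G_def using A operator_system_subset_cstar
    by (intro boundary_ideal_norm_le[OF L A] boundary_ideal_left[OF L D] cstar_scale N_bounded) auto
  with \<open>2 \<le> norm A\<close> have G: "2 \<le> norm G" by simp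
  have G_apply: "G x = A (x - D x)" for x
    by (simp add: G_def blinfun.add_left blinfun.diff_right oscale_minus_one blinfun.minus_left)
  have defect: "(norm (x - D x))\<^sup>2 \<le> 1 - b * (norm (S x))\<^sup>2" if x: "norm x = 1" for x
  proof -
    have "cinner x (D x) = of_real b * cinner (S x) (S x)"
      unfolding D_apply cinner_cscale_right
      using cinner_adj[OF cstar_bounded[OF N_bounded S'], of x "S x"] by simp
    then have re: "Re (cinner x (D x)) = b * (norm (S x))\<^sup>2" by (simp add: cinner_self)
    have "norm (D x) \<le> b * (norm S * norm (S x))"
      using adjS[of "S x"] b by (simp add: D_apply norm_cscale mult_left_mono)
    then have "(norm (D x))\<^sup>2 \<le> (b * (norm S * norm (S x)))\<^sup>2" by (intro power_mono) auto
    also have "\<dots> = (b * (norm S)\<^sup>2) * (b * (norm (S x))\<^sup>2)"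
      by (simp add: power2_eq_square)
    also have "\<dots> \<le> 1 * (b * (norm (S x))\<^sup>2)" using b by (intro mult_right_mono) auto
    finally show ?thesis unfolding norm_diff_sq re using x by simp
  qed
  define \<epsilon> where "\<epsilon> n = 1 / real (Suc n)" for n
  have \<epsilon>_lim: "\<epsilon> \<longlonglongrightarrow> 0" unfolding \<epsilon>_def by (rule LIMSEQ_Suc[OF lim_const_over_n])
  have \<epsilon>: "0 < \<epsilon> n" "\<epsilon> n \<le> 1" for n by (simp_all add: \<epsilon>_def)
  have "\<exists>x. norm x = 1 \<and> 2 - \<epsilon> n < norm (G x)" for n
    by (rule norm_almost_attained[of "2 - \<epsilon> n" G]) (use G \<epsilon>[of n] in auto)
  then obtain u where u: "\<And>n. norm (u n) = 1" "\<And>n. 2 - \<epsilon> n < norm (G (u n))" by metis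
  have "b * (norm (S (u n)))\<^sup>2 \<le> \<epsilon> n" for n
  proof -
    have "2 - \<epsilon> n \<le> 2 * norm (u n - D (u n))"
      using u(2)[of n] A_le[of "u n - D (u n)"] by (simp add: G_apply)
    then have "(2 - \<epsilon> n)\<^sup>2 \<le> (2 * norm (u n - D (u n)))\<^sup>2" using \<epsilon>[of n] by (intro power_mono) auto
    also have "\<dots> \<le> 4 * (1 - b * (norm (S (u n)))\<^sup>2)"
      using defect[OF u(1)[of n]] by (simp add: power_mult_distrib)
    finally have "4 * (b * (norm (S (u n)))\<^sup>2) \<le> 4 * \<epsilon> n - (\<epsilon> n)\<^sup>2"
      by (simp add: power2_eq_square algebra_simps)
    then show ?thesis using zero_le_power2[of "\<epsilon> n"] by linarith
  qed
  then have "(norm (S (u n)))\<^sup>2 \<le> \<epsilon> n / b" for n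
    using b by (simp add: field_simps)
  then have "(\<lambda>n. (norm (S (u n)))\<^sup>2) \<longlonglongrightarrow> 0"
    by (intro Lim_null_comparison[OF _ tendsto_divide_zero[OF \<epsilon>_lim, of b]]) auto
  then have "(\<lambda>n. sqrt ((norm (S (u n)))\<^sup>2)) \<longlonglongrightarrow> sqrt 0" by (rule tendsto_real_sqrt)
  then have "(\<lambda>n. norm (S (u n))) \<longlonglongrightarrow> 0" by simp
  then have Su: "(\<lambda>n. S (u n)) \<longlonglongrightarrow> 0" by (rule tendsto_norm_zero_cancel)
  then have "(\<lambda>n. D (u n)) \<longlonglongrightarrow> cscale (of_real b) (adj S 0)"
    unfolding D_apply by (intro bounded_linear.tendsto[OF bounded_linear_cscale] blinfun.tendsto tendsto_const)
  then have Du: "(\<lambda>n. norm (D (u n))) \<longlonglongrightarrow> 0" by (simp add: tendsto_norm_zero)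
  \<comment> \<open>Since \<open>u n\<close> and \<open>cnj z N (u n)\<close> are in the unit ball and their sum has norm close to 2, the
    parallelogram law makes their difference small.\<close>
  have "(norm (u n - cscale (cnj z) (N (u n))))\<^sup>2 \<le> 4 * (\<epsilon> n + 2 * norm (D (u n)))" for n
  proof -
    define y where "y = cscale (cnj z) (N (u n))"
    have y: "(norm y)\<^sup>2 \<le> 1"
      using N_contraction[of "u n"] z u(1)[of n] by (simp add: y_def norm_cscale power_le_one)
    define \<delta> where "\<delta> = \<epsilon> n + 2 * norm (D (u n))"
    have Auy: "norm (A (u n)) = norm (u n + y)" by (simp add: A_apply y_def)
    have "norm (G (u n)) \<le> norm (A (u n)) + norm (A (D (u n)))"
      unfolding G_apply blinfun.diff_right by (rule norm_triangle_ineq4)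
    then have low: "2 - \<delta> \<le> norm (u n + y)"
      using u(2)[of n] A_le[of "D (u n)"] Auy by (simp add: \<delta>_def)
    have "4 - 4 * \<delta> \<le> (norm (u n + y))\<^sup>2"
    proof (cases "\<delta> \<le> 2")
      case True
      then have "(2 - \<delta>)\<^sup>2 \<le> (norm (u n + y))\<^sup>2" using low by (intro power_mono) auto
      moreover have "(2 - \<delta>)\<^sup>2 = 4 - 4 * \<delta> + \<delta>\<^sup>2" by (simp add: power2_diff)
      ultimately show ?thesis using zero_le_power2[of \<delta>] by linarith
    next
      case False
      then show ?thesis using zero_le_power2[of "norm (u n + y)"] by linarith
    qed
    moreover have "(norm (u n - y))\<^sup>2 + (norm (u n + y))\<^sup>2 = 2 * (norm (u n))\<^sup>2 + 2 * (norm y)\<^sup>2"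
      by (simp add: power2_norm_eq_inner inner_diff_left inner_diff_right inner_add_left inner_add_right inner_commute)
    ultimately show ?thesis using y u(1)[of n] by (simp add: y_def \<delta>_def)
  qed
  moreover have lim4: "(\<lambda>n. 4 * (\<epsilon> n + 2 * norm (D (u n)))) \<longlonglongrightarrow> 0"
    using tendsto_mult_left[OF tendsto_add[OF \<epsilon>_lim tendsto_mult_left[OF Du, of 2]], of 4] by simp
  ultimately have "(\<lambda>n. (norm (u n - cscale (cnj z) (N (u n))))\<^sup>2) \<longlonglongrightarrow> 0"
    by (intro Lim_null_comparison[OF _ lim4]) auto
  then have "(\<lambda>n. sqrt ((norm (u n - cscale (cnj z) (N (u n))))\<^sup>2)) \<longlonglongrightarrow> sqrt 0" by (rule tendsto_real_sqrt)
  moreover have "norm (N x - cscale z x) = norm (x - cscale (cnj z) (N x))" for x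
  proof -
    have "N x - cscale z x = cscale (- z) (x - cscale (cnj z) (N x))"
    proof (rule ell2_eqI)
      fix n
      have "z * (cnj z * coord (N x) n) = coord (N x) n"
        using zz by (simp add: mult.commute[of z] flip: mult.assoc)
      then show "coord (N x - cscale z x) n = coord (cscale (- z) (x - cscale (cnj z) (N x))) n"
        by (simp add: coord_diff coord_cscale right_diff_distrib)
    qed
    then show ?thesis using z by (simp add: norm_cscale)
  qed
  ultimately have eig: "(\<lambda>n. norm (N (u n) - cscale z (u n))) \<longlonglongrightarrow> 0" by simp
  have "(\<lambda>n. 2 * norm (N (u n) - cscale z (u n))) \<longlonglongrightarrow> 0"
    using tendsto_mult_left[OF eig, of 2] by simp
  then have "(\<lambda>n. (norm (adj N (u n) - cscale (cnj z) (u n)))\<^sup>2) \<longlonglongrightarrow> 0"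
    by (rule Lim_null_comparison[rotated]) (use adj_N_approx_eigen[OF z u(1)] in auto)
  then have "(\<lambda>n. sqrt ((norm (adj N (u n) - cscale (cnj z) (u n)))\<^sup>2)) \<longlonglongrightarrow> sqrt 0" by (rule tendsto_real_sqrt)
  then have adj_eig: "(\<lambda>n. norm (adj N (u n) - cscale (cnj z) (u n))) \<longlonglongrightarrow> 0" by simp
  have "filterlim u (eigen_filter z) sequentially"
    unfolding eigen_filter_def filterlim_inf filterlim_filtercomap_iff filterlim_principal o_def
    using tendsto_add[OF eig adj_eig] u(1) by simp
  then have "(\<lambda>n. S (u n) - cscale (symbol S z) (u n)) \<longlonglongrightarrow> 0"
    using is_symbol_symbol[OF z S'] unfolding is_symbol_def by (rule filterlim_compose[rotated])
  then have "(\<lambda>n. S (u n) - (S (u n) - cscale (symbol S z) (u n))) \<longlonglongrightarrow> 0 - 0"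
    by (intro tendsto_diff Su)
  then have "(\<lambda>n. norm (cscale (symbol S z) (u n))) \<longlonglongrightarrow> 0" by (simp add: tendsto_norm_zero)
  then have "(\<lambda>n. norm (symbol S z)) \<longlonglongrightarrow> 0" by (simp add: norm_cscale u(1))
  then show ?thesis by (simp add: LIMSEQ_const_iff)
qed

proposition envelope_unbounded:
  "star_isomorphic (cstar_envelope N) (continuous_function_algebra (sphere 0 1))"
proof -
  let ?C = "continuous_function_algebra (sphere 0 1)"
  have zero_iff: "symbol S = zero ?C \<longleftrightarrow> (\<forall>z. norm z = 1 \<longrightarrow> symbol S z = 0)" for S
  proof -
    have "symbol S = zero ?C" if "\<And>z. norm z = 1 \<Longrightarrow> symbol S z = 0"
      unfolding continuous_function_algebra_def
      using that by (auto intro!: extensionalityI[of _ "sphere 0 1"] simp: symbol_extensional)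
    moreover have "symbol S z = 0" if "symbol S = zero ?C" "norm z = 1" for z
      using that by (simp add: continuous_function_algebra_def)
    ultimately show ?thesis by blast
  qed
  show ?thesis
  proof (rule cstar_envelope_isomorphic[OF N_bounded symbol_hom symbol_surj])
    show "symbol 0 = zero ?C"
      unfolding zero_iff by (auto intro: symbol_eqI is_symbol_zero)
    fix S assume S: "S \<in> carrier (cstar N)"
    show "symbol (oscale c S) = scal ?C c (symbol S)" for c
      unfolding continuous_function_algebra_def using S
      by (auto intro!: extensionalityI[of _ "sphere 0 1"] simp: symbol_extensional symbol_simps)
    show "symbol (adj S) = star ?C (symbol S)"
      unfolding continuous_function_algebra_def using S
      by (auto intro!: extensionalityI[of _ "sphere 0 1"] simp: symbol_extensional symbol_simps)
  next
    show "closed {S \<in> carrier (cstar N). symbol S = zero ?C}"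
      unfolding closed_sequential_limits zero_iff
    proof (intro allI impI, elim conjE)
      fix X l assume X: "\<forall>n. X n \<in> {S \<in> carrier (cstar N). \<forall>z. norm z = 1 \<longrightarrow> symbol S z = 0}" "X \<longlonglongrightarrow> l"
      have "symbol l z = 0" if z: "norm z = 1" for z
      proof -
        have "(\<lambda>n. symbol (X n) z) \<longlonglongrightarrow> symbol l z"
          using X by (intro symbol_tendsto z) auto
        then show ?thesis using X(1) z by (simp add: LIMSEQ_const_iff)
      qed
      moreover have "l \<in> carrier (cstar N)"
        by (rule closed_sequentially[OF cstar_closed[OF N_bounded] _ X(2)]) (use X(1) in auto)
      ultimately show "l \<in> {S \<in> carrier (cstar N). \<forall>z. norm z = 1 \<longrightarrow> symbol S z = 0}" by simp
    qed
  next
    fix n :: nat and A C :: "nat \<Rightarrow> nat \<Rightarrow> oper"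
    assume "\<And>i j. i < n \<Longrightarrow> j < n \<Longrightarrow> A i j \<in> operator_system N"
      "\<And>i j. i < n \<Longrightarrow> j < n \<Longrightarrow> C i j - A i j \<in> carrier (cstar N)"
      "\<And>i j. i < n \<Longrightarrow> j < n \<Longrightarrow> symbol (C i j - A i j) = zero ?C"
    then show "matrix_norm n A \<le> matrix_norm n C"
      unfolding zero_iff by (intro symbol_isometric) auto
  next
    fix L S assume "boundary_ideal N L" "S \<in> L"
    then show "symbol S = zero ?C" unfolding zero_iff by (blast intro: symbol_maximal)
  qed
qed

end

theorem proposition2p2:
  fixes lam :: complex and m :: "nat \<Rightarrow> nat"
  assumes "\<And>k. 0 < m k"
  shows "case (SUP k. enat (m k)) of
      \<infinity> \<Rightarrow> star_isomorphic (cstar_envelope (jordan_sum lam m))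
              (continuous_function_algebra (sphere 0 1))
    | enat M \<Rightarrow> star_isomorphic (cstar_envelope (jordan_sum lam m)) (matrix_algebra M)"
proof -
  interpret nilpotent_sum m by unfold_locales (rule assms)
  show ?thesis
  proof (cases "SUP k. enat (m k)")
    case (enat M)
    have le: "m k \<le> M" for k
      using SUP_upper[of k UNIV "\<lambda>k. enat (m k)"] enat by simp
    have "\<exists>k. m k = M"
    proof (rule ccontr)
      assume "\<not> (\<exists>k. m k = M)"
      then have less: "m k < M" for k using le[of k] by (simp add: le_less)
      have "enat (m k) \<le> enat (M - 1)" for k using less[of k] by simp
      then have "(SUP k. enat (m k)) \<le> enat (M - 1)" by (intro SUP_least)
      then show False using enat less[of 0] by simp
    qed
    then obtain k0 where k0: "m k0 = M" ..
    interpret bounded_nilpotent_sum m M k0 by unfold_locales (use le k0 in auto)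
    show ?thesis using envelope_bounded enat by (simp add: cstar_envelope_jordan_sum)
  next
    case infinity
    have "\<exists>k. n \<le> m k" for n
    proof (rule ccontr)
      assume "\<not> (\<exists>k. n \<le> m k)"
      then have "enat (m k) \<le> enat n" for k by (simp add: not_le less_imp_le)
      then have "(SUP k. enat (m k)) \<le> enat n" by (intro SUP_least)
      then show False using infinity by simp
    qed
    then interpret unbounded_nilpotent_sum m by unfold_locales
    show ?thesis using envelope_unbounded infinity by (simp add: cstar_envelope_jordan_sum)
  qed
qed

end
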